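(* Let $k\geq 2$ be an integer and assume the Generalized Riemann Hypothesis (for the Riemann zeta function and for Dirichlet $L$-functions). Then there exists a multiplicative function $f:\mathbb{N}\to\{-1,0,+1\}$ with support on the $k$-free integers such that $f(p)\in\{-1,+1\}$ for every prime $p$, and such that for every $\varepsilon>0$, $$\sum_{n\leq x}f(n)\ll_{\varepsilon} x^{1/(k+1)+\varepsilon}\quad\text{as }x\to\infty.$$
   Context: A positive integer $n$ is $k$-free if no prime power $p^k$ divides $n$. A function $f$ has support on the $k$-free integers if $f(n)=0$ whenever $n$ is not $k$-free. A function $f:\mathbb{N}\to\mathbb{C}$ is multiplicative if $f(mn)=f(m)f(n)$ whenever $\gcd(m,n)=1$. The Generalized Riemann Hypothesis is the assertion that all non-trivial zeros of $\zeta(s)$ and of every Dirichlet $L$-function $L(s,\chi)$ have real part $1/2$. The notation $A\ll B$ means $|A|\leq CB$ for some constant $C$ (depending on $f$, $k$ and $\varepsilon$) and all sufficiently large $x$. *)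

theory Defs
  imports "HOL-Complex_Analysis.Complex_Analysis" "HOL-Library.Landau_Symbols"
    "HOL-Computational_Algebra.Primes"
begin

definition k_free :: "nat \<Rightarrow> nat \<Rightarrow> bool" where
  "k_free k n \<longleftrightarrow> n > 0 \<and> (\<forall>p. prime p \<longrightarrow> \<not> p ^ k dvd n)"

text \<open>Arithmetic functions live on the positive integers; the value at \<open>0\<close> is irrelevant.\<close>

definition multiplicative_fun :: "(nat \<Rightarrow> 'a::comm_ring_1) \<Rightarrow> bool" where
  "multiplicative_fun f \<longleftrightarrow>
     (\<forall>m n. m > 0 \<and> n > 0 \<and> coprime m n \<longrightarrow> f (m * n) = f m * f n)"

definition dirichlet_character :: "nat \<Rightarrow> (nat \<Rightarrow> complex) \<Rightarrow> bool" where
  "dirichlet_character q \<psi> \<longleftrightarrow>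
     q > 0 \<and>
     (\<forall>n. \<psi> (n + q) = \<psi> n) \<and>
     (\<forall>m n. \<psi> (m * n) = \<psi> m * \<psi> n) \<and>
     (\<forall>n. \<psi> n \<noteq> 0 \<longleftrightarrow> coprime n q)"

definition dirichlet_series :: "(nat \<Rightarrow> complex) \<Rightarrow> complex \<Rightarrow> complex" where
  "dirichlet_series a s = (\<Sum>n. a (Suc n) / of_nat (Suc n) powr s)"

text \<open>
  The analytic continuation of the Dirichlet series of a bounded sequence from \<open>Re z > 1\<close>.
  It is continued through half-planes \<open>Re z > c\<close> punctured at the possible pole \<open>1\<close>. Any two such
  continuations agree on the smaller half-plane (see \<open>dirichlet_continuation_eqI\<close>), and for
  Dirichlet characters \<open>c\<close> can be taken arbitrarily small, so this is the usual function on
  \<open>\<complex> - {1}\<close>. The value at \<open>1\<close> is left unspecified.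
\<close>

definition dirichlet_continuation :: "(nat \<Rightarrow> complex) \<Rightarrow> complex \<Rightarrow> complex" where
  "dirichlet_continuation a s =
     (THE w. \<exists>c F. c < Re s \<and> F holomorphic_on {z. Re z > c} - {1} \<and>
                   (\<forall>z. Re z > 1 \<longrightarrow> F z = dirichlet_series a z) \<and> w = F s)"

lemma dirichlet_continuation_eqI:
  assumes F: "F holomorphic_on {z. Re z > c} - {1}"
    and eqF: "\<And>z. Re z > 1 \<Longrightarrow> F z = dirichlet_series a z"
    and s: "Re s > c" "s \<noteq> 1"
  shows "dirichlet_continuation a s = F s"
  unfolding dirichlet_continuation_def
proof (rule the_equality)
  show "\<exists>c G. c < Re s \<and> G holomorphic_on {z. Re z > c} - {1} \<and>
          (\<forall>z. Re z > 1 \<longrightarrow> G z = dirichlet_series a z) \<and> F s = G s"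
    using assms by blast
next
  fix w
  assume "\<exists>d G. d < Re s \<and> G holomorphic_on {z. Re z > d} - {1} \<and>
          (\<forall>z. Re z > 1 \<longrightarrow> G z = dirichlet_series a z) \<and> w = G s"
  then obtain d G where G: "d < Re s" "G holomorphic_on {z. Re z > d} - {1}"
    "\<And>z. Re z > 1 \<Longrightarrow> G z = dirichlet_series a z" "w = G s"
    by blast
  define e where "e = max c d"
  define S where "S = {z. Re z > e} - {1::complex}"
  define T where "T = {z. Re z > max e 1}"
  have hol: "(\<lambda>z. G z - F z) holomorphic_on S"
    by (intro holomorphic_on_diff holomorphic_on_subset[OF G(2)] holomorphic_on_subset[OF F])
       (auto simp: S_def e_def)
  have oS: "open S" unfolding S_def by (intro open_delete open_halfspace_Re_gt)
  have cS: "connected S" unfolding S_def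
    by (intro connected_open_delete open_halfspace_Re_gt convex_connected convex_halfspace_Re_gt)
       auto
  have oT: "open T" unfolding T_def by (rule open_halfspace_Re_gt)
  define t where "t = complex_of_real (max e 1 + 1)"
  have t: "t \<in> T" by (simp add: T_def t_def max_def)
  have TS: "T \<subseteq> S" by (auto simp: T_def S_def)
  have lim: "t islimpt T" using oT t by (simp add: interior_limit_point interior_open)
  have sS: "s \<in> S" using s G by (auto simp: S_def e_def)
  have "G s - F s = 0"
  proof (rule analytic_continuation[OF hol oS cS TS _ lim _ sS])
    show "t \<in> S" using t TS by blast
    show "\<And>z. z \<in> T \<Longrightarrow> G z - F z = 0" using G(3) eqF by (simp add: T_def)
  qed
  then show "w = F s" using G by simp
qed

definition riemann_zeta :: "complex \<Rightarrow> complex" where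
  "riemann_zeta = dirichlet_continuation (\<lambda>_. 1)"

definition dirichlet_L :: "(nat \<Rightarrow> complex) \<Rightarrow> complex \<Rightarrow> complex" where
  "dirichlet_L \<psi> = dirichlet_continuation \<psi>"

text \<open>
  The non-trivial zeros are those in the open critical strip; for imprimitive characters this
  excludes the zeros of the finitely many Euler factors, which lie on \<open>Re s = 0\<close>.
\<close>

definition nontrivial_zeros :: "(complex \<Rightarrow> complex) \<Rightarrow> complex set" where
  "nontrivial_zeros L = {s. 0 < Re s \<and> Re s < 1 \<and> L s = 0}"

definition generalized_riemann_hypothesis :: bool where
  "generalized_riemann_hypothesis \<longleftrightarrow>
     (\<forall>s \<in> nontrivial_zeros riemann_zeta. Re s = 1/2) \<and>
     (\<forall>q \<psi>. dirichlet_character q \<psi> \<longrightarrow>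
        (\<forall>s \<in> nontrivial_zeros (dirichlet_L \<psi>). Re s = 1/2))"

end

theory Submission
  imports Defs "HOL-Number_Theory.Prime_Powers" "HOL-Computational_Algebra.Squarefree"
begin

text \<open>
  Let \<open>\<chi>\<close> be the non-principal character modulo 4 and \<open>a n = \<chi> n\<close> for \<open>k\<close>-free \<open>n\<close>, \<open>a n = 0\<close> otherwise.
  The function \<open>f n = a n + a (n / 2)\<close> repairs the value at the prime 2, so only the partial sums of
  \<open>a\<close> matter. Detecting \<open>k\<close>-freeness by \<open>m ^ k\<close> dividing \<open>n\<close>, these are sums of \<open>\<chi> d h m\<close> over \<open>m ^ k d \<le> x\<close>
  with \<open>h = \<mu> \<chi> ^ k\<close>. Since the partial sums of \<open>\<chi>\<close> are bounded, the terms with \<open>m \<le> z = x ^ (1/(k+1))\<close>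
  contribute \<open>O(z)\<close>, and in the others \<open>d \<le> z\<close>. There the sum over \<open>m\<close> is written as a truncated, slightly
  smoothed Perron integral of \<open>1 / L(s, \<chi> ^ k)\<close>, which GRH allows to be moved to \<open>Re s = 1/2 + \<eta>\<close>, where
  \<open>1 / L\<close> is \<open>O(|s| ^ \<epsilon>)\<close>. The sum over \<open>d\<close> inside the integral is a Dirichlet polynomial \<open>D\<close> at \<open>s / k\<close>;
  its part beyond \<open>|s|\<close> is \<open>O(1)\<close> by oscillation of \<open>\<chi>\<close> and the rest is controlled in mean square, so the
  integral is \<open>O(x ^ (1/(2k) + \<epsilon>) z ^ (1/2 - 1/(2k)))\<close>, that is \<open>O(x ^ (1/(k+1) + \<epsilon>))\<close>.

  The bound for \<open>1 / L\<close> comes from Borel-Caratheodory and a three-lines argument for \<open>log L\<close>. GRH says nothing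
  about \<open>Re s = 1\<close>, where \<open>L\<close> is shown to be non-zero by the 3-4-1 inequality.
\<close>

subsection \<open>The character modulo 4 and k-free integers\<close>

text \<open>Treating each \<open>d\<close> separately is too weak: GRH bounds the sum over
  \<open>m\<close> by about \<open>(x / d) ^ (1/(2k) + \<epsilon>)\<close>, and adding this over
  \<open>d \<le> z\<close> gives only \<open>x ^ (3/(2(k+1)) + \<epsilon>)\<close>. The cut
  \<open>z\<close> is the point at which the two bounds \<open>z\<close> and
  \<open>x ^ (1/(2k)) z ^ (1/2 - 1/(2k))\<close> coincide.

  Boundedness of the sums of \<chi> is used twice: directly for \<open>m \<le> z\<close>, and with
  complex exponents for the tail of \<open>D\<close>, so that only a polynomial of length comparable
  to the range of integration enters the mean square.

  Smoothing means logarithmic weights \<open>ln (y / m)\<close>, whose Perron kernel decays like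
  \<open>1 / s ^ 2\<close>; a short difference quotient in \<open>y\<close> returns to the sharp
  cut-off at the cost of at most one term.

  Modulus 4 is convenient because \<chi> is real, \<chi> ^ k is again a character modulo 4, and
  \<chi> vanishes at the single prime 2, so that one Euler factor repairs it.\<close>

text \<open>\<open>char4 1\<close> is the principal and \<open>char4 (-1)\<close> the non-principal character modulo 4, so that
  \<open>char4 (-1) n ^ k = char4 ((-1) ^ k) n\<close> treats even and odd \<open>k\<close> uniformly.\<close>

definition char4 :: "real \<Rightarrow> nat \<Rightarrow> real" where
  "char4 e n = (if n mod 4 = 1 then 1 else if n mod 4 = 3 then e else 0)"

lemma char4_0 [simp]: "char4 e 0 = 0" and char4_1 [simp]: "char4 e (Suc 0) = 1"
  by (simp_all add: char4_def)

lemma char4_mult: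
  assumes "e\<^sup>2 = 1"
  shows "char4 e (m * n) = char4 e m * char4 e n"
proof -
  have e: "e * e = 1" using assms by (simp add: power2_eq_square)
  have "m mod 4 \<in> {0,1,2,3}" "n mod 4 \<in> {0,1,2,3}" by auto
  moreover have "(m * n) mod 4 = (m mod 4) * (n mod 4) mod 4" by (rule mod_mult_eq[symmetric])
  ultimately show ?thesis by (auto simp: char4_def e)
qed

lemma char4_pow:
  assumes "e\<^sup>2 = 1"
  shows "char4 e (m ^ k) = char4 e m ^ k"
  by (induction k) (simp_all add: char4_mult[OF assms])

lemma char4_add_4: "char4 e (n + 4) = char4 e n"
  by (simp add: char4_def)

lemma char4_eq_0_iff:
  assumes "e\<^sup>2 = 1"
  shows "char4 e n = 0 \<longleftrightarrow> even n"
proof -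
  have "n mod 4 \<in> {0,1,2,3}" by auto
  moreover have "even n \<longleftrightarrow> even (n mod 4)" by (rule even_even_mod_4_iff)
  ultimately show ?thesis using assms by (auto simp: char4_def)
qed

lemma char4_power:
  assumes "k > 0" shows "char4 e n ^ k = char4 (e ^ k) n"
  using assms by (simp add: char4_def)

lemma abs_char4_le: "e\<^sup>2 = 1 \<Longrightarrow> \<bar>char4 e n\<bar> \<le> 1"
  by (auto simp: char4_def power2_eq_1_iff)

lemma char4_minus1_in: "char4 (-1) n \<in> {-1,0,1}"
  by (simp add: char4_def)

lemma sum_char4_minus1: "(\<Sum>n\<in>{1..N}. char4 (-1) n) = (if N mod 4 \<in> {1,2} then 1 else 0)"
proof (induction N)
  case (Suc N)
  have "N mod 4 \<in> {0,1,2,3}" by auto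
  then show ?case using Suc by (auto simp: char4_def mod_Suc)
qed auto

lemma abs_sum_char4_minus1_le: "\<bar>\<Sum>n\<in>{1..N}. char4 (-1) n\<bar> \<le> 1"
  unfolding sum_char4_minus1 by simp

section \<open>The Moebius function and the detection of k-free integers\<close>

definition mob :: "nat \<Rightarrow> real" where
  "mob n = (if squarefree n then (-1) ^ card (prime_factors n) else 0)"

lemma mob_1 [simp]: "mob (Suc 0) = 1" by (simp add: mob_def)

lemma abs_mob_le: "\<bar>mob n\<bar> \<le> 1" by (simp add: mob_def)

lemma mob_prime_mult:
  assumes p: "prime p" and d: "squarefree d" "\<not> p dvd d"
  shows "mob (p * d) = - mob d"
proof -
  have d0: "d \<noteq> 0" using d(1) by (metis not_squarefree_0)
  have "coprime p d" using p d(2) by (simp add: prime_imp_coprime)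
  then have sq: "squarefree (p * d)"
    using p d(1) by (simp add: squarefree_mult_coprime squarefree_prime)
  have "prime_factors (p * d) = insert p (prime_factors d)"
    using p d0 by (simp add: prime_factors_product prime_prime_factors)
  moreover have "p \<notin> prime_factors d" using d(2) by auto
  ultimately show ?thesis using sq d(1) by (simp add: mob_def)
qed

text \<open>Fix a prime \<open>p\<close> dividing \<open>n\<close>. The squarefree divisors fall
  into pairs \<open>d\<close>, \<open>p * d\<close> with \<open>p\<close> not dividing
  \<open>d\<close>, and the two values of \<open>mob\<close> in a pair cancel; the other divisors
  contribute 0.\<close>

lemma sum_mob_divisors:
  assumes "n > 0"
  shows "(\<Sum>d | d dvd n. mob d) = (if n = 1 then 1 else 0)"
proof (cases "n = 1")
  case True
  then have "{d. d dvd n} = {1}" by auto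
  then show ?thesis using True by simp
next
  case False
  then obtain p where p: "prime p" "p dvd n" using prime_factor_nat by blast
  define A where "A = {d. d dvd n \<and> squarefree d \<and> \<not> p dvd d}"
  have fin: "finite {d. d dvd n}" using assms by simp
  have finA: "finite A" by (rule finite_subset[OF _ fin]) (auto simp: A_def)
  have B: "{d. d dvd n \<and> squarefree d \<and> p dvd d} = (\<lambda>d. p * d) ` A"
  proof (intro equalityI subsetI)
    fix x assume "x \<in> {d. d dvd n \<and> squarefree d \<and> p dvd d}"
    then have x: "x dvd n" "squarefree x" "p dvd x" by auto
    then obtain d where d: "x = p * d" by blast
    have "\<not> p dvd d"
    proof
      assume "p dvd d"
      then have "p ^ 2 dvd x" using d by (auto simp: power2_eq_square)
      then have "p dvd 1" using x(2) by (auto simp: squarefree_def)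
      then show False using p(1) by (simp add: prime_nat_iff)
    qed
    moreover have "squarefree d" using x(2) d by (meson dvd_triv_right squarefree_mono)
    moreover have "d dvd n" using x(1) d by (meson dvd_trans dvd_triv_right)
    ultimately show "x \<in> (\<lambda>d. p * d) ` A" using d by (auto simp: A_def)
  next
    fix x assume "x \<in> (\<lambda>d. p * d) ` A"
    then obtain d where d: "x = p * d" "d dvd n" "squarefree d" "\<not> p dvd d" by (auto simp: A_def)
    have cop: "coprime p d" using p(1) d(4) by (simp add: prime_imp_coprime)
    then have "squarefree x" using p(1) d by (simp add: squarefree_mult_coprime squarefree_prime)
    moreover have "x dvd n" using cop p(2) d(1,2) by (simp add: divides_mult)
    ultimately show "x \<in> {d. d dvd n \<and> squarefree d \<and> p dvd d}" using d(1) by simp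
  qed
  have "(\<Sum>d | d dvd n. mob d) = (\<Sum>d\<in>A \<union> {d. d dvd n \<and> squarefree d \<and> p dvd d}. mob d)"
    by (rule sum.mono_neutral_right[OF fin]) (auto simp: A_def mob_def)
  also have "\<dots> = sum mob A + (\<Sum>d | d dvd n \<and> squarefree d \<and> p dvd d. mob d)"
    by (rule sum.union_disjoint) (use finA B in \<open>auto simp: A_def\<close>)
  also have "(\<Sum>d | d dvd n \<and> squarefree d \<and> p dvd d. mob d) = (\<Sum>d\<in>A. mob (p * d))"
    unfolding B using p(1) by (subst sum.reindex) (auto simp: inj_on_def prime_gt_0_nat)
  also have "\<dots> = (\<Sum>d\<in>A. - mob d)"
    by (rule sum.cong) (auto simp: A_def mob_prime_mult p(1))
  finally show ?thesis using False by (simp add: sum_negf)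
qed

text \<open>The root \<open>m0\<close> has multiplicity \<open>multiplicity p n div k\<close> at
  each prime, since \<open>k * a \<le> b\<close> is the same as \<open>a \<le> b div k\<close>. It
  turns a sum over \<open>m\<close> with \<open>m ^ k dvd n\<close> into a full divisor sum of
  \<open>m0\<close>, to which Moebius inversion applies.\<close>

lemma power_dvd_iff_dvd_root:
  assumes k: "k \<ge> 1" and n: "n > 0"
  shows "\<exists>m0>0. (\<forall>m. m ^ k dvd n \<longleftrightarrow> m dvd m0) \<and> (k_free k n \<longleftrightarrow> m0 = 1)"
proof -
  define m0 where "m0 = (\<Prod>p\<in>prime_factors n. p ^ (multiplicity p n div k))"
  have m0: "m0 > 0" unfolding m0_def by (intro prod_pos) (auto simp: prime_gt_0_nat in_prime_factors_iff)
  have mult: "multiplicity p m0 = multiplicity p n div k" if "prime p" for p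
  proof (cases "p \<in> prime_factors n")
    case True
    then show ?thesis unfolding m0_def using that
      by (subst multiplicity_prod_prime_powers) auto
  next
    case False
    then have "multiplicity p n = 0" using that n
      by (simp add: prime_factors_multiplicity)
    then show ?thesis unfolding m0_def using that False
      by (subst multiplicity_prod_prime_powers) auto
  qed
  have dvd_iff_mult: "a dvd b \<longleftrightarrow> (\<forall>p. prime p \<longrightarrow> multiplicity p a \<le> multiplicity p b)"
    if "a \<noteq> 0" "b \<noteq> 0" for a b :: nat
    using that multiplicity_le_imp_dvd[of a b] dvd_imp_multiplicity_le[of a b] by blast
  have iff: "m ^ k dvd n \<longleftrightarrow> m dvd m0" for m
  proof (cases "m = 0")
    case True
    then show ?thesis using k n m0 by auto
  next
    case False
    have "m ^ k dvd n \<longleftrightarrow> (\<forall>p. prime p \<longrightarrow> multiplicity p (m ^ k) \<le> multiplicity p n)"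
      by (rule dvd_iff_mult) (use False n in auto)
    also have "\<dots> \<longleftrightarrow> (\<forall>p. prime p \<longrightarrow> multiplicity p m \<le> multiplicity p m0)"
      using False k
      by (auto simp: mult prime_elem_multiplicity_power_distrib less_eq_div_iff_mult_less_eq mult.commute)
    also have "\<dots> \<longleftrightarrow> m dvd m0"
      by (rule dvd_iff_mult[symmetric]) (use False m0 in auto)
    finally show ?thesis .
  qed
  have "k_free k n \<longleftrightarrow> (\<forall>p. prime p \<longrightarrow> \<not> p dvd m0)" using n by (simp add: k_free_def iff)
  also have "\<dots> \<longleftrightarrow> m0 = 1" by (metis nat_dvd_1_iff_1 not_prime_1 prime_factor_nat)
  finally have "k_free k n \<longleftrightarrow> m0 = 1" .
  then show ?thesis using m0 iff by blast
qed

lemma sum_mob_k_free: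
  assumes k: "k \<ge> 1" and n: "n > 0"
  shows "(\<Sum>m | m ^ k dvd n. mob m) = of_bool (k_free k n)"
proof -
  from power_dvd_iff_dvd_root[OF assms] obtain m0
    where m0: "m0 > 0 \<and> (\<forall>m. m ^ k dvd n \<longleftrightarrow> m dvd m0) \<and> (k_free k n \<longleftrightarrow> m0 = 1)" ..
  show ?thesis using sum_mob_divisors[of m0] m0 by simp
qed

lemma k_free_mult_coprime:
  assumes "coprime m n" "m > 0" "n > 0"
  shows "k_free k (m * n) \<longleftrightarrow> k_free k m \<and> k_free k n"
proof
  show "k_free k (m * n) \<Longrightarrow> k_free k m \<and> k_free k n"
    using assms by (auto simp: k_free_def)
next
  assume *: "k_free k m \<and> k_free k n"
  have "\<not> p ^ k dvd m * n" if p: "prime p" for p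
  proof
    assume "p ^ k dvd m * n"
    moreover have "coprime p m \<or> coprime p n"
      using assms p by (metis coprime_common_divisor not_prime_unit prime_imp_coprime)
    ultimately have "p ^ k dvd m \<or> p ^ k dvd n"
      by (metis coprime_dvd_mult_left_iff coprime_dvd_mult_right_iff coprime_power_left_iff)
    then show False using * p by (auto simp: k_free_def)
  qed
  then show "k_free k (m * n)" using assms by (simp add: k_free_def)
qed

section \<open>Splitting the k-free character sum at \<open>z\<close>\<close>

definition kfree_char :: "nat \<Rightarrow> nat \<Rightarrow> real" where
  "kfree_char k n = char4 (-1) n * of_bool (k_free k n)"

text \<open>With \<open>e = (-1) ^ k\<close> this is the \<open>h\<close> of the overview. By
  \<open>sum_mob_char\<close> it is the Dirichlet inverse of \<open>char4 e\<close>, hence its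
  series is \<open>1 / L\<close>.\<close>

definition mob_char :: "real \<Rightarrow> nat \<Rightarrow> real" where
  "mob_char e m = mob m * char4 e m"

lemma abs_mob_char_le: "e\<^sup>2 = 1 \<Longrightarrow> \<bar>mob_char e m\<bar> \<le> 1"
  unfolding mob_char_def abs_mult using mult_mono[OF abs_mob_le abs_char4_le, of e m m] by simp

lemma sum_mob_char:
  assumes "n > 0" "e\<^sup>2 = 1"
  shows "(\<Sum>d | d dvd n. mob_char e d * char4 e (n div d)) = (if n = 1 then 1 else 0)"
proof -
  have "(\<Sum>d | d dvd n. mob_char e d * char4 e (n div d)) = (\<Sum>d | d dvd n. mob d * char4 e n)"
  proof (rule sum.cong)
    fix d assume "d \<in> {d. d dvd n}"
    then have "char4 e n = char4 e d * char4 e (n div d)"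
      using char4_mult[OF assms(2), of d "n div d"] by simp
    then show "mob_char e d * char4 e (n div d) = mob d * char4 e n" by (simp add: mob_char_def)
  qed simp
  also have "\<dots> = (if n = 1 then 1 else 0)"
    using sum_mob_divisors[OF assms(1)] by (simp flip: sum_distrib_right)
  finally show ?thesis .
qed

text \<open>Hyperbola method on the pairs \<open>(m, d)\<close> with
  \<open>m ^ k * d \<le> X\<close>. The pairs with \<open>m \<le> z\<close> cost \<open>z\<close>,
  because the inner sums of \<chi> are bounded by 1. If \<open>m > z\<close> then
  \<open>d \<le> N\<close>, and \<open>N \<le> z\<close> by the choice of \<open>z\<close>.
  Extending the inner sum down to \<open>m = 1\<close> adds a full rectangle, which factors and
  costs another \<open>z\<close>.\<close>

lemma kfree_char_sum_reduction:
  fixes k X z :: nat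
  assumes k: "k \<ge> 1" and z: "z \<ge> 1" and X: "X \<le> z ^ (k + 1)"
  defines "e \<equiv> (-1) ^ k" and "N \<equiv> X div z ^ k"
  shows "N \<le> z"
    and "\<bar>\<Sum>n\<in>{1..X}. kfree_char k n\<bar> \<le>
      2 * real z + \<bar>\<Sum>d\<in>{1..N}. char4 (-1) d * (\<Sum>m | m \<ge> 1 \<and> m ^ k * d \<le> X. mob_char e m)\<bar>"
proof -
  have e: "e\<^sup>2 = 1" by (simp add: e_def flip: power_mult)
  have "N \<le> z ^ (k + 1) div z ^ k" unfolding N_def using X by (rule div_le_mono)
  also have "z ^ (k + 1) div z ^ k = z" using z by simp
  finally show Nz: "N \<le> z" .
  have div: "d \<le> X div m ^ k \<longleftrightarrow> m ^ k * d \<le> X" if "m \<ge> 1" for m d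
    using that less_eq_div_iff_mult_less_eq[of "m ^ k" d X] by (simp only: mult.commute) simp
  have mle: "m \<le> X" if "m \<ge> 1" "d \<ge> 1" "m ^ k * d \<le> X" for m d :: nat
  proof -
    have "m ^ 1 \<le> m ^ k" using k that(1) by (intro power_increasing) auto
    also have "\<dots> \<le> m ^ k * d" using that(2) by simp
    finally show ?thesis using that(3) by simp
  qed
  have sub: "{m. z < m \<and> m ^ k * d \<le> X} \<subseteq> {..X}" if "d \<ge> 1" for d
  proof
    fix m assume "m \<in> {m. z < m \<and> m ^ k * d \<le> X}"
    then show "m \<in> {..X}" using mle[of m d] z that by simp
  qed
  define S where "S = (\<lambda>P. {(m,d). m \<ge> 1 \<and> d \<ge> 1 \<and> m ^ k * d \<le> X \<and> P m})"
  have fin: "finite (S P)" for P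
  proof (rule finite_subset)
    show "S P \<subseteq> {1..X} \<times> {1..X}"
    proof (clarsimp simp: S_def)
      fix m d assume *: "Suc 0 \<le> m" "Suc 0 \<le> d" "m ^ k * d \<le> X"
      have "1 * d \<le> m ^ k * d" using * by (intro mult_right_mono) auto
      then show "m \<le> X \<and> d \<le> X" using mle[of m d] * by linarith
    qed
  qed auto
  define F where "F = (\<lambda>(m,d). mob_char e m * char4 (-1) d)"
  have FS: "(\<Sum>n\<in>{1..X}. kfree_char k n) = sum F (S (\<lambda>_. True))"
  proof -
    have "(\<Sum>n\<in>{1..X}. kfree_char k n) = (\<Sum>n\<in>{1..X}. \<Sum>m | m ^ k dvd n. mob m * char4 (-1) n)"
    proof (rule sum.cong)
      fix n assume "n \<in> {1..X}"
      then have "of_bool (k_free k n) = (\<Sum>m | m ^ k dvd n. mob m)"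
        by (intro sum_mob_k_free[OF k, symmetric]) auto
      then show "kfree_char k n = (\<Sum>m | m ^ k dvd n. mob m * char4 (-1) n)"
        unfolding kfree_char_def sum_distrib_right[symmetric] by (simp only: mult.commute)
    qed simp
    also have "\<dots> = (\<Sum>(n,m)\<in>(SIGMA n:{1..X}. {m. m ^ k dvd n}). mob m * char4 (-1) n)"
    proof (rule sum.Sigma)
      show "\<forall>n\<in>{1..X}. finite {m. m ^ k dvd n}"
      proof
        fix n assume "n \<in> {1..X}"
        have "m \<le> n" if "m ^ k dvd n" for m
        proof (rule dvd_imp_le)
          have "m ^ 1 dvd m ^ k" using k by (rule le_imp_power_dvd)
          then show "m dvd n" using that by (auto intro: dvd_trans)
        qed (use \<open>n \<in> {1..X}\<close> in auto)
        then have "{m. m ^ k dvd n} \<subseteq> {..n}" by auto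
        then show "finite {m. m ^ k dvd n}" by (rule finite_subset) simp
      qed
    qed simp
    also have "\<dots> = sum F (S (\<lambda>_. True))"
    proof (rule sum.reindex_bij_witness[of _ "\<lambda>(m,d). (m ^ k * d, m)" "\<lambda>(n,m). (m, n div m ^ k)"])
      fix a assume "a \<in> (SIGMA n:{1..X}. {m. m ^ k dvd n})"
      then obtain n m where a: "a = (n,m)" "1 \<le> n" "n \<le> X" "m ^ k dvd n" by auto
      then obtain d where d: "n = m ^ k * d" by blast
      have mk: "m > 0" "d > 0" "m ^ k > 0" using a d k by (auto intro!: Nat.gr0I simp: zero_power)
      show "(case case a of (n, m) \<Rightarrow> (m, n div m ^ k) of (m, d) \<Rightarrow> (m ^ k * d, m)) = a"
        using a d mk by auto
      show "(case a of (n, m) \<Rightarrow> (m, n div m ^ k)) \<in> S (\<lambda>_. True)"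
        using a d mk by (auto simp: S_def)
      \<comment> \<open>Here \<open>e = (-1) ^ k\<close> arises: \<chi> is completely
        multiplicative, so \<open>m ^ k\<close> contributes \<chi>(m) ^ k, which is
        \<open>char4 e m\<close>.\<close>
      have "char4 (-1) n = char4 (-1) m ^ k * char4 (-1) d"
        unfolding d by (simp add: char4_mult char4_pow)
      moreover have "char4 (-1) m ^ k = char4 e m" using k by (simp add: char4_power e_def)
      ultimately show "F (case a of (n, m) \<Rightarrow> (m, n div m ^ k)) = (case a of (n, m) \<Rightarrow> mob m * char4 (-1) n)"
        using a(1) d mk by (simp add: F_def mob_char_def)
    next
      fix b assume "b \<in> S (\<lambda>_. True)"
      then show "(case case b of (m, d) \<Rightarrow> (m ^ k * d, m) of (n, m) \<Rightarrow> (m, n div m ^ k)) = b"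
        "(case b of (m, d) \<Rightarrow> (m ^ k * d, m)) \<in> (SIGMA n:{1..X}. {m. m ^ k dvd n})"
        by (auto simp: S_def)
    qed
    finally show ?thesis .
  qed
  have split: "sum F (S (\<lambda>_. True)) = sum F (S (\<lambda>m. m \<le> z)) + sum F (S (\<lambda>m. m > z))"
  proof -
    have "S (\<lambda>_. True) = S (\<lambda>m. m \<le> z) \<union> S (\<lambda>m. m > z)" by (auto simp: S_def)
    moreover have "S (\<lambda>m. m \<le> z) \<inter> S (\<lambda>m. m > z) = {}" by (auto simp: S_def)
    ultimately show ?thesis by (metis sum.union_disjoint[OF fin fin])
  qed
  have "sum F (S (\<lambda>m. m \<le> z)) = (\<Sum>m\<in>{1..z}. \<Sum>d\<in>{1..X div m ^ k}. F (m,d))"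
  proof -
    have "S (\<lambda>m. m \<le> z) = (SIGMA m:{1..z}. {1..X div m ^ k})"
      by (auto simp: S_def div)
    then show ?thesis by (simp only: sum.Sigma finite_atLeastAtMost ball_triv simp_thms) (simp add: case_prod_unfold)
  qed
  also have "\<dots> = (\<Sum>m\<in>{1..z}. mob_char e m * (\<Sum>d\<in>{1..X div m ^ k}. char4 (-1) d))"
    by (simp add: F_def sum_distrib_left)
  also have "\<bar>\<dots>\<bar> \<le> (\<Sum>m\<in>{1..z}. 1)"
  proof (rule order.trans[OF sum_abs sum_mono])
    fix m
    have "\<bar>mob_char e m\<bar> * \<bar>\<Sum>d\<in>{1..X div m ^ k}. char4 (-1) d\<bar> \<le> 1 * 1"
      by (intro mult_mono abs_mob_char_le e abs_sum_char4_minus1_le) auto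
    then show "\<bar>mob_char e m * (\<Sum>d\<in>{1..X div m ^ k}. char4 (-1) d)\<bar> \<le> 1"
      by (simp add: abs_mult)
  qed
  finally have 1: "\<bar>sum F (S (\<lambda>m. m \<le> z))\<bar> \<le> real z" by simp
  have "sum F (S (\<lambda>m. m > z)) = (\<Sum>d\<in>{1..N}. \<Sum>m | m > z \<and> m ^ k * d \<le> X. F (m,d))"
  proof -
    have "sum F (S (\<lambda>m. m > z)) = (\<Sum>(d,m)\<in>(SIGMA d:{1..N}. {m. m > z \<and> m ^ k * d \<le> X}). F (m,d))"
    proof (rule sum.reindex_bij_witness[of _ "\<lambda>(d,m). (m,d)" "\<lambda>(m,d). (d,m)"])
      fix a assume "a \<in> S (\<lambda>m. m > z)"
      then obtain m d where a: "a = (m,d)" "m \<ge> 1" "d \<ge> 1" "m ^ k * d \<le> X" "m > z" by (auto simp: S_def)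
      have "z ^ k * d \<le> m ^ k * d" using a by (intro mult_right_mono power_mono) auto
      then have "d \<le> N" unfolding N_def using a(4) by (subst div[OF z]) linarith
      then show "(case a of (m, d) \<Rightarrow> (d, m)) \<in> (SIGMA d:{1..N}. {m. m > z \<and> m ^ k * d \<le> X})"
        using a by auto
    qed (auto simp: S_def)
    also have "\<dots> = (\<Sum>d\<in>{1..N}. \<Sum>m | m > z \<and> m ^ k * d \<le> X. F (m,d))"
    proof (rule sum.Sigma[symmetric])
      show "\<forall>d\<in>{1..N}. finite {m. z < m \<and> m ^ k * d \<le> X}"
      proof
        fix d assume "d \<in> {1..N}"
        then have "{m. z < m \<and> m ^ k * d \<le> X} \<subseteq> {..X}" by (intro sub) simp
        then show "finite {m. z < m \<and> m ^ k * d \<le> X}" by (rule finite_subset) simp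
      qed
    qed simp
    finally show ?thesis .
  qed
  \<comment> \<open>For \<open>d \<le> N\<close> every \<open>m \<le> z\<close> satisfies
    \<open>m ^ k * d \<le> X\<close>. The part removed from the complete sum is therefore the same
    for all \<open>d\<close>, and the correction becomes a product of two sums.\<close>
  also have "\<dots> = (\<Sum>d\<in>{1..N}. char4 (-1) d * (\<Sum>m | m \<ge> 1 \<and> m ^ k * d \<le> X. mob_char e m)
                       - char4 (-1) d * (\<Sum>m\<in>{1..z}. mob_char e m))"
  proof (rule sum.cong)
    fix d assume d: "d \<in> {1..N}"
    have f: "finite {m. z < m \<and> m ^ k * d \<le> X}"
      by (rule finite_subset[of _ "{..X}"], rule sub) (use d in auto)
    have "m ^ k * d \<le> X" if "m \<le> z" for m
    proof -
      have "m ^ k * d \<le> z ^ k * N" using d that by (intro mult_mono power_mono) auto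
      also have "\<dots> \<le> X" by (simp add: N_def)
      finally show ?thesis .
    qed
    then have "{m. m \<ge> 1 \<and> m ^ k * d \<le> X} = {1..z} \<union> {m. m > z \<and> m ^ k * d \<le> X}"
      using z by auto
    then have "(\<Sum>m | m \<ge> 1 \<and> m ^ k * d \<le> X. mob_char e m) =
       (\<Sum>m\<in>{1..z}. mob_char e m) + (\<Sum>m | m > z \<and> m ^ k * d \<le> X. mob_char e m)"
      by (simp add: sum.union_disjoint f disjoint_iff)
    then show "(\<Sum>m | m > z \<and> m ^ k * d \<le> X. F (m,d)) =
      char4 (-1) d * (\<Sum>m | m \<ge> 1 \<and> m ^ k * d \<le> X. mob_char e m)
                       - char4 (-1) d * (\<Sum>m\<in>{1..z}. mob_char e m)"
      by (simp add: F_def algebra_simps sum_distrib_left)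
  qed simp
  also have "\<dots> = (\<Sum>d\<in>{1..N}. char4 (-1) d * (\<Sum>m | m \<ge> 1 \<and> m ^ k * d \<le> X. mob_char e m))
     - (\<Sum>d\<in>{1..N}. char4 (-1) d) * (\<Sum>m\<in>{1..z}. mob_char e m)"
    by (simp add: sum_subtractf sum_distrib_right)
  finally have 2: "sum F (S (\<lambda>m. m > z)) = \<dots>" .
  have "\<bar>\<Sum>m\<in>{1..z}. mob_char e m\<bar> \<le> (\<Sum>m\<in>{1..z}. 1)"
    by (rule order.trans[OF sum_abs sum_mono]) (rule abs_mob_char_le[OF e])
  then have "\<bar>\<Sum>d\<in>{1..N}. char4 (-1) d\<bar> * \<bar>\<Sum>m\<in>{1..z}. mob_char e m\<bar> \<le> 1 * real z"
    by (intro mult_mono abs_sum_char4_minus1_le) auto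
  then have 3: "\<bar>(\<Sum>d\<in>{1..N}. char4 (-1) d) * (\<Sum>m\<in>{1..z}. mob_char e m)\<bar> \<le> real z"
    by (simp add: abs_mult)
  show "\<bar>\<Sum>n\<in>{1..X}. kfree_char k n\<bar> \<le>
      2 * real z + \<bar>\<Sum>d\<in>{1..N}. char4 (-1) d * (\<Sum>m | m \<ge> 1 \<and> m ^ k * d \<le> X. mob_char e m)\<bar>"
  proof -
    define W where "W = (\<Sum>d\<in>{1..N}. char4 (-1) d) * (\<Sum>m\<in>{1..z}. mob_char e m)"
    have bound: "\<bar>a + (t - w)\<bar> \<le> 2 * y + \<bar>t\<bar>" if "\<bar>a\<bar> \<le> y" "\<bar>w\<bar> \<le> y" for a t w y :: real
      using that by linarith
    show ?thesis
      unfolding FS split 2 W_def[symmetric] by (rule bound[OF 1 3[folded W_def]])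
  qed
qed

subsection \<open>Mean values of the character polynomial\<close>

lemma norm_exp_diff_le:
  fixes a b :: complex
  assumes "Re a \<le> 0" "Re b \<le> 0"
  shows "norm (exp a - exp b) \<le> norm (a - b)"
proof -
  have "norm (exp a - exp b) \<le> 1 * norm (a - b)"
  proof (rule field_differentiable_bound[of "{z. Re z \<le> 0}" exp exp])
    show "convex {z. Re z \<le> 0}" by (rule convex_halfspace_Re_le)
  qed (use assms in \<open>auto intro: DERIV_exp[THEN DERIV_subset]\<close>)
  then show ?thesis by simp
qed

text \<open>With \<open>q\<^sub>j = x\<^sub>j\<^sub>+\<^sub>1 / x\<^sub>j\<close> close to the positive axis, \<open>v\<^sub>j = 1 / (1 + q\<^sub>j)\<close> turns the alternating terms
  \<open>z\<^sub>j\<close> into differences \<open>z\<^sub>j = (z\<^sub>j - z\<^sub>j\<^sub>+\<^sub>1) v\<^sub>j\<close>, and the \<open>v\<^sub>j\<close> have bounded variation.\<close>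

lemma norm_alternating_sum_le:
  fixes w :: complex and a b :: nat
  assumes w: "Re w \<ge> 0" and a: "2 * norm w \<le> 2 * real a + 1"
  shows "norm (\<Sum>j\<in>{a..<b}. (-1) ^ j * exp (- w * of_real (ln (2 * real j + 1)))) \<le> 3"
proof (cases "a < b")
  case True
  define \<delta> where "\<delta> = (\<lambda>j::nat. ln (2 * real j + 3) - ln (2 * real j + 1))"
  define q where "q = (\<lambda>j. exp (- w * of_real (\<delta> j)))"
  define v where "v = (\<lambda>j. 1 / (1 + q j))"
  define z where "z = (\<lambda>j::nat. (-1) ^ j * exp (- w * of_real (ln (2 * real j + 1))))"
  have \<delta>_eq: "\<delta> j = ln (1 + 2 / (2 * real j + 1))" for j
  proof -
    have "ln ((2 * real j + 3) / (2 * real j + 1)) = \<delta> j"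
      unfolding \<delta>_def by (simp add: ln_div)
    moreover have "(2 * real j + 3) / (2 * real j + 1) = 1 + 2 / (2 * real j + 1)"
      by (simp add: field_simps)
    ultimately show ?thesis by simp
  qed
  have \<delta>_pos: "\<delta> j \<ge> 0" for j unfolding \<delta>_eq by simp
  have \<delta>_le: "\<delta> j \<le> 2 / (2 * real j + 1)" for j
    unfolding \<delta>_eq by (rule ln_add_one_self_le_self) simp
  have \<delta>_dec: "\<delta> (Suc j) \<le> \<delta> j" for j
    unfolding \<delta>_eq by (subst ln_le_cancel_iff) (auto intro!: add_pos_nonneg divide_left_mono)
  have Rew: "Re (- w * of_real (\<delta> j)) \<le> 0" for j
    using w \<delta>_pos[of j] by simp
  \<comment> \<open>The hypothesis on \<open>a\<close> says that summation starts where one step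
    changes the exponent by at most 1.\<close>
  have wd: "norm w * \<delta> j \<le> 1" if "a \<le> j" for j
  proof -
    have "norm w * \<delta> j \<le> norm w * (2 / (2 * real j + 1))"
      by (intro mult_left_mono \<delta>_le) auto
    also have "\<dots> \<le> 1" using a that by (simp add: field_simps)
    finally show ?thesis .
  qed
  \<comment> \<open>The argument of \<open>q j\<close> is at most 1 in absolute value, less than
    half of \<pi>, so \<open>q j\<close> has non-negative real part and \<open>1 + q j\<close> stays
    away from 0.\<close>
  have v1: "norm (1 + q j) \<ge> 1" if "a \<le> j" for j
  proof -
    have "\<bar>Im w * \<delta> j\<bar> \<le> norm w * \<delta> j"
      using \<delta>_pos[of j] abs_Im_le_cmod[of w] by (simp add: abs_mult mult_right_mono)
    also have "\<dots> \<le> 1" by (rule wd[OF that])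
    finally have "cos (Im w * \<delta> j) \<ge> 0" using pi_half_gt_zero pi_ge_two
      by (intro cos_ge_zero) auto
    then have "Re (q j) \<ge> 0" by (simp add: q_def Re_exp)
    then have "1 \<le> Re (1 + q j)" by simp
    also have "\<dots> \<le> norm (1 + q j)" by (rule complex_Re_le_cmod)
    finally show ?thesis .
  qed
  have nz: "1 + q j \<noteq> 0" if "a \<le> j" for j using v1[OF that] by auto
  have v_le: "norm (v j) \<le> 1" if "a \<le> j" for j
    using v1[OF that] by (simp add: v_def norm_divide divide_le_eq)
  have z_le: "norm (z j) \<le> 1" for j
    using w by (simp add: z_def norm_mult norm_power mult_nonneg_nonneg)
  have zq: "z (Suc j) = - q j * z j" for j
  proof -
    have "exp (- w * of_real (ln (2 * real (Suc j) + 1))) = q j * exp (- w * of_real (ln (2 * real j + 1)))"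
      by (simp add: q_def \<delta>_def algebra_simps flip: exp_add)
    then show ?thesis by (simp add: z_def)
  qed
  have zv: "z j = (z j - z (Suc j)) * v j" if "a \<le> j" for j
    using nz[OF that] by (simp add: zq v_def field_simps)
  have v_diff: "norm (v (Suc j) - v j) \<le> norm w * (\<delta> j - \<delta> (Suc j))" if "a \<le> j" for j
  proof -
    have "v (Suc j) - v j = (q j - q (Suc j)) * (v j * v (Suc j))"
      using nz[of j] nz[of "Suc j"] that by (simp add: v_def field_simps)
    then have "norm (v (Suc j) - v j) = norm (q j - q (Suc j)) * (norm (v j) * norm (v (Suc j)))"
      by (simp add: norm_mult)
    also have "\<dots> \<le> norm (q j - q (Suc j)) * (1 * 1)"
      using that by (intro mult_left_mono mult_mono v_le) auto
    also have "norm (q j - q (Suc j)) \<le> norm (- w * of_real (\<delta> j) - - w * of_real (\<delta> (Suc j)))"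
      unfolding q_def by (rule norm_exp_diff_le[OF Rew Rew])
    also have "- w * of_real (\<delta> j) - - w * of_real (\<delta> (Suc j)) = - w * of_real (\<delta> j - \<delta> (Suc j))"
      by (simp add: algebra_simps)
    also have "norm \<dots> = norm w * (\<delta> j - \<delta> (Suc j))"
      using \<delta>_dec[of j] by (simp add: norm_mult del: of_real_diff)
    finally show ?thesis by simp
  qed
  \<comment> \<open>Summation by parts, with the two boundary terms moved to the left. The variation
    of \<open>v\<close> telescopes because \<delta> is decreasing. In the end each boundary term and
    \<open>norm w * \<delta> a\<close> are at most 1, which gives the constant 3.\<close>
  have ind: "norm ((\<Sum>j\<in>{a..<Suc b}. z j) - z a * v a + z (Suc b) * v b) \<le> norm w * (\<delta> a - \<delta> b)"
    if "a \<le> b" for b using that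
  proof (induction b rule: dec_induct)
    case base
    have "z a - z a * v a + z (Suc a) * v a = 0" using zv[of a] by (simp add: algebra_simps)
    then show ?case by simp
  next
    case (step b)
    have "(\<Sum>j\<in>{a..<Suc (Suc b)}. z j) - z a * v a + z (Suc (Suc b)) * v (Suc b) =
       ((\<Sum>j\<in>{a..<Suc b}. z j) - z a * v a + z (Suc b) * v b) + z (Suc b) * (v (Suc b) - v b)"
      using step.hyps zv[of "Suc b"] by (simp add: algebra_simps)
    also have "norm \<dots> \<le> norm w * (\<delta> a - \<delta> b) + 1 * (norm w * (\<delta> b - \<delta> (Suc b)))"
      using step.hyps
      by (intro norm_triangle_mono step.IH order.trans[OF norm_mult_ineq] mult_mono z_le v_diff) auto
    finally show ?case by (simp add: algebra_simps)
  qed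
  obtain c where c: "b = Suc c" "a \<le> c" using True by (cases b) auto
  have "norm (\<Sum>j\<in>{a..<b}. z j) = norm (((\<Sum>j\<in>{a..<Suc c}. z j) - z a * v a + z (Suc c) * v c) + z a * v a - z (Suc c) * v c)"
    by (simp add: c)
  also have "\<dots> \<le> norm w * (\<delta> a - \<delta> c) + 1 * 1 + 1 * 1"
    by (intro order.trans[OF norm_triangle_ineq4] add_mono order.trans[OF norm_triangle_ineq] ind c(2)
          order.trans[OF norm_mult_ineq] mult_mono z_le v_le order.refl) (use c(2) in auto)
  also have "norm w * (\<delta> a - \<delta> c) \<le> norm w * \<delta> a"
    using \<delta>_pos[of c] by (intro mult_left_mono) auto
  also have "norm w * \<delta> a \<le> 1" by (rule wd) simp
  finally show ?thesis by (simp add: z_def)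
qed auto

lemma char4_minus1_odd: "char4 (-1) (2 * j + 1) = (-1) ^ j"
proof (induction j)
  case (Suc j)
  have "j mod 2 \<in> {0,1}" by auto
  have "char4 (-1) (2 * Suc j + 1) = - char4 (-1) (2 * j + 1)"
    unfolding char4_def by (simp, presburger)
  then show ?case using Suc by simp
qed simp

text \<open>The Dirichlet polynomial \<open>D\<close> of the overview, the sum of \<chi>(d) d ^
  (-w). The power is written with \<open>exp\<close> so that it splits off from the Perron kernel by
  \<open>exp_add\<close>.\<close>

definition char_poly :: "nat \<Rightarrow> complex \<Rightarrow> complex" where
  "char_poly N w = (\<Sum>d\<in>{1..N}. of_real (char4 (-1) d) * exp (- w * of_real (ln (real d))))"

text \<open>Only odd \<open>d = 2 * j + 1\<close> count, with sign \<open>(-1) ^ j\<close>. Beyond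
  \<open>2 * norm w\<close> the factors d ^ (-w) vary slowly compared with this alternation, so the
  tail is bounded however long it is.\<close>

lemma norm_char_poly_diff_le:
  assumes "Re w \<ge> 0" "2 * norm w \<le> real P" "P \<le> N"
  shows "norm (char_poly N w - char_poly P w) \<le> 3"
proof -
  define t where "t = (\<lambda>d. of_real (char4 (-1) d) * exp (- w * of_real (ln (real d))))"
  define a where "a = (P + 1) div 2"
  define b where "b = (N + 1) div 2"
  have un: "{1..N} = {1..P} \<union> {P<..N}" using assms(3) by auto
  have "sum t {1..N} = sum t {1..P} + sum t {P<..N}"
    unfolding un by (rule sum.union_disjoint) auto
  then have "char_poly N w - char_poly P w = sum t {P<..N}"
    unfolding char_poly_def t_def[symmetric] by simp
  also have "\<dots> = sum t ((\<lambda>j. 2 * j + 1) ` {a..<b})"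
  proof (rule sum.mono_neutral_right)
    show "(\<lambda>j. 2 * j + 1) ` {a..<b} \<subseteq> {P<..N}" by (auto simp: a_def b_def)
    show "\<forall>i\<in>{P<..N} - (\<lambda>j. 2 * j + 1) ` {a..<b}. t i = 0"
    proof
      fix i assume i: "i \<in> {P<..N} - (\<lambda>j. 2 * j + 1) ` {a..<b}"
      have "even i"
      proof (rule ccontr)
        assume "odd i"
        then obtain j where j: "i = 2 * j + 1" by (elim oddE)
        then have "j \<in> {a..<b}" using i by (auto simp: a_def b_def)
        then show False using i j by auto
      qed
      then have "char4 (-1) i = 0" by (subst char4_eq_0_iff) auto
      then show "t i = 0" by (simp add: t_def)
    qed
  qed auto
  also have "\<dots> = (\<Sum>j\<in>{a..<b}. t (2 * j + 1))"
    by (subst sum.reindex) (auto simp: inj_on_def)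
  also have "\<dots> = (\<Sum>j\<in>{a..<b}. (-1) ^ j * exp (- w * of_real (ln (2 * real j + 1))))"
    by (rule sum.cong) (simp_all only: t_def char4_minus1_odd, simp_all add: add.commute)
  also have "norm \<dots> \<le> 3"
    by (rule norm_alternating_sum_le) (use assms a_def in auto)
  finally show ?thesis .
qed

section \<open>Mean square of a Dirichlet polynomial\<close>

lemma sum_inverse_le: "n \<ge> 1 \<Longrightarrow> (\<Sum>j\<in>{1..n}. 1 / real j) \<le> 1 + ln (real n)"
proof (induction n rule: dec_induct)
  case (step n)
  have "1 / real (Suc n) \<le> - ln (1 - 1 / real (Suc n))"
    using ln_le_minus_one[of "1 - 1 / real (Suc n)"] step.hyps by (simp add: field_simps)
  also have "1 - 1 / real (Suc n) = real n / real (Suc n)" by (simp add: field_simps)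
  also have "- ln (real n / real (Suc n)) = ln (real (Suc n)) - ln (real n)"
    using step.hyps by (simp add: ln_div)
  finally show ?case using step.IH by simp
qed simp

lemma sum_inverse_dist_le:
  assumes "m \<in> {1..P}"
  shows "(\<Sum>n\<in>{1..P} - {m}. 1 / \<bar>real m - real n\<bar>) \<le> 2 * (1 + ln (real P))"
proof -
  have le: "(\<Sum>n\<in>A. 1 / \<bar>real m - real n\<bar>) \<le> (\<Sum>j\<in>{1..P}. 1 / real j)"
    if "inj_on f A" "f ` A \<subseteq> {1..P}" "\<And>n. n \<in> A \<Longrightarrow> \<bar>real m - real n\<bar> = real (f n)" for A f
  proof -
    have "(\<Sum>n\<in>A. 1 / \<bar>real m - real n\<bar>) = (\<Sum>j\<in>f ` A. 1 / real j)"
      using that(1,3) by (subst sum.reindex) auto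
    also have "\<dots> \<le> (\<Sum>j\<in>{1..P}. 1 / real j)" using that(2) by (intro sum_mono2) auto
    finally show ?thesis .
  qed
  have un: "{1..P} - {m} = {1..<m} \<union> {m<..P}" using assms by auto
  have "(\<Sum>n\<in>{1..P} - {m}. 1 / \<bar>real m - real n\<bar>) =
      (\<Sum>n\<in>{1..<m}. 1 / \<bar>real m - real n\<bar>) + (\<Sum>n\<in>{m<..P}. 1 / \<bar>real m - real n\<bar>)"
    unfolding un by (rule sum.union_disjoint) auto
  also have "\<dots> \<le> (\<Sum>j\<in>{1..P}. 1 / real j) + (\<Sum>j\<in>{1..P}. 1 / real j)"
  proof (rule add_mono)
    show "(\<Sum>n\<in>{1..<m}. 1 / \<bar>real m - real n\<bar>) \<le> (\<Sum>j\<in>{1..P}. 1 / real j)"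
      by (rule le[of "\<lambda>n. m - n"]) (use assms in \<open>auto simp: inj_on_def of_nat_diff\<close>)
    show "(\<Sum>n\<in>{m<..P}. 1 / \<bar>real m - real n\<bar>) \<le> (\<Sum>j\<in>{1..P}. 1 / real j)"
      by (rule le[of "\<lambda>n. n - m"]) (use assms in \<open>auto simp: inj_on_def of_nat_diff\<close>)
  qed
  also have "\<dots> \<le> 2 * (1 + ln (real P))"
    using sum_inverse_le[of P] assms by simp
  finally show ?thesis .
qed

text \<open>Spacing of the frequencies of a Dirichlet polynomial of length \<open>P\<close>, from
  \<open>ln x \<le> x - 1\<close> at a quotient of two integers.\<close>

lemma abs_ln_diff_ge:
  assumes "m \<in> {1..P}" "n \<in> {1..P}"
  shows "\<bar>ln (real m) - ln (real n)\<bar> \<ge> \<bar>real m - real n\<bar> / real P"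
proof -
  have *: "ln (real b) - ln (real a) \<ge> (real b - real a) / real P"
    if "1 \<le> a" "a \<le> b" "b \<le> P" for a b
  proof -
    have "ln (real a / real b) \<le> real a / real b - 1" by (rule ln_le_minus_one) (use that in simp)
    moreover have "ln (real a / real b) = ln (real a) - ln (real b)" using that by (simp add: ln_div)
    moreover have "(real b - real a) / real P \<le> (real b - real a) / real b"
      using that by (intro divide_left_mono) auto
    moreover have "(real b - real a) / real b = 1 - real a / real b" using that by (simp add: field_simps)
    ultimately show ?thesis by linarith
  qed
  show ?thesis
  proof (cases "m \<le> n")
    case True
    then show ?thesis using *[of m n] assms by (simp add: abs_if)
  next
    case False
    then show ?thesis using *[of n m] assms by (simp add: abs_if)
  qed
qed

lemma norm_sum_cis_square:
  fixes a :: "nat \<Rightarrow> real" and \<theta> :: "nat \<Rightarrow> real"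
  assumes "finite A"
  shows "(norm (\<Sum>m\<in>A. of_real (a m) * cis (\<theta> m)))\<^sup>2 = (\<Sum>m\<in>A. \<Sum>n\<in>A. a m * a n * cos (\<theta> m - \<theta> n))"
proof -
  have "(norm (\<Sum>m\<in>A. of_real (a m) * cis (\<theta> m)))\<^sup>2 =
     (\<Sum>m\<in>A. a m * cos (\<theta> m))\<^sup>2 + (\<Sum>m\<in>A. a m * sin (\<theta> m))\<^sup>2"
    by (simp add: cmod_power2)
  also have "\<dots> = (\<Sum>m\<in>A. \<Sum>n\<in>A. a m * a n * cos (\<theta> m - \<theta> n))"
    by (simp add: power2_eq_square sum_product cos_diff algebra_simps flip: sum.distrib)
  finally show ?thesis .
qed

lemma integral_cos_mult:
  fixes U c :: real
  assumes "U \<ge> 0" "c \<noteq> 0"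
  shows "((\<lambda>u. cos (c * u)) has_integral sin (c * U) / c) {0..U}"
proof -
  have "((\<lambda>u. cos (c * u)) has_integral sin (c * U) / c - sin (c * 0) / c) {0..U}"
    using assms by (intro fundamental_theorem_of_calculus)
       (auto intro!: derivative_eq_intros simp flip: has_real_derivative_iff_has_vector_derivative)
  then show ?thesis by simp
qed

text \<open>Elementary mean value theorem. Diagonal terms integrate to \<open>U\<close>, and
  off-diagonal ones to at most the inverse of the frequency difference. With
  \<open>\<bar>a m * a n\<bar>\<close> at most the mean of the two squares and \<open>I\<close>
  symmetric, the double sum reduces to row sums, and the spacing of the \<open>ln m\<close> makes
  each row at most \<open>P / \<kappa>\<close> times a harmonic sum over both sides.\<close>

lemma mean_square_le:
  fixes a :: "nat \<Rightarrow> real"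
  assumes U: "U \<ge> 0" and \<kappa>: "\<kappa> > 0" and P: "P \<ge> 1"
  shows "integral {0..U} (\<lambda>u. (norm (\<Sum>m\<in>{1..P}. of_real (a m) * cis (- (\<kappa> * ln (real m) * u))))\<^sup>2)
           \<le> (U + 2 * real P * (1 + ln (real P)) / \<kappa>) * (\<Sum>m\<in>{1..P}. (a m)\<^sup>2)"
proof -
  define c where "c = (\<lambda>m n. \<kappa> * (ln (real n) - ln (real m)))"
  define I where "I = (\<lambda>m n. if m = n then U else sin (c m n * U) / c m n)"
  let ?A = "{1..P}"
  have c0: "c m n \<noteq> 0" if "m \<in> ?A" "n \<in> ?A" "m \<noteq> n" for m n
    using that \<kappa> by (auto simp: c_def)
  have hI: "((\<lambda>u. a m * a n * cos (c m n * u)) has_integral a m * a n * I m n) {0..U}"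
    if "m \<in> ?A" "n \<in> ?A" for m n
  proof -
    have "((\<lambda>u. cos (c m n * u)) has_integral I m n) {0..U}"
    proof (cases "m = n")
      case True
      then show ?thesis using U has_integral_const_real[of "1::real" 0 U] by (simp add: I_def c_def)
    next
      case False
      then show ?thesis using integral_cos_mult[OF U c0[OF that(1,2)]] by (simp add: I_def)
    qed
    then show ?thesis by (rule has_integral_mult_right)
  qed
  have "(norm (\<Sum>m\<in>?A. of_real (a m) * cis (- (\<kappa> * ln (real m) * u))))\<^sup>2 =
      (\<Sum>m\<in>?A. \<Sum>n\<in>?A. a m * a n * cos (c m n * u))" for u
    by (subst norm_sum_cis_square) (simp_all add: c_def algebra_simps)
  then have "integral {0..U} (\<lambda>u. (norm (\<Sum>m\<in>?A. of_real (a m) * cis (- (\<kappa> * ln (real m) * u))))\<^sup>2)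
     = integral {0..U} (\<lambda>u. \<Sum>m\<in>?A. \<Sum>n\<in>?A. a m * a n * cos (c m n * u))" by simp
  also have "\<dots> = (\<Sum>m\<in>?A. \<Sum>n\<in>?A. a m * a n * I m n)"
    by (intro integral_unique has_integral_sum hI) auto
  also have "\<dots> \<le> (\<Sum>m\<in>?A. \<Sum>n\<in>?A. (((a m)\<^sup>2 + (a n)\<^sup>2) / 2) * \<bar>I m n\<bar>)"
  proof (intro sum_mono)
    fix m n
    have "\<bar>a m * a n\<bar> \<le> ((a m)\<^sup>2 + (a n)\<^sup>2) / 2"
      using sum_squares_bound[of "\<bar>a m\<bar>" "\<bar>a n\<bar>"] by (simp add: abs_mult power2_eq_square)
    then have "\<bar>a m * a n\<bar> * \<bar>I m n\<bar> \<le> (((a m)\<^sup>2 + (a n)\<^sup>2) / 2) * \<bar>I m n\<bar>"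
      by (rule mult_right_mono) simp
    then show "a m * a n * I m n \<le> (((a m)\<^sup>2 + (a n)\<^sup>2) / 2) * \<bar>I m n\<bar>"
      by (simp flip: abs_mult)
  qed
  also have "\<dots> = (\<Sum>m\<in>?A. \<Sum>n\<in>?A. (a m)\<^sup>2 / 2 * \<bar>I m n\<bar>) + (\<Sum>m\<in>?A. \<Sum>n\<in>?A. (a n)\<^sup>2 / 2 * \<bar>I m n\<bar>)"
    by (simp add: add_divide_distrib algebra_simps flip: sum.distrib)
  also have "(\<Sum>m\<in>?A. \<Sum>n\<in>?A. (a n)\<^sup>2 / 2 * \<bar>I m n\<bar>) = (\<Sum>n\<in>?A. \<Sum>m\<in>?A. (a n)\<^sup>2 / 2 * \<bar>I m n\<bar>)"
    by (rule sum.swap)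
  also have "\<dots> = (\<Sum>m\<in>?A. \<Sum>n\<in>?A. (a m)\<^sup>2 / 2 * \<bar>I m n\<bar>)"
  proof (intro sum.cong refl)
    fix m n
    have "c n m = - c m n" by (simp add: c_def algebra_simps)
    then have "I n m = I m n" by (simp add: I_def)
    then show "(a m)\<^sup>2 / 2 * \<bar>I n m\<bar> = (a m)\<^sup>2 / 2 * \<bar>I m n\<bar>" by simp
  qed
  also have "(\<Sum>m\<in>?A. \<Sum>n\<in>?A. (a m)\<^sup>2 / 2 * \<bar>I m n\<bar>) + (\<Sum>m\<in>?A. \<Sum>n\<in>?A. (a m)\<^sup>2 / 2 * \<bar>I m n\<bar>) =
      (\<Sum>m\<in>?A. (a m)\<^sup>2 * (\<Sum>n\<in>?A. \<bar>I m n\<bar>))"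
    by (simp add: sum_distrib_left mult.commute flip: sum.distrib)
  also have "\<dots> \<le> (\<Sum>m\<in>?A. (a m)\<^sup>2 * (U + 2 * real P * (1 + ln (real P)) / \<kappa>))"
  proof (intro sum_mono mult_left_mono)
    fix m assume m: "m \<in> ?A"
    have "(\<Sum>n\<in>?A. \<bar>I m n\<bar>) = \<bar>I m m\<bar> + (\<Sum>n\<in>?A - {m}. \<bar>I m n\<bar>)"
      using m by (subst sum.remove[of _ m]) auto
    also have "(\<Sum>n\<in>?A - {m}. \<bar>I m n\<bar>) \<le> (\<Sum>n\<in>?A - {m}. real P / \<kappa> * (1 / \<bar>real m - real n\<bar>))"
    proof (rule sum_mono)
      fix n assume n: "n \<in> ?A - {m}"
      have "\<bar>c m n\<bar> = \<kappa> * \<bar>ln (real m) - ln (real n)\<bar>"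
        using \<kappa> by (simp add: c_def abs_mult abs_minus_commute)
      then have c: "\<bar>c m n\<bar> \<ge> \<kappa> * (\<bar>real m - real n\<bar> / real P)"
        using abs_ln_diff_ge[OF m, of n] n \<kappa> by (simp only:) (intro mult_left_mono, auto)
      have pos: "\<kappa> * (\<bar>real m - real n\<bar> / real P) > 0" using \<kappa> n P by auto
      have "\<bar>I m n\<bar> = \<bar>sin (c m n * U)\<bar> / \<bar>c m n\<bar>" using n by (simp add: I_def)
      also have "\<dots> \<le> 1 / (\<kappa> * (\<bar>real m - real n\<bar> / real P))"
        using c pos by (intro frac_le) auto
      finally show "\<bar>I m n\<bar> \<le> real P / \<kappa> * (1 / \<bar>real m - real n\<bar>)" by simp
    qed
    also have "\<dots> = real P / \<kappa> * (\<Sum>n\<in>?A - {m}. 1 / \<bar>real m - real n\<bar>)"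
      by (simp add: sum_distrib_left)
    also have "\<dots> \<le> real P / \<kappa> * (2 * (1 + ln (real P)))"
      using \<kappa> m by (intro mult_left_mono sum_inverse_dist_le) auto
    finally show "(\<Sum>n\<in>?A. \<bar>I m n\<bar>) \<le> U + 2 * real P * (1 + ln (real P)) / \<kappa>"
      using U by (simp add: I_def field_simps)
  qed auto
  finally show ?thesis by (subst mult.commute) (simp only: sum_distrib_right)
qed

text \<open>As \<open>1 - 2 * \<sigma> \<ge> 0\<close>, the factor
  \<open>d powr (1 - 2 * \<sigma>)\<close> can be taken at \<open>N\<close>, which leaves a harmonic
  sum. The logarithm buys uniformity in \<sigma>, including \<sigma> = 1/2.\<close>

lemma sum_powr_le:
  assumes N: "1 \<le> P" "P \<le> N" and \<sigma>: "2 * \<sigma> \<le> 1"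
  shows "(\<Sum>d\<in>{1..P}. real d powr (- 2 * \<sigma>)) \<le> real N powr (1 - 2 * \<sigma>) * (1 + ln (real N))"
proof -
  have "(\<Sum>d\<in>{1..P}. real d powr (- 2 * \<sigma>)) \<le> (\<Sum>d\<in>{1..N}. real d powr (- 2 * \<sigma>))"
    using N by (intro sum_mono2) auto
  also have "\<dots> \<le> (\<Sum>d\<in>{1..N}. real N powr (1 - 2 * \<sigma>) * (1 / real d))"
  proof (rule sum_mono)
    fix d assume d: "d \<in> {1..N}"
    have "real d powr (- 2 * \<sigma>) = real d powr (1 - 2 * \<sigma>) * (1 / real d)"
      using d by (simp add: powr_diff powr_minus field_simps)
    also have "\<dots> \<le> real N powr (1 - 2 * \<sigma>) * (1 / real d)"
      using d \<sigma> by (intro mult_right_mono powr_mono2) auto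
    finally show "real d powr (- 2 * \<sigma>) \<le> real N powr (1 - 2 * \<sigma>) * (1 / real d)" .
  qed
  also have "\<dots> = real N powr (1 - 2 * \<sigma>) * (\<Sum>d\<in>{1..N}. 1 / real d)"
    by (simp add: sum_distrib_left)
  also have "\<dots> \<le> real N powr (1 - 2 * \<sigma>) * (1 + ln (real N))"
    using N by (intro mult_left_mono sum_inverse_le) auto
  finally show ?thesis .
qed

lemma continuous_on_char_poly [continuous_intros]:
  assumes "continuous_on A f" shows "continuous_on A (\<lambda>x. char_poly N (f x))"
  unfolding char_poly_def by (intro continuous_intros assms)

lemma char_poly_eq_cis:
  "char_poly P (Complex \<sigma> (\<kappa> * u)) =
     (\<Sum>d\<in>{1..P}. of_real (char4 (-1) d * real d powr (-\<sigma>)) * cis (- (\<kappa> * ln (real d) * u)))"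
  unfolding char_poly_def
proof (rule sum.cong)
  fix d assume d: "d \<in> {1..P}"
  have "- Complex \<sigma> (\<kappa> * u) * of_real (ln (real d)) =
      of_real (- \<sigma> * ln (real d)) + \<i> * of_real (- (\<kappa> * ln (real d) * u))"
    by (simp add: complex_eq_iff)
  then have "exp (- Complex \<sigma> (\<kappa> * u) * of_real (ln (real d))) =
      of_real (real d powr (-\<sigma>)) * cis (- (\<kappa> * ln (real d) * u))"
    using d by (simp only: exp_add cis_conv_exp exp_of_real) (simp add: powr_def)
  then show "of_real (char4 (-1) d) * exp (- Complex \<sigma> (\<kappa> * u) * of_real (ln (real d))) =
     of_real (char4 (-1) d * real d powr (-\<sigma>)) * cis (- (\<kappa> * ln (real d) * u))"
    by simp
qed simp

text \<open>Up to an error 3 the polynomial is replaced by its part of length about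
  \<open>2 * (U + 1)\<close>. That length is comparable to the interval, so the off-diagonal terms
  lose only a logarithm, and \<open>B ^ 2\<close> absorbs the diagonal sum together with this
  logarithm.\<close>

lemma integral_char_poly_le:
  assumes N: "N \<ge> 1" and \<sigma>: "0 \<le> \<sigma>" "\<sigma> \<le> 1/2" and \<kappa>: "0 < \<kappa>" "\<kappa> \<le> 1" and U: "U \<ge> 0"
  shows "integral {0..U} (\<lambda>u. norm (char_poly N (Complex \<sigma> (\<kappa> * u))))
           \<le> 10 / \<kappa> * (1 + U) * (real N powr (1/2 - \<sigma>) * (1 + ln (real N)))"
proof -
  define B where "B = real N powr (1/2 - \<sigma>) * (1 + ln (real N))"
  \<comment> \<open>The argument \<open>w\<close> has norm at most \<open>U + 1/2\<close> on the
    interval, so this length satisfies the hypothesis \<open>2 * norm w \<le> P\<close> of the tail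
    bound.\<close>
  define P where "P = min N (nat \<lceil>2 * (U + 1)\<rceil>)"
  have "nat \<lceil>2 * (U + 1)\<rceil> \<ge> 1"
    unfolding One_nat_def Suc_le_eq zero_less_nat_eq zero_less_ceiling using U by simp
  then have P1: "P \<ge> 1" "P \<le> N" using N by (auto simp: P_def)
  have PU: "real P \<le> 2 * U + 3" using U unfolding P_def by (simp add: min_def) linarith
  have N1: "real N powr (1/2 - \<sigma>) \<ge> 1" using N \<sigma> by (intro ge_one_powr_ge_zero) auto
  have ln: "0 \<le> ln (real P)" "ln (real P) \<le> ln (real N)" using P1 by auto
  have B1: "B \<ge> 1" unfolding B_def using N1 N mult_mono[of 1 "real N powr (1/2 - \<sigma>)" 1 "1 + ln (real N)"] by simp
  define D where "D = (\<lambda>u. char_poly P (Complex \<sigma> (\<kappa> * u)))"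
  have cont: "continuous_on {0..U} D"
    unfolding D_def Complex_eq by (intro continuous_intros)
  have pw: "norm (char_poly N (Complex \<sigma> (\<kappa> * u))) \<le> ((norm (D u))\<^sup>2 / B + B) / 2 + 3" if u: "u \<in> {0..U}" for u
  proof -
    have "norm (char_poly N (Complex \<sigma> (\<kappa> * u)) - D u) \<le> 3"
    proof (cases "P = N")
      case False
      then have P: "real P \<ge> 2 * (U + 1)" unfolding P_def by (simp add: min_def split: if_splits) linarith
      have "norm (Complex \<sigma> (\<kappa> * u)) \<le> \<bar>\<sigma>\<bar> + \<bar>\<kappa> * u\<bar>"
        using cmod_le[of "Complex \<sigma> (\<kappa> * u)"] by simp
      also have "\<bar>\<kappa> * u\<bar> \<le> 1 * U" unfolding abs_mult using \<kappa> u by (intro mult_mono) auto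
      finally have "norm (Complex \<sigma> (\<kappa> * u)) \<le> \<bar>\<sigma>\<bar> + 1 * U" by simp
      moreover have "\<bar>\<sigma>\<bar> \<le> 1/2" using \<sigma> by simp
      ultimately have "2 * norm (Complex \<sigma> (\<kappa> * u)) \<le> real P" using P by argo
      then show ?thesis unfolding D_def using \<sigma> P1 by (intro norm_char_poly_diff_le) auto
    qed (simp add: D_def)
    then have "norm (char_poly N (Complex \<sigma> (\<kappa> * u))) \<le> norm (D u) + 3"
      using norm_triangle_sub[of "char_poly N (Complex \<sigma> (\<kappa> * u))" "D u"] by linarith
    \<comment> \<open>Pointwise replacement for the Cauchy-Schwarz inequality; \<open>B\<close> is
      the expected root mean square, so nothing is lost in order of magnitude.\<close>
    also have "norm (D u) \<le> ((norm (D u))\<^sup>2 / B + B) / 2"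
      using B1 sum_squares_bound[of "norm (D u)" B] by (simp add: field_simps power2_eq_square)
    finally show ?thesis by simp
  qed
  have i1: "(\<lambda>u. norm (char_poly N (Complex \<sigma> (\<kappa> * u)))) integrable_on {0..U}"
    unfolding Complex_eq by (intro integrable_continuous_interval continuous_intros)
  have i2: "(\<lambda>u. (norm (D u))\<^sup>2) integrable_on {0..U}"
    by (intro integrable_continuous_interval continuous_intros cont)
  have hi: "((\<lambda>u. ((norm (D u))\<^sup>2 / B + B) / 2 + 3) has_integral
       (integral {0..U} (\<lambda>u. (norm (D u))\<^sup>2) / B + U * B) / 2 + U * 3) {0..U}"
    using U has_integral_const_real[of B 0 U] has_integral_const_real[of "3::real" 0 U]
    by (intro has_integral_add has_integral_divide integrable_integral[OF i2]) auto
  have "integral {0..U} (\<lambda>u. norm (char_poly N (Complex \<sigma> (\<kappa> * u))))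
      \<le> integral {0..U} (\<lambda>u. ((norm (D u))\<^sup>2 / B + B) / 2 + 3)"
    by (rule integral_le[OF i1 has_integral_integrable[OF hi] pw])
  also have "\<dots> = (integral {0..U} (\<lambda>u. (norm (D u))\<^sup>2) / B + U * B) / 2 + U * 3"
    by (rule integral_unique[OF hi])
  finally have 1: "integral {0..U} (\<lambda>u. norm (char_poly N (Complex \<sigma> (\<kappa> * u)))) \<le> \<dots>" .
  have "integral {0..U} (\<lambda>u. (norm (D u))\<^sup>2) \<le>
     (U + 2 * real P * (1 + ln (real P)) / \<kappa>) * (\<Sum>d\<in>{1..P}. (char4 (-1) d * real d powr (-\<sigma>))\<^sup>2)"
    unfolding D_def char_poly_eq_cis by (rule mean_square_le[OF U \<kappa>(1) P1(1)])
  also have "\<dots> \<le> (7 * (1 + U) * (1 + ln (real N)) / \<kappa>) * (real N powr (1 - 2 * \<sigma>) * (1 + ln (real N)))"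
  proof (rule mult_mono)
    have "U \<le> U * (1 + ln (real N)) / \<kappa>"
    proof -
      have "U * \<kappa> \<le> U * (1 + ln (real N))" using U \<kappa> ln by (intro mult_left_mono) auto
      then show ?thesis using \<kappa> by (simp add: field_simps)
    qed
    moreover have "2 * real P * (1 + ln (real P)) / \<kappa> \<le> 2 * (2 * U + 3) * (1 + ln (real N)) / \<kappa>"
      using PU ln \<kappa> U by (intro divide_right_mono mult_mono) auto
    ultimately have "U + 2 * real P * (1 + ln (real P)) / \<kappa> \<le>
        U * (1 + ln (real N)) / \<kappa> + 2 * (2 * U + 3) * (1 + ln (real N)) / \<kappa>"
      by (rule add_mono)
    also have "\<dots> = (5 * U + 6) * (1 + ln (real N)) / \<kappa>"
      by (simp add: add_divide_distrib[symmetric] distrib_right[symmetric])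
    also have "\<dots> \<le> 7 * (1 + U) * (1 + ln (real N)) / \<kappa>"
      using ln \<kappa> U by (intro divide_right_mono mult_right_mono) auto
    finally show "U + 2 * real P * (1 + ln (real P)) / \<kappa> \<le> 7 * (1 + U) * (1 + ln (real N)) / \<kappa>" .
    have "(\<Sum>d\<in>{1..P}. (char4 (-1) d * real d powr (-\<sigma>))\<^sup>2) \<le> (\<Sum>d\<in>{1..P}. real d powr (- 2 * \<sigma>))"
    proof (rule sum_mono)
      fix d
      have sq: "(real d powr (-\<sigma>))\<^sup>2 = real d powr (- 2 * \<sigma>)"
        by (simp add: power2_eq_square powr_add[symmetric])
      have "(char4 (-1) d)\<^sup>2 \<le> 1" by (simp add: char4_def)
      then have "(char4 (-1) d)\<^sup>2 * real d powr (- 2 * \<sigma>) \<le> 1 * real d powr (- 2 * \<sigma>)"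
        by (rule mult_right_mono) simp
      then show "(char4 (-1) d * real d powr (-\<sigma>))\<^sup>2 \<le> real d powr (- 2 * \<sigma>)"
        unfolding power_mult_distrib sq by simp
    qed
    also have "\<dots> \<le> real N powr (1 - 2 * \<sigma>) * (1 + ln (real N))"
      using \<sigma> by (intro sum_powr_le P1) auto
    finally show "(\<Sum>d\<in>{1..P}. (char4 (-1) d * real d powr (-\<sigma>))\<^sup>2) \<le> \<dots>" .
  qed (use U ln \<kappa> in \<open>auto intro!: sum_nonneg divide_nonneg_nonneg mult_nonneg_nonneg\<close>)
  also have "\<dots> = 7 * (1 + U) / \<kappa> * (B * B)"
  proof -
    have "real N powr (1/2 - \<sigma>) * real N powr (1/2 - \<sigma>) = real N powr (1 - 2 * \<sigma>)"
      by (simp flip: powr_add)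
    then show ?thesis by (simp add: B_def)
  qed
  finally have "integral {0..U} (\<lambda>u. (norm (D u))\<^sup>2) / B \<le> 7 * (1 + U) / \<kappa> * B"
    using B1 by (simp add: divide_le_eq mult.assoc)
  then have "(integral {0..U} (\<lambda>u. (norm (D u))\<^sup>2) / B + U * B) / 2 + U * 3 \<le>
      (7 * (1 + U) / \<kappa> * B + U * B) / 2 + U * 3"
    by (intro add_mono divide_right_mono order.refl) auto
  also have "\<dots> \<le> (7 * (1 + U) / \<kappa> * B + (1 + U) / \<kappa> * B) / 2 + (1 + U) / \<kappa> * B * 3"
  proof -
    have k: "(1 + U) / \<kappa> \<ge> U" using \<kappa> U mult_mono[of U "1 + U" \<kappa> 1] by (simp add: field_simps)
    have 1: "U * B \<le> (1 + U) / \<kappa> * B" using k B1 by (intro mult_right_mono) auto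
    have 2: "U * 1 \<le> (1 + U) / \<kappa> * B" using k B1 U \<kappa> by (intro mult_mono) auto
    have "(x + y) / 2 + U * 3 \<le> (x + z) / 2 + z * 3" if "y \<le> z" "U * 1 \<le> z" for x y z :: real
      using that by argo
    from this[OF 1 2] show ?thesis .
  qed
  also have "\<dots> \<le> 10 / \<kappa> * (1 + U) * B" using B1 U \<kappa> by (simp add: field_simps)
  finally show ?thesis using 1 by (simp add: B_def)
qed

text \<open>Integration by parts with the primitive \<open>F\<close>, which vanishes at 0. Linear
  growth of \<open>F\<close> makes the weighted integral logarithmic in \<open>T\<close>.\<close>

lemma integral_weighted_le:
  fixes g :: "real \<Rightarrow> real"
  assumes g: "continuous_on {0..T} g" and T: "T \<ge> 0"
    and bound: "\<And>U. U \<in> {0..T} \<Longrightarrow> integral {0..U} g \<le> K * (1 + U)" and K: "K \<ge> 0"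
  shows "integral {0..T} (\<lambda>u. g u / (1 + u)) \<le> K * (1 + ln (1 + T))"
proof -
  define F where "F = (\<lambda>u. integral {0..u} g)"
  have F: "(F has_real_derivative g u) (at u within {0..T})" if "u \<in> {0..T}" for u
    unfolding F_def has_real_derivative_iff_has_vector_derivative
    by (rule integral_has_vector_derivative[OF g that])
  have contF: "continuous_on {0..T} F"
    by (rule DERIV_continuous_on[OF F])
  have alg: "(a * (1 + u) - b) / ((1 + u) * (1 + u)) = a / (1 + u) - b / (1 + u)\<^sup>2" if "0 \<le> u" for a b u :: real
    using that by (simp add: power2_eq_square diff_divide_distrib)
  have 1: "((\<lambda>u. g u / (1 + u) - F u / (1 + u)\<^sup>2) has_integral F T / (1 + T) - F 0 / (1 + 0)) {0..T}"
    using T by (intro fundamental_theorem_of_calculus)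
      (auto intro!: derivative_eq_intros F alg
            simp flip: has_real_derivative_iff_has_vector_derivative)
  have 2: "((\<lambda>u. K / (1 + u)) has_integral K * ln (1 + T) - K * ln (1 + 0)) {0..T}"
    using T by (intro fundamental_theorem_of_calculus)
      (auto intro!: derivative_eq_intros simp flip: has_real_derivative_iff_has_vector_derivative)
  have i3: "(\<lambda>u. F u / (1 + u)\<^sup>2) integrable_on {0..T}"
    by (intro integrable_continuous_interval continuous_intros contF) auto
  have "integral {0..T} (\<lambda>u. g u / (1 + u)) =
      integral {0..T} (\<lambda>u. (g u / (1 + u) - F u / (1 + u)\<^sup>2) + F u / (1 + u)\<^sup>2)" by simp
  also have "\<dots> = integral {0..T} (\<lambda>u. g u / (1 + u) - F u / (1 + u)\<^sup>2) + integral {0..T} (\<lambda>u. F u / (1 + u)\<^sup>2)"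
    by (rule integral_add[OF has_integral_integrable[OF 1] i3])
  also have "integral {0..T} (\<lambda>u. g u / (1 + u) - F u / (1 + u)\<^sup>2) = F T / (1 + T)"
    using integral_unique[OF 1] by (simp add: F_def)
  also have "F T / (1 + T) \<le> K" using bound[of T] T by (simp add: F_def divide_le_eq)
  also have "integral {0..T} (\<lambda>u. F u / (1 + u)\<^sup>2) \<le> integral {0..T} (\<lambda>u. K / (1 + u))"
  proof (rule integral_le[OF i3 has_integral_integrable[OF 2]])
    fix u assume u: "u \<in> {0..T}"
    have "F u / (1 + u)\<^sup>2 \<le> K * (1 + u) / (1 + u)\<^sup>2"
      using bound[OF u] by (intro divide_right_mono) (auto simp: F_def)
    then show "F u / (1 + u)\<^sup>2 \<le> K / (1 + u)" using u by (simp add: power2_eq_square)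
  qed
  also have "\<dots> = K * ln (1 + T)" using integral_unique[OF 2] by simp
  finally show ?thesis by (simp add: algebra_simps)
qed

subsection \<open>Dirichlet series\<close>

abbreviation dterm :: "(nat \<Rightarrow> complex) \<Rightarrow> complex \<Rightarrow> nat \<Rightarrow> complex" where
  "dterm a s n \<equiv> a (Suc n) / of_nat (Suc n) powr s"

definition dconv :: "(nat \<Rightarrow> complex) \<Rightarrow> (nat \<Rightarrow> complex) \<Rightarrow> nat \<Rightarrow> complex" where
  "dconv a b n = (\<Sum>d | d dvd n. a d * b (n div d))"

lemma norm_dterm: "norm (dterm a s n) = norm (a (Suc n)) * real (Suc n) powr (- Re s)"
  by (simp add: norm_mult norm_inverse norm_powr_real_powr powr_minus divide_inverse del: of_nat_Suc)

lemma of_nat_mult_powr: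
  fixes s :: complex
  shows "(of_nat (m * n) :: complex) powr s = of_nat m powr s * of_nat n powr s"
proof -
  have "(of_real (real m) * of_real (real n) :: complex) powr s = of_real (real m) powr s * of_real (real n) powr s"
    by (rule powr_times_real) auto
  then show ?thesis by simp
qed

text \<open>Absolute convergence makes the family of products summable over all pairs, and the pairs
  are then regrouped by the value of the product.\<close>

lemma dirichlet_series_mult:
  assumes a: "summable (\<lambda>n. norm (dterm a s n))" and b: "summable (\<lambda>n. norm (dterm b s n))"
  shows "dterm (dconv a b) s sums (dirichlet_series a s * dirichlet_series b s)"
proof -
  define f where "f = dterm a s"
  define g where "g = dterm b s"
  have f: "(f has_sum dirichlet_series a s) UNIV" and g: "(g has_sum dirichlet_series b s) UNIV"
    unfolding f_def g_def dirichlet_series_def using a b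
    by (intro norm_summable_imp_has_sum summable_sums summable_norm_cancel[OF a]
              summable_norm_cancel[OF b]; simp)+
  have fn: "(\<lambda>n. norm (f n)) summable_on UNIV" and gn: "(\<lambda>n. norm (g n)) summable_on UNIV"
    unfolding f_def g_def using a b
    by (intro norm_summable_imp_summable_on; simp)+
  have abs: "(\<lambda>x. norm (case x of (m,n) \<Rightarrow> f m * g n)) summable_on (UNIV \<times> UNIV)"
  proof (subst Infinite_Sum.abs_summable_on_Sigma_iff, intro conjI ballI)
    show "(\<lambda>n. norm (case (m, n) of (m, n) \<Rightarrow> f m * g n)) summable_on UNIV" for m
      using summable_on_cmult_right[OF gn, of "norm (f m)"] by (simp add: norm_mult)
    have "(\<lambda>m. norm (f m) * infsum (\<lambda>n. norm (g n)) UNIV) summable_on UNIV"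
      by (rule summable_on_cmult_left[OF fn])
    moreover have "infsum (\<lambda>n. norm (f m * g n)) UNIV = norm (f m) * infsum (\<lambda>n. norm (g n)) UNIV" for m
      by (simp add: norm_mult infsum_cmult_right')
    moreover have "infsum (\<lambda>n. norm (g n)) UNIV \<ge> 0" by (rule infsum_nonneg) simp
    ultimately show "(\<lambda>m. norm (infsum (\<lambda>n. norm (case (m, n) of (m, n) \<Rightarrow> f m * g n)) UNIV)) summable_on UNIV"
      by (simp add: abs_mult)
  qed
  have "((\<lambda>(m,n). f m * g n) has_sum (dirichlet_series a s * dirichlet_series b s)) (UNIV \<times> UNIV)"
  proof (rule has_sum_SigmaI)
    show "((\<lambda>n. case (m, n) of (m, n) \<Rightarrow> f m * g n) has_sum (f m * dirichlet_series b s)) UNIV" for m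
      using has_sum_cmult_right[OF g, of "f m"] by simp
    show "((\<lambda>m. f m * dirichlet_series b s) has_sum (dirichlet_series a s * dirichlet_series b s)) UNIV"
      by (rule has_sum_cmult_left[OF f])
    show "(\<lambda>(m,n). f m * g n) summable_on (UNIV \<times> UNIV)"
      by (rule Infinite_Sum.abs_summable_summable[OF abs])
  qed
  also have "?this \<longleftrightarrow> ((\<lambda>(n,d). a d * b (Suc n div d) / of_nat (Suc n) powr s) has_sum
      (dirichlet_series a s * dirichlet_series b s)) (SIGMA n:UNIV. {d. d dvd Suc n})"
  \<comment> \<open>Indices are shifted by one: \<open>m\<close> and \<open>n\<close> stand for the
    integers \<open>Suc m\<close> and \<open>Suc n\<close>, which explains every \<open>- 1\<close>
    in the two maps.\<close>
  proof (rule has_sum_reindex_bij_witness[of _ "\<lambda>(n,d). (d - 1, Suc n div d - 1)" "\<lambda>(m,n). (Suc m * Suc n - 1, Suc m)"])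
    fix x :: "nat \<times> nat"
    show "(case case x of (m, n) \<Rightarrow> (Suc m * Suc n - 1, Suc m) of (n, d) \<Rightarrow> (d - 1, Suc n div d - 1)) = x"
      by (cases x) (simp del: mult_Suc mult_Suc_right)
    show "(case x of (m, n) \<Rightarrow> (Suc m * Suc n - 1, Suc m)) \<in> (SIGMA n:UNIV. {d. d dvd Suc n})"
      by (cases x) (simp del: mult_Suc mult_Suc_right)
    show "(case case x of (m, n) \<Rightarrow> (Suc m * Suc n - 1, Suc m) of
             (n, d) \<Rightarrow> a d * b (Suc n div d) / of_nat (Suc n) powr s) = (case x of (m, n) \<Rightarrow> f m * g n)"
      by (cases x) (simp add: f_def g_def of_nat_mult_powr del: mult_Suc mult_Suc_right of_nat_Suc of_nat_mult)
  next
    fix y assume "y \<in> (SIGMA n:UNIV. {d. d dvd Suc n})"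
    then obtain n d where y: "y = (n,d)" "d dvd Suc n" by auto
    then obtain e where e: "Suc n = d * e" by blast
    then have "d \<noteq> 0" "e \<noteq> 0" by (metis mult_0 Zero_not_Suc, metis mult_0_right Zero_not_Suc)
    then have de: "Suc (d - 1) = d" "Suc (e - 1) = e" by simp_all
    have div: "Suc n div d = e" unfolding e using \<open>d \<noteq> 0\<close> by (rule nonzero_mult_div_cancel_left)
    have n: "d * e - 1 = n" unfolding e[symmetric] by simp
    show "(case case y of (n, d) \<Rightarrow> (d - 1, Suc n div d - 1) of (m, n) \<Rightarrow> (Suc m * Suc n - 1, Suc m)) = y"
      by (simp only: y(1) prod.case div de n)
  qed auto
  finally have "((\<lambda>n. dterm (dconv a b) s n) has_sum (dirichlet_series a s * dirichlet_series b s)) UNIV"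
  proof (rule has_sum_SigmaD)
    fix n :: nat
    have "finite {d. d dvd Suc n}" by simp
    then show "((\<lambda>d. case (n, d) of (n, d) \<Rightarrow> a d * b (Suc n div d) / of_nat (Suc n) powr s)
        has_sum dterm (dconv a b) s n) {d. d dvd Suc n}"
      by (simp add: has_sum_finite_iff dconv_def sum_divide_distrib)
  qed
  then show ?thesis by (rule has_sum_imp_sums)
qed

lemma summable_Suc_powr: "\<sigma> > 1 \<Longrightarrow> summable (\<lambda>n. real (Suc n) powr (- \<sigma>))"
  using summable_real_powr_iff[of "-\<sigma>"] by (subst summable_Suc_iff) simp

lemma summable_dterm:
  assumes "\<And>n. norm (a n) \<le> C" "Re s > 1"
  shows "summable (\<lambda>n. norm (dterm a s n))"
proof (rule summable_comparison_test')
  show "summable (\<lambda>n. C * real (Suc n) powr (- Re s))"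
    using assms by (intro summable_mult summable_Suc_powr)
  show "norm (norm (dterm a s n)) \<le> C * real (Suc n) powr (- Re s)" for n
    using assms by (simp add: norm_dterm mult_right_mono del: of_nat_Suc)
qed

text \<open>Termwise differentiation; on a ball of radius \<open>(Re x - 1) / 2\<close> the real
  parts stay beyond \<open>1 + d\<close>, which supplies a summable majorant. The first claim
  identifies the derivative as a series with factors \<open>- ln n\<close>, as needed for the
  logarithmic derivative of \<open>L\<close>.\<close>

lemma dirichlet_series_has_field_derivative:
  assumes a: "\<And>n. norm (a n) \<le> C" and s: "Re s > 1"
  shows "(\<lambda>n. dterm (\<lambda>n. - of_real (ln (real n)) * a n) s n) sums deriv (dirichlet_series a) s"
    and "(dirichlet_series a has_field_derivative deriv (dirichlet_series a) s) (at s)"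
proof -
  define S where "S = {s. Re s > 1}"
  have op: "open S" unfolding S_def by (rule open_halfspace_Re_gt)
  have C: "C \<ge> 0" using a[of 0] norm_ge_zero order_trans by blast
  have "\<exists>g g'. \<forall>x\<in>S. ((\<lambda>n. dterm a x n) sums g x) \<and>
     ((\<lambda>n. dterm (\<lambda>n. - of_real (ln (real n)) * a n) x n) sums g' x) \<and> (g has_field_derivative g' x) (at x)"
  proof (rule series_and_derivative_comparison_local[OF op])
    fix n x assume "x \<in> S"
    have "((\<lambda>x. a (Suc n) / exp (x * of_real (ln (real (Suc n))))) has_field_derivative
        - of_real (ln (real (Suc n))) * a (Suc n) / exp (x * of_real (ln (real (Suc n))))) (at x)"
      by (auto intro!: derivative_eq_intros simp: field_simps simp del: of_nat_Suc)
    moreover have "of_nat (Suc n) powr x = exp (x * of_real (ln (real (Suc n))))" for x :: complex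
      using Ln_of_real[of "real (Suc n)"] by (simp add: powr_def del: of_nat_Suc)
    ultimately show "((\<lambda>x. dterm a x n) has_field_derivative dterm (\<lambda>n. - of_real (ln (real n)) * a n) x n) (at x)"
      by simp
  next
    fix x assume x: "x \<in> S"
    define d where "d = (Re x - 1) / 2"
    have d: "d > 0" using x by (simp add: d_def S_def)
    show "\<exists>d h. 0 < d \<and> summable h \<and> (\<forall>\<^sub>F n in sequentially. \<forall>y\<in>ball x d \<inter> S. norm (dterm a y n) \<le> h n)"
    proof (intro exI conjI always_eventually allI ballI)
      show "summable (\<lambda>n. C * real (Suc n) powr (- (1 + d)))"
        using d by (intro summable_mult summable_Suc_powr) auto
      fix n y assume y: "y \<in> ball x d \<inter> S"
      have "Re x - Re y \<le> norm (x - y)" using complex_Re_le_cmod[of "x - y"] by simp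
      then have "Re x - Re y \<le> d" using y by (simp add: dist_norm)
      then have "Re y \<ge> 1 + d" unfolding d_def by (simp add: field_simps)
      then show "norm (dterm a y n) \<le> C * real (Suc n) powr (- (1 + d))"
        unfolding norm_dterm using a C by (intro mult_mono powr_mono) auto
    qed (rule d)
  qed
  then obtain g g' where gg: "\<forall>x\<in>S. ((\<lambda>n. dterm a x n) sums g x) \<and>
     ((\<lambda>n. dterm (\<lambda>n. - of_real (ln (real n)) * a n) x n) sums g' x) \<and> (g has_field_derivative g' x) (at x)"
    by (elim exE) (rule that)
  note g = gg[rule_format, THEN conjunct1] gg[rule_format, THEN conjunct2, THEN conjunct1]
    gg[rule_format, THEN conjunct2, THEN conjunct2]
  have eq: "dirichlet_series a x = g x" if "x \<in> S" for x
    using g(1)[OF that] by (simp add: dirichlet_series_def sums_iff)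
  have sS: "s \<in> S" using s by (simp add: S_def)
  have der: "(dirichlet_series a has_field_derivative g' s) (at s)"
    by (rule has_field_derivative_transform_within_open[OF g(3)[OF sS] op sS]) (simp add: eq)
  show "(\<lambda>n. dterm (\<lambda>n. - of_real (ln (real n)) * a n) s n) sums deriv (dirichlet_series a) s"
    using g(2)[OF sS] DERIV_imp_deriv[OF der] by simp
  show "(dirichlet_series a has_field_derivative deriv (dirichlet_series a) s) (at s)"
    using der DERIV_imp_deriv[OF der] by simp
qed

section \<open>The series of the characters modulo 4\<close>

definition cchar :: "real \<Rightarrow> nat \<Rightarrow> complex" where "cchar e n = of_real (char4 e n)"
definition cmob :: "real \<Rightarrow> nat \<Rightarrow> complex" where "cmob e n = of_real (mob_char e n)"

lemma norm_cchar_le: "e\<^sup>2 = 1 \<Longrightarrow> norm (cchar e n) \<le> 1"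
  by (simp add: cchar_def abs_char4_le)

lemma norm_cmob_le: "e\<^sup>2 = 1 \<Longrightarrow> norm (cmob e n) \<le> 1"
  by (simp add: cmob_def abs_mob_char_le)

lemma dirichlet_character_cchar:
  assumes "e\<^sup>2 = 1" shows "dirichlet_character 4 (cchar e)"
proof -
  have "coprime n 4 \<longleftrightarrow> odd n" for n :: nat
  proof -
    have "coprime n (2 ^ 2) \<longleftrightarrow> odd n" by (subst coprime_power_right_iff) (auto simp: coprime_right_2_iff_odd)
    then show ?thesis by simp
  qed
  then show ?thesis
    unfolding dirichlet_character_def cchar_def
    by (auto simp: char4_add_4 char4_mult[OF assms] char4_eq_0_iff[OF assms])
qed

text \<open>Blocks of four separate the progressions 1 and 3 modulo 4, whose series are the ones
  that \<open>hz 1\<close> and \<open>hz 3\<close> continue.\<close>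

lemma sums_char4_groups:
  assumes e: "e\<^sup>2 = 1" and s: "Re s > 1"
  shows "(\<lambda>j. of_nat (4 * j + 1) powr (-s) + of_real e * of_nat (4 * j + 3) powr (-s)) sums
           dirichlet_series (cchar e) s"
proof -
  have "dterm (cchar e) s sums dirichlet_series (cchar e) s"
    unfolding dirichlet_series_def
    by (intro summable_sums summable_norm_cancel[OF summable_dterm[of _ 1]]) (auto simp: norm_cchar_le e s)
  then have "(\<lambda>j. sum (dterm (cchar e) s) {j * 4..<j * 4 + 4}) sums dirichlet_series (cchar e) s"
    by (rule sums_group) simp
  moreover have "sum (dterm (cchar e) s) {j * 4..<j * 4 + 4} =
      of_nat (4 * j + 1) powr (-s) + of_real e * of_nat (4 * j + 3) powr (-s)" for j
  proof -
    have "{j * 4..<j * 4 + 4} = {4*j, 4*j+1, 4*j+2, 4*j+3}" by auto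
    moreover have "Suc (4*j) mod 4 = 1" "Suc (4*j+1) mod 4 = 2" "Suc (4*j+2) mod 4 = 3" "Suc (4*j+3) mod 4 = 0"
      by presburger+
    ultimately show ?thesis
      by (simp add: cchar_def char4_def powr_minus divide_inverse add.commute)
  qed
  ultimately show ?thesis by simp
qed

text \<open>Every block of four is non-negative even if \<open>e = -1\<close>, and the first one is
  at least \<open>1 - 1/3\<close>. The uniform lower bound excludes a zero of \<open>L\<close> at 1
  and also shows that \<open>(s - 1) L\<close> is not constant.\<close>

lemma Re_dirichlet_series_char4_ge:
  assumes e: "e\<^sup>2 = 1" and s: "\<sigma> > 1"
  shows "Re (dirichlet_series (cchar e) (of_real \<sigma>)) \<ge> 2/3"
proof -
  have e1: "e \<ge> -1" using e by (auto simp: power2_eq_1_iff)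
  define t where "t = (\<lambda>j. real (4 * j + 1) powr (-\<sigma>) + e * real (4 * j + 3) powr (-\<sigma>))"
  have cpowr: "of_nat m powr (- of_real \<sigma>) = complex_of_real (real m powr (-\<sigma>))" for m
    using powr_of_real[of "real m" "-\<sigma>"] by simp
  have "(\<lambda>j. of_real (t j)) sums dirichlet_series (cchar e) (of_real \<sigma>)"
    using sums_char4_groups[OF e, of "of_real \<sigma>"] s
    by (simp only: t_def cpowr of_real_add of_real_mult Re_complex_of_real)
  then have sum: "t sums Re (dirichlet_series (cchar e) (of_real \<sigma>))"
    using sums_Re by fastforce
  have dec: "real (4 * j + 3) powr (-\<sigma>) \<le> real (4 * j + 1) powr (-\<sigma>)" for j
    using s by (intro powr_mono2') auto
  have low: "t j \<ge> real (4 * j + 1) powr (-\<sigma>) - real (4 * j + 3) powr (-\<sigma>)" for j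
    using mult_right_mono[OF e1, of "real (4 * j + 3) powr (-\<sigma>)"] by (simp add: t_def)
  have nonneg: "t j \<ge> 0" for j using low[of j] dec[of j] by linarith
  have "summable t" using sum by (simp add: sums_iff)
  then have "sum t {0} \<le> suminf t" by (rule sum_le_suminf) (simp_all add: nonneg)
  moreover have "3 powr (-\<sigma>) \<le> 3 powr (-1 :: real)" using s by (intro powr_mono) auto
  then have "3 powr (-\<sigma>) \<le> 1/3" by (simp add: powr_minus)
  then have "t 0 \<ge> 2/3" using low[of 0] by simp
  moreover have "suminf t = Re (dirichlet_series (cchar e) (of_real \<sigma>))"
    by (rule sums_unique[OF sum, symmetric])
  ultimately show ?thesis by simp
qed

lemma dirichlet_inverse:
  assumes e: "e\<^sup>2 = 1" and s: "Re s > 1"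
  shows "dirichlet_series (cmob e) s * dirichlet_series (cchar e) s = 1"
proof -
  have "dterm (dconv (cmob e) (cchar e)) s sums (dirichlet_series (cmob e) s * dirichlet_series (cchar e) s)"
    by (intro dirichlet_series_mult summable_dterm[of _ 1] norm_cmob_le norm_cchar_le e s)
  moreover have "dterm (dconv (cmob e) (cchar e)) s = (\<lambda>n. if n = 0 then 1 else 0)"
  proof
    fix n
    have "dconv (cmob e) (cchar e) (Suc n) = of_real (\<Sum>d | d dvd Suc n. mob_char e d * char4 e (Suc n div d))"
      by (simp add: dconv_def cmob_def cchar_def)
    also have "(\<Sum>d | d dvd Suc n. mob_char e d * char4 e (Suc n div d)) = (if Suc n = 1 then 1 else 0)"
      by (rule sum_mob_char[OF _ e]) simp
    finally show "dterm (dconv (cmob e) (cchar e)) s n = (if n = 0 then 1 else 0)" by simp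
  qed
  moreover have "(\<lambda>n. if n = 0 then 1 else 0 :: complex) sums 1"
    using sums_single[of 0 "\<lambda>_. 1 :: complex"] by simp
  ultimately show ?thesis by (simp only:) (rule sums_unique2)
qed

subsection \<open>Analytic continuation\<close>

text \<open>\<open>hz a s\<close> continues \<open>(s - 1) * (\<Sum>j. (a + 4 * j) powr - s)\<close> to \<open>Re s > 0\<close>: from each term the average of
  \<open>u powr - s\<close> over the interval of length 4 to the right of \<open>a + 4 * j\<close> is subtracted, multiplied by \<open>s - 1\<close>
  so that nothing is singular at 1.\<close>

definition hz_term :: "real \<Rightarrow> nat \<Rightarrow> complex \<Rightarrow> complex" where
  "hz_term a j s = (s - 1) * of_real (a + 4 * real j) powr (-s) +
     (of_real (a + 4 * real (Suc j)) powr (1 - s) - of_real (a + 4 * real j) powr (1 - s)) / 4"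

lemma norm_of_real_powr: "x > 0 \<Longrightarrow> norm (of_real x powr (s::complex)) = x powr Re s"
  by (simp add: norm_powr_real_powr)

lemma of_real_powr_has_field_derivative:
  "x > 0 \<Longrightarrow> ((\<lambda>z::complex. z powr w) has_field_derivative w * of_real x powr (w - 1)) (at (of_real x) within A)"
  by (rule has_field_derivative_at_within[OF has_field_derivative_powr]) (auto simp: complex_nonpos_Reals_iff)

text \<open>The quotient of the difference by 4 is \<open>1 - s\<close> times the average of
  \<open>u powr (-s)\<close> over \<open>[x, x + 4]\<close>. The mean value inequality is used
  twice: for \<phi>, whose linear term makes its derivative vanish at \<open>x\<close>, and for
  \<open>z powr (-s)\<close> inside that derivative.\<close>

lemma norm_first_order_quadrature_le:
  fixes s :: complex
  assumes x: "x > 0" and s: "Re s \<ge> 0"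
  shows "norm ((s - 1) * of_real x powr (-s) + (of_real (x + 4) powr (1 - s) - of_real x powr (1 - s)) / 4)
           \<le> 4 * norm (s - 1) * norm s * x powr (- Re s - 1)"
proof -
  define S :: "complex set" where "S = of_real ` {x..x+4}"
  define B where "B = norm s * x powr (- Re s - 1)"
  have S_eq: "S = closed_segment (of_real x) (of_real (x + 4))"
    unfolding S_def closed_segment_of_real by (simp add: closed_segment_eq_real_ivl)
  have conv: "convex S" unfolding S_eq by (rule convex_closed_segment)
  have xS: "of_real x \<in> S" "of_real (x + 4) \<in> S" by (auto simp: S_def simp del: of_real_add)
  have B0: "B \<ge> 0" by (simp add: B_def)
  have 1: "norm (z powr (-s) - of_real x powr (-s)) \<le> 4 * B" if z: "z \<in> S" for z
  proof -
    have "norm (z powr (-s) - of_real x powr (-s)) \<le> B * norm (z - of_real x)"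
    proof (rule field_differentiable_bound[OF conv _ _ z xS(1)])
      fix y assume "y \<in> S"
      then obtain u where u: "y = of_real u" "x \<le> u" by (auto simp: S_def)
      show "((\<lambda>z. z powr (-s)) has_field_derivative (-s) * y powr (-s-1)) (at y within S)"
        unfolding u(1) by (rule of_real_powr_has_field_derivative) (use x u in simp)
      have "u powr (- Re s - 1) \<le> x powr (- Re s - 1)" using x u s by (intro powr_mono2') auto
      then show "norm ((-s) * y powr (-s-1)) \<le> B"
        unfolding u(1) B_def using x u
        by (simp add: norm_mult norm_of_real_powr mult_left_mono)
    qed
    also have "\<dots> \<le> B * 4"
    proof (rule mult_left_mono[OF _ B0])
      obtain u where u: "z = of_real u" "x \<le> u" "u \<le> x + 4" using z by (auto simp: S_def)
      have "z - of_real x = of_real (u - x)" by (simp add: u)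
      then show "norm (z - of_real x) \<le> 4" using u by (simp only: norm_of_real)
    qed
    finally show ?thesis by simp
  qed
  define \<phi> where "\<phi> = (\<lambda>z. z powr (1 - s) + (s - 1) * (z - of_real x) * of_real x powr (-s))"
  have "norm (\<phi> (of_real (x + 4)) - \<phi> (of_real x)) \<le> (norm (s - 1) * (4 * B)) * norm (of_real (x + 4) - of_real x :: complex)"
  proof (rule field_differentiable_bound[OF conv _ _ xS(2) xS(1)])
    fix z assume z: "z \<in> S"
    then obtain u where u: "z = of_real u" "x \<le> u" by (auto simp: S_def)
    have d: "((\<lambda>z. z powr (1 - s)) has_field_derivative (1 - s) * z powr (-s)) (at z within S)"
      using of_real_powr_has_field_derivative[of u "1 - s" S] x u by simp
    show "(\<phi> has_field_derivative (1 - s) * (z powr (-s) - of_real x powr (-s))) (at z within S)"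
    proof -
      have "((\<lambda>z. (s - 1) * (z - of_real x) * of_real x powr (-s)) has_field_derivative
          (s - 1) * of_real x powr (-s)) (at z within S)"
        by (auto intro!: derivative_eq_intros)
      from DERIV_add[OF d this] show ?thesis unfolding \<phi>_def by (simp add: algebra_simps)
    qed
    show "norm ((1 - s) * (z powr (-s) - of_real x powr (-s))) \<le> norm (s - 1) * (4 * B)"
      unfolding norm_mult using 1[OF z] by (simp add: norm_minus_commute mult_left_mono)
  qed
  also have "norm (of_real (x + 4) - of_real x :: complex) = 4" by simp
  also have "\<phi> (of_real (x + 4)) - \<phi> (of_real x) =
      4 * ((s - 1) * of_real x powr (-s) + (of_real (x + 4) powr (1 - s) - of_real x powr (1 - s)) / 4)"
  proof -
    have "p + 4 * q - r = 4 * (q + (p - r) / 4)" for p q r :: complex by (simp add: field_simps)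
    then show ?thesis by (simp add: \<phi>_def mult_ac)
  qed
  also have "norm \<dots> = 4 * norm ((s - 1) * of_real x powr (-s) + (of_real (x + 4) powr (1 - s) - of_real x powr (1 - s)) / 4)"
    by (simp only: norm_mult norm_numeral)
  finally show ?thesis by (simp add: B_def mult_ac)
qed

lemma norm_hz_term_le:
  assumes a: "a \<ge> 1" and s: "Re s \<ge> \<sigma>" "\<sigma> \<ge> 0"
  shows "norm (hz_term a j s) \<le> 4 * norm (s - 1) * norm s * real (Suc j) powr (- \<sigma> - 1)"
proof -
  have eq: "a + 4 * real (Suc j) = (a + 4 * real j) + 4" by simp
  have pos: "a + 4 * real j > 0" using a by (simp add: add_pos_nonneg)
  have "norm (hz_term a j s) \<le> 4 * norm (s - 1) * norm s * (a + 4 * real j) powr (- Re s - 1)"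
    unfolding hz_term_def eq using s by (intro norm_first_order_quadrature_le pos) auto
  also have "(a + 4 * real j) powr (- Re s - 1) \<le> real (Suc j) powr (- Re s - 1)"
    using a s by (intro powr_mono2') auto
  also have "real (Suc j) powr (- Re s - 1) \<le> real (Suc j) powr (- \<sigma> - 1)"
    using s by (intro powr_mono) auto
  finally show ?thesis by (simp add: mult_left_mono)
qed

lemma summable_Suc_powr':
  assumes "\<sigma> > 0" shows "summable (\<lambda>n. real (Suc n) powr (- \<sigma> - 1))"
proof -
  have "- \<sigma> - 1 = - (\<sigma> + 1)" by simp
  then show ?thesis using summable_Suc_powr[of "\<sigma> + 1"] assms by (simp only:)
qed

definition hz :: "real \<Rightarrow> complex \<Rightarrow> complex" where
  "hz a s = (\<Sum>j. hz_term a j s) + of_real a powr (1 - s) / 4"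

lemma summable_hz_term:
  assumes "a \<ge> 1" "Re s > 0" shows "summable (\<lambda>j. norm (hz_term a j s))"
proof (rule summable_comparison_test')
  show "summable (\<lambda>j. 4 * norm (s - 1) * norm s * real (Suc j) powr (- Re s - 1))"
    using assms by (intro summable_mult summable_Suc_powr')
  show "norm (norm (hz_term a j s)) \<le> 4 * norm (s - 1) * norm s * real (Suc j) powr (- Re s - 1)" for j
    using norm_hz_term_le[of a "Re s" s j] assms by simp
qed

lemma hz_holomorphic:
  assumes a: "a \<ge> 1" shows "hz a holomorphic_on {s. Re s > 0}"
proof -
  define S where "S = {s. Re s > 0}"
  have op: "open S" unfolding S_def by (rule open_halfspace_Re_gt)
  have hol: "hz_term a j field_differentiable at x" for j x
  proof -
    have *: "(\<lambda>s. (s - 1) * c powr (-s) + (d powr (1 - s) - c powr (1 - s)) / 4) field_differentiable at x"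
      if "c \<noteq> 0" "d \<noteq> 0" for c d :: complex
      using that by (intro holomorphic_on_imp_differentiable_at[of _ UNIV] holomorphic_intros) auto
    have "a + 4 * real j > 0" "a + 4 * real (Suc j) > 0" using a by (auto intro!: add_pos_nonneg)
    then show ?thesis unfolding hz_term_def by (intro *) (simp_all only: of_real_eq_0_iff)
  qed
  have "\<exists>g g'. \<forall>x\<in>S. ((\<lambda>n. hz_term a n x) sums g x) \<and>
     ((\<lambda>n. deriv (hz_term a n) x) sums g' x) \<and> (g has_field_derivative g' x) (at x)"
  proof (rule series_and_derivative_comparison_local[OF op])
    show "(hz_term a n has_field_derivative deriv (hz_term a n) x) (at x)" for n x
      using hol field_differentiable_derivI by blast
    fix x assume x: "x \<in> S"
    define d where "d = Re x / 2"
    define M where "M = norm x + d + 1"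
    have d: "d > 0" using x by (simp add: d_def S_def)
    have M: "M \<ge> 0" using d by (simp add: M_def)
    show "\<exists>d h. 0 < d \<and> summable h \<and> (\<forall>\<^sub>F n in sequentially. \<forall>y\<in>ball x d \<inter> S. norm (hz_term a n y) \<le> h n)"
    proof (intro exI conjI always_eventually allI ballI)
      show "summable (\<lambda>j. 4 * M * M * real (Suc j) powr (- d - 1))"
        using d by (intro summable_mult summable_Suc_powr')
      fix n y assume y: "y \<in> ball x d \<inter> S"
      then have xy: "norm (x - y) < d" by (simp add: dist_norm)
      have "Re x - Re y \<le> norm (x - y)" using complex_Re_le_cmod[of "x - y"] by simp
      then have "Re y \<ge> d" using xy unfolding d_def by (simp add: field_simps)
      then have "norm (hz_term a n y) \<le> 4 * norm (y - 1) * norm y * real (Suc n) powr (- d - 1)"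
        using d by (intro norm_hz_term_le a) auto
      also have "\<dots> \<le> 4 * M * M * real (Suc n) powr (- d - 1)"
      proof -
        have "norm y \<le> norm x + norm (x - y)" by (metis norm_minus_commute norm_triangle_sub)
        moreover have "norm (y - 1) \<le> norm y + 1" using norm_triangle_ineq4[of y 1] by simp
        ultimately have "norm y \<le> M" "norm (y - 1) \<le> M" using xy d by (auto simp: M_def)
        then show ?thesis using M by (intro mult_mono) auto
      qed
      finally show "norm (hz_term a n y) \<le> 4 * M * M * real (Suc n) powr (- d - 1)" .
    qed (rule d)
  qed
  then obtain g g' where gg: "\<forall>x\<in>S. ((\<lambda>n. hz_term a n x) sums g x) \<and>
     ((\<lambda>n. deriv (hz_term a n) x) sums g' x) \<and> (g has_field_derivative g' x) (at x)"
    by (elim exE) (rule that)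
  have "g holomorphic_on S"
    using gg op by (auto simp: holomorphic_on_open)
  moreover have "(\<Sum>j. hz_term a j x) = g x" if "x \<in> S" for x
    using gg that by (metis sums_unique)
  ultimately have "(\<lambda>s. \<Sum>j. hz_term a j s) holomorphic_on S"
    by (metis holomorphic_transform)
  moreover have "(\<lambda>s. of_real a powr (1 - s) / 4) holomorphic_on S"
    using a by (intro holomorphic_intros) auto
  ultimately show ?thesis unfolding hz_def S_def by (intro holomorphic_on_add)
qed

text \<open>The factors \<open>norm (s - 1)\<close> and \<open>norm s\<close> of the termwise bound
  give the square. Only the logarithm of this growth matters later.\<close>

lemma norm_hz_le:
  assumes a: "a \<ge> 1"
  shows "\<exists>C. \<forall>s. Re s \<ge> 1/2 \<longrightarrow> norm (hz a s) \<le> C * (1 + norm s)\<^sup>2"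
proof -
  define K where "K = (\<Sum>j. real (Suc j) powr (- (1/2) - 1))"
  have sK: "summable (\<lambda>j. real (Suc j) powr (- (1/2) - 1))" by (rule summable_Suc_powr') simp
  have K0: "K \<ge> 0" unfolding K_def by (intro suminf_nonneg sK) simp
  have "norm (hz a s) \<le> (4 * K + a) * (1 + norm s)\<^sup>2" if s: "Re s \<ge> 1/2" for s
  proof -
    have m1: "norm (s - 1) \<le> 1 + norm s" using norm_triangle_ineq4[of s 1] by simp
    have sum: "summable (\<lambda>j. norm (hz_term a j s))" using s by (intro summable_hz_term a) auto
    have "norm (\<Sum>j. hz_term a j s) \<le> (\<Sum>j. norm (hz_term a j s))" by (rule summable_norm[OF sum])
    also have "\<dots> \<le> (\<Sum>j. 4 * norm (s - 1) * norm s * real (Suc j) powr (- (1/2) - 1))"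
      using s by (intro suminf_le sum summable_mult sK norm_hz_term_le a) auto
    also have "\<dots> = 4 * norm (s - 1) * norm s * K" unfolding K_def by (rule suminf_mult[OF sK])
    also have "\<dots> \<le> 4 * (1 + norm s) * (1 + norm s) * K"
      using m1 K0 by (intro mult_mono) auto
    finally have 1: "norm (\<Sum>j. hz_term a j s) \<le> 4 * K * (1 + norm s)\<^sup>2"
      by (simp add: power2_eq_square mult_ac)
    have "norm (of_real a powr (1 - s)) = a powr (1 - Re s)" using a by (simp add: norm_of_real_powr)
    also have "\<dots> \<le> a powr 1" using a s by (intro powr_mono) auto
    finally have "norm (of_real a powr (1 - s) / 4) \<le> a" using a by (simp add: norm_divide)
    also have "a * 1 \<le> a * (1 + norm s)\<^sup>2" using a by (intro mult_left_mono) (auto simp: power2_eq_square algebra_simps)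
    finally have 2: "norm (of_real a powr (1 - s) / 4) \<le> a * (1 + norm s)\<^sup>2" by simp
    show ?thesis unfolding hz_def
      using norm_triangle_mono[OF 1 2] by (simp add: algebra_simps)
  qed
  then show ?thesis by blast
qed

text \<open>For \<open>Re s > 1\<close> the differences in \<open>hz_term\<close> telescope to
  \<open>- (a powr (1 - s)) / 4\<close>, which is exactly what the additional term in
  \<open>hz\<close> compensates.\<close>

lemma hz_eq:
  assumes a: "a \<ge> 1" and s: "Re s > 1"
  shows "(\<lambda>j. of_real (a + 4 * real j) powr (-s)) sums (hz a s / (s - 1))"
proof -
  define x where "x = (\<lambda>j. a + 4 * real j)"
  have pos: "x j > 0" for j using a by (simp add: x_def add_pos_nonneg)
  have sumx: "summable (\<lambda>j. norm (of_real (x j) powr (-s)))"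
  proof (rule summable_comparison_test')
    show "summable (\<lambda>j. real (Suc j) powr (- Re s))" by (rule summable_Suc_powr[OF s])
    show "norm (norm (of_real (x j) powr (-s))) \<le> real (Suc j) powr (- Re s)" for j
      using a s by (simp add: norm_of_real_powr[OF pos]) (auto simp: x_def intro!: powr_mono2')
  qed
  have "(\<lambda>j. (x j) powr (1 - Re s)) \<longlonglongrightarrow> 0"
  proof (rule tendsto_neg_powr)
    show "filterlim x at_top sequentially" unfolding x_def
      by (intro filterlim_tendsto_add_at_top[OF tendsto_const] filterlim_tendsto_pos_mult_at_top[OF tendsto_const]
            filterlim_real_sequentially) auto
  qed (use s in auto)
  then have "(\<lambda>j. norm (of_real (x j) powr (1 - s))) \<longlonglongrightarrow> 0"
    by (simp add: norm_of_real_powr[OF pos])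
  then have lim: "(\<lambda>j. of_real (x j) powr (1 - s)) \<longlonglongrightarrow> 0" by (rule tendsto_norm_zero_cancel)
  have "(\<lambda>j. (s - 1) * of_real (x j) powr (-s) + (of_real (x (Suc j)) powr (1 - s) - of_real (x j) powr (1 - s)) / 4)
     sums ((s - 1) * (\<Sum>j. of_real (x j) powr (-s)) + (0 - of_real (x 0) powr (1 - s)) / 4)"
    by (intro sums_add sums_mult sums_divide telescope_sums lim summable_sums summable_norm_cancel[OF sumx])
  then have "(\<Sum>j. hz_term a j s) = (s - 1) * (\<Sum>j. of_real (x j) powr (-s)) - of_real a powr (1 - s) / 4"
    by (simp add: sums_iff hz_term_def x_def)
  then have "hz a s = (s - 1) * (\<Sum>j. of_real (x j) powr (-s))" by (simp add: hz_def)
  moreover have "s \<noteq> 1" using s by auto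
  ultimately have "hz a s / (s - 1) = (\<Sum>j. of_real (x j) powr (-s))" by simp
  then show ?thesis using summable_sums[OF summable_norm_cancel[OF sumx]] by (simp add: x_def)
qed

text \<open>\<open>Qf e s = (s - 1) L(s, char4 e)\<close>.\<close>

definition Qf :: "real \<Rightarrow> complex \<Rightarrow> complex" where
  "Qf e s = hz 1 s + of_real e * hz 3 s"

lemma Qf_holomorphic: "Qf e holomorphic_on {s. Re s > 0}"
  unfolding Qf_def by (intro holomorphic_intros hz_holomorphic) auto

lemma norm_Qf_le:
  assumes e: "e\<^sup>2 = 1"
  shows "\<exists>C>0. \<forall>s. Re s \<ge> 1/2 \<longrightarrow> norm (Qf e s) \<le> C * (1 + norm s)\<^sup>2"
proof -
  have e1: "\<bar>e\<bar> = 1" using e by (auto simp: power2_eq_1_iff)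
  obtain C1 where C1: "\<And>s. Re s \<ge> 1/2 \<Longrightarrow> norm (hz 1 s) \<le> C1 * (1 + norm s)\<^sup>2"
    using norm_hz_le[of 1] by auto
  obtain C3 where C3: "\<And>s. Re s \<ge> 1/2 \<Longrightarrow> norm (hz 3 s) \<le> C3 * (1 + norm s)\<^sup>2"
    using norm_hz_le[of 3] by auto
  have "norm (Qf e s) \<le> (\<bar>C1\<bar> + \<bar>C3\<bar> + 1) * (1 + norm s)\<^sup>2" if s: "Re s \<ge> 1/2" for s
  proof -
    have "norm (Qf e s) \<le> norm (hz 1 s) + norm (hz 3 s)"
      unfolding Qf_def using e1 by (intro norm_triangle_mono) (auto simp: norm_mult)
    also have "\<dots> \<le> C1 * (1 + norm s)\<^sup>2 + C3 * (1 + norm s)\<^sup>2"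
      by (intro add_mono C1 C3 s)
    also have "\<dots> = (C1 + C3) * (1 + norm s)\<^sup>2" by (simp add: algebra_simps)
    also have "\<dots> \<le> (\<bar>C1\<bar> + \<bar>C3\<bar> + 1) * (1 + norm s)\<^sup>2" by (intro mult_right_mono) auto
    finally show ?thesis .
  qed
  moreover have "\<bar>C1\<bar> + \<bar>C3\<bar> + 1 > 0" by simp
  ultimately show ?thesis by blast
qed

lemma Qf_eq:
  assumes e: "e\<^sup>2 = 1" and s: "Re s > 1"
  shows "Qf e s = (s - 1) * dirichlet_series (cchar e) s"
proof -
  have "(\<lambda>j. of_real (1 + 4 * real j) powr (-s) + of_real e * of_real (3 + 4 * real j) powr (-s)) sums
      (hz 1 s / (s - 1) + of_real e * (hz 3 s / (s - 1)))"
    by (intro sums_add sums_mult hz_eq s) auto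
  moreover have "of_real (1 + 4 * real j) = (of_nat (4 * j + 1) :: complex)"
    "of_real (3 + 4 * real j) = (of_nat (4 * j + 3) :: complex)" for j
    by (simp_all add: add.commute)
  ultimately have "(\<lambda>j. of_nat (4 * j + 1) powr (-s) + of_real e * of_nat (4 * j + 3) powr (-s)) sums
      (hz 1 s / (s - 1) + of_real e * (hz 3 s / (s - 1)))" by (simp only:)
  then have "dirichlet_series (cchar e) s = hz 1 s / (s - 1) + of_real e * (hz 3 s / (s - 1))"
    using sums_char4_groups[OF e s] sums_unique2 by blast
  moreover have "s \<noteq> 1" using s by auto
  ultimately show ?thesis by (simp add: Qf_def distrib_left)
qed

text \<open>Identifies the function GRH speaks about with the explicit quotient. Continuation to
  \<open>Re z > 0\<close>, that is \<open>c = 0\<close>, already covers the critical strip.\<close>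

lemma dirichlet_L_cchar:
  assumes e: "e\<^sup>2 = 1" and s: "Re s > 0" "s \<noteq> 1"
  shows "dirichlet_L (cchar e) s = Qf e s / (s - 1)"
  unfolding dirichlet_L_def
proof (rule dirichlet_continuation_eqI[where c = 0])
  show "(\<lambda>s. Qf e s / (s - 1)) holomorphic_on {z. Re z > 0} - {1}"
    by (intro holomorphic_intros holomorphic_on_subset[OF Qf_holomorphic]) auto
  show "Qf e z / (z - 1) = dirichlet_series (cchar e) z" if "Re z > 1" for z
    using that Qf_eq[OF e that] by auto
qed (use s in auto)

lemma Qf_nonzero_strip:
  assumes GRH: "generalized_riemann_hypothesis" and e: "e\<^sup>2 = 1" and s: "1/2 < Re s" "Re s < 1"
  shows "Qf e s \<noteq> 0"
proof
  assume "Qf e s = 0"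
  moreover have "s \<noteq> 1" using s by auto
  ultimately have "dirichlet_L (cchar e) s = 0" using dirichlet_L_cchar[OF e] s by simp
  then have "s \<in> nontrivial_zeros (dirichlet_L (cchar e))" using s by (simp add: nontrivial_zeros_def)
  then have "Re s = 1/2"
    using GRH dirichlet_character_cchar[OF e] unfolding generalized_riemann_hypothesis_def by blast
  then show False using s by simp
qed

lemma Qf_nonzero_gt_1:
  assumes e: "e\<^sup>2 = 1" and s: "Re s > 1"
  shows "Qf e s \<noteq> 0"
proof -
  have "dirichlet_series (cchar e) s \<noteq> 0" using dirichlet_inverse[OF e s] by auto
  moreover have "s \<noteq> 1" using s by auto
  ultimately show ?thesis using Qf_eq[OF e s] by simp
qed

subsection \<open>Non-vanishing on the line 1\<close>

definition cmangoldt :: "real \<Rightarrow> nat \<Rightarrow> complex" where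
  "cmangoldt e n = mangoldt n * cchar e n"

lemma summable_dterm_cmangoldt:
  assumes e: "e\<^sup>2 = 1" and s: "Re s > 1"
  shows "summable (\<lambda>n. norm (dterm (cmangoldt e) s n))"
proof (rule summable_comparison_test')
  define d where "d = (Re s - 1) / 2"
  have d: "d > 0" using s by (simp add: d_def)
  show "summable (\<lambda>n. 1 / d * real (Suc n) powr (- (1 + d)))"
    using d by (intro summable_mult summable_Suc_powr) auto
  fix n
  have "norm (cmangoldt e (Suc n)) = mangoldt (Suc n) * norm (cchar e (Suc n))"
    by (simp add: cmangoldt_def norm_mult)
  also have "\<dots> \<le> ln (real (Suc n)) * 1"
    by (intro mult_mono mangoldt_le norm_cchar_le e) auto
  also have "ln (real (Suc n)) \<le> real (Suc n) powr d / d"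
    by (rule ln_powr_bound) (use d in auto)
  finally have "norm (dterm (cmangoldt e) s n) \<le> real (Suc n) powr d / d * real (Suc n) powr (- Re s)"
    unfolding norm_dterm by (intro mult_right_mono) auto
  also have "\<dots> = 1 / d * real (Suc n) powr (- (1 + d))"
  proof -
    have "d + - Re s = - (1 + d)" by (simp add: d_def field_simps)
    then have "real (Suc n) powr d * real (Suc n) powr (- Re s) = real (Suc n) powr (- (1 + d))"
      unfolding powr_add[symmetric] by (simp only:)
    then show ?thesis by simp
  qed
  finally show "norm (norm (dterm (cmangoldt e) s n)) \<le> 1 / d * real (Suc n) powr (- (1 + d))" by simp
qed

lemma dirichlet_series_mangoldt:
  assumes e: "e\<^sup>2 = 1" and s: "Re s > 1"
  shows "dirichlet_series (cmangoldt e) s * dirichlet_series (cchar e) s = - deriv (dirichlet_series (cchar e)) s"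
proof -
  have "dterm (dconv (cmangoldt e) (cchar e)) s sums (dirichlet_series (cmangoldt e) s * dirichlet_series (cchar e) s)"
    by (intro dirichlet_series_mult summable_dterm_cmangoldt summable_dterm[of _ 1] norm_cchar_le e s)
  moreover have "dterm (dconv (cmangoldt e) (cchar e)) s n =
      - dterm (\<lambda>n. - of_real (ln (real n)) * cchar e n) s n" for n
  proof -
    have "dconv (cmangoldt e) (cchar e) (Suc n) = (\<Sum>d | d dvd Suc n. mangoldt d * cchar e (Suc n))"
      unfolding dconv_def
    proof (rule sum.cong)
      fix d assume "d \<in> {d. d dvd Suc n}"
      then have "char4 e (Suc n) = char4 e d * char4 e (Suc n div d)"
        using char4_mult[OF e, of d "Suc n div d"] by simp
      then show "cmangoldt e d * cchar e (Suc n div d) = mangoldt d * cchar e (Suc n)"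
        by (simp add: cmangoldt_def cchar_def)
    qed simp
    also have "\<dots> = of_real (ln (real (Suc n))) * cchar e (Suc n)"
      by (simp only: sum_distrib_right[symmetric]) (subst mangoldt_sum, auto)
    finally show ?thesis by simp
  qed
  moreover have "(\<lambda>n. - dterm (\<lambda>n. - of_real (ln (real n)) * cchar e n) s n) sums - deriv (dirichlet_series (cchar e)) s"
    by (intro sums_minus dirichlet_series_has_field_derivative(1)[of _ 1] norm_cchar_le e s)
  ultimately show ?thesis by (simp only:) (rule sums_unique2)
qed

text \<open>The left side is \<open>- L' / L\<close>; passing from \<open>L\<close> to
  \<open>Qf = (s - 1) L\<close> splits off the possible pole at 1 as the explicit
  \<open>1 / (s - 1)\<close>.\<close>

lemma dirichlet_series_mangoldt_eq:
  assumes e: "e\<^sup>2 = 1" and s: "Re s > 1"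
  shows "dirichlet_series (cmangoldt e) s = 1 / (s - 1) - deriv (Qf e) s / Qf e s"
proof -
  define L where "L = dirichlet_series (cchar e)"
  have op: "open {s. Re s > 1}" by (rule open_halfspace_Re_gt)
  have L: "(L has_field_derivative deriv L s) (at s)"
    unfolding L_def by (rule dirichlet_series_has_field_derivative(2)[of _ 1]) (auto simp: norm_cchar_le e s)
  have "((\<lambda>s. (s - 1) * L s) has_field_derivative (1 * L s + deriv L s * (s - 1))) (at s)"
    by (auto intro!: derivative_eq_intros L)
  then have "(Qf e has_field_derivative (1 * L s + deriv L s * (s - 1))) (at s)"
    by (rule has_field_derivative_transform_within_open[OF _ op]) (use s in \<open>auto simp: L_def Qf_eq[OF e]\<close>)
  then have d: "deriv (Qf e) s = L s + deriv L s * (s - 1)" by (simp add: DERIV_imp_deriv)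
  have Q: "Qf e s = (s - 1) * L s" using Qf_eq[OF e s] by (simp add: L_def)
  have s1: "s - 1 \<noteq> 0" using s by auto
  have L0: "L s \<noteq> 0" using Qf_nonzero_gt_1[OF e s] Q by auto
  have "dirichlet_series (cmangoldt e) s * L s = - deriv L s"
    using dirichlet_series_mangoldt[OF e s] by (simp add: L_def)
  then have "dirichlet_series (cmangoldt e) s = - deriv L s / L s" using L0 by (simp add: field_simps)
  also have "\<dots> = 1 / (s - 1) - deriv (Qf e) s / Qf e s"
    unfolding Q d using s1 L0 by (simp add: add_divide_distrib)
  finally show ?thesis .
qed

text \<open>For odd \<open>N\<close> the value \<open>c\<close> of the character is 1 or -1, and
  \<open>3 + 4 c cos \<theta> + cos (2 \<theta>) = 2 (c + cos \<theta>) ^ 2\<close>. The square of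
  the character is principal, hence \<open>cmangoldt 1\<close> in the outer terms; even
  \<open>N\<close> contribute 0.\<close>

lemma three_four_one:
  assumes e: "e\<^sup>2 = 1" and \<sigma>: "\<sigma> > 1"
  shows "0 \<le> Re (3 * dirichlet_series (cmangoldt 1) (of_real \<sigma>)
      + 4 * dirichlet_series (cmangoldt e) (Complex \<sigma> t) + dirichlet_series (cmangoldt 1) (Complex \<sigma> (2 * t)))"
proof -
  have sm: "dterm (cmangoldt e) s sums dirichlet_series (cmangoldt e) s" if "e\<^sup>2 = 1" "Re s > 1" for e s
    unfolding dirichlet_series_def
    by (intro summable_sums summable_norm_cancel[OF summable_dterm_cmangoldt] that)
  define T where "T = (\<lambda>n. 3 * dterm (cmangoldt 1) (of_real \<sigma>) n + 4 * dterm (cmangoldt e) (Complex \<sigma> t) n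
      + dterm (cmangoldt 1) (Complex \<sigma> (2 * t)) n)"
  have "T sums (3 * dirichlet_series (cmangoldt 1) (of_real \<sigma>)
      + 4 * dirichlet_series (cmangoldt e) (Complex \<sigma> t) + dirichlet_series (cmangoldt 1) (Complex \<sigma> (2 * t)))"
    unfolding T_def by (intro sums_add sums_mult sm) (use e \<sigma> in auto)
  then have sums: "(\<lambda>n. Re (T n)) sums Re (3 * dirichlet_series (cmangoldt 1) (of_real \<sigma>)
      + 4 * dirichlet_series (cmangoldt e) (Complex \<sigma> t) + dirichlet_series (cmangoldt 1) (Complex \<sigma> (2 * t)))"
    by (rule sums_Re)
  have "Re (T n) \<ge> 0" for n
  proof -
    define N where "N = Suc n"
    define \<theta> where "\<theta> = - t * ln (real N)"
    define c where "c = char4 e N"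
    define r where "r = mangoldt N * real N powr (- \<sigma>)"
    have r: "r \<ge> 0" by (simp add: r_def mangoldt_nonneg)
    have "1 / of_nat N powr Complex \<sigma> u = of_real (real N powr (- \<sigma>)) * cis (- u * ln (real N))" for u
    proof -
      have N0: "(of_nat N :: complex) \<noteq> 0" "real N > 0" by (simp_all add: N_def del: of_nat_Suc)
      have "1 / of_nat N powr Complex \<sigma> u = exp (- Complex \<sigma> u * of_real (ln (real N)))"
        using Ln_of_real[of "real N"] N0 by (simp add: powr_def exp_minus divide_inverse)
      also have "- Complex \<sigma> u * of_real (ln (real N)) = of_real (- \<sigma> * ln (real N)) + \<i> * of_real (- u * ln (real N))"
        by (simp add: complex_eq_iff)
      also have "exp \<dots> = of_real (real N powr (- \<sigma>)) * cis (- u * ln (real N))"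
        using N0 by (simp only: exp_add cis_conv_exp exp_of_real) (simp add: powr_def)
      finally show ?thesis .
    qed
    note pw = this
    have dt: "dterm (cmangoldt e') (Complex \<sigma> u) n = of_real (r * char4 e' N) * cis (- u * ln (real N))" for e' u
    proof -
      have "dterm (cmangoldt e') (Complex \<sigma> u) n = mangoldt N * of_real (char4 e' N) * (1 / of_nat N powr Complex \<sigma> u)"
        by (simp add: cmangoldt_def cchar_def N_def)
      then show ?thesis unfolding pw r_def by (simp add: mult_ac)
    qed
    have c2: "char4 1 N = c\<^sup>2" using e by (simp add: c_def char4_def)
    have cc: "c\<^sup>2 = 0 \<or> c\<^sup>2 = 1" using e by (simp add: c_def char4_def)
    have "Re (T n) = r * (3 * c\<^sup>2 + 4 * (c * cos \<theta>) + c\<^sup>2 * cos (2 * \<theta>))"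
      unfolding T_def using dt[of 1 0] dt[of e t] dt[of 1 "2 * t"] complex_of_real_def[of \<sigma>]
      by (simp add: c2 \<theta>_def algebra_simps flip: c_def)
    moreover have "3 * c\<^sup>2 + 4 * (c * cos \<theta>) + c\<^sup>2 * cos (2 * \<theta>) \<ge> 0"
    proof (cases "c = 0")
      case False
      then have c1: "c\<^sup>2 = 1" using cc by auto
      have "3 * c\<^sup>2 + 4 * (c * cos \<theta>) + c\<^sup>2 * cos (2 * \<theta>) = 2 + 4 * (c * cos \<theta>) + 2 * (cos \<theta>)\<^sup>2"
        by (simp add: c1 cos_double_cos)
      also have "\<dots> = 2 * (c + cos \<theta>)\<^sup>2"
        using c1 by (simp add: power2_sum algebra_simps)
      finally show ?thesis by simp
    qed simp
    ultimately show ?thesis using r by simp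
  qed
  then show ?thesis using sums by (metis suminf_nonneg sums_iff)
qed

text \<open>The limit \<open>m\<close> is the order of vanishing of \<open>Q\<close> at \<xi>: after
  writing \<open>Q w = (w - \<xi>) ^ n * g w\<close>, the logarithmic derivative of \<open>g\<close>
  is regular and is killed by the factor \<open>w - \<xi>\<close>.\<close>

lemma log_deriv_limit:
  assumes Q: "Q holomorphic_on S" and S: "open S" "connected S" "\<xi> \<in> S" and nc: "\<not> Q constant_on S"
  shows "\<exists>m::nat. ((\<lambda>w. (w - \<xi>) * deriv Q w / Q w) \<longlongrightarrow> of_nat m) (at \<xi>) \<and> (Q \<xi> = 0 \<longrightarrow> m \<ge> 1)"
proof (cases "Q \<xi> = 0")
  case False
  have 1: "Q \<midarrow>\<xi>\<rightarrow> Q \<xi>"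
    using holomorphic_on_imp_continuous_on[OF Q] S by (simp add: continuous_on_eq_continuous_at isCont_def)
  have 2: "deriv Q \<midarrow>\<xi>\<rightarrow> deriv Q \<xi>"
    using holomorphic_on_imp_continuous_on[OF holomorphic_deriv[OF Q S(1)]] S
    by (simp add: continuous_on_eq_continuous_at isCont_def)
  have "((\<lambda>w. (w - \<xi>) * deriv Q w / Q w) \<longlongrightarrow> (\<xi> - \<xi>) * deriv Q \<xi> / Q \<xi>) (at \<xi>)"
    by (intro tendsto_intros 1 2 False)
  then show ?thesis using False by (intro exI[of _ 0]) simp
next
  case True
  obtain g r n where g: "0 < n" "0 < r" "ball \<xi> r \<subseteq> S" "g holomorphic_on ball \<xi> r"
      "\<And>w. w \<in> ball \<xi> r \<Longrightarrow> Q w = (w - \<xi>)^n * g w" "\<And>w. w \<in> ball \<xi> r \<Longrightarrow> g w \<noteq> 0"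
    by (rule holomorphic_factor_zero_nonconstant[OF Q S True nc], rule that)
  have \<xi>: "\<xi> \<in> ball \<xi> r" using g(2) by simp
  have 1: "g \<midarrow>\<xi>\<rightarrow> g \<xi>"
    using holomorphic_on_imp_continuous_on[OF g(4)] \<xi> by (simp add: continuous_on_eq_continuous_at isCont_def)
  have 2: "deriv g \<midarrow>\<xi>\<rightarrow> deriv g \<xi>"
    using holomorphic_on_imp_continuous_on[OF holomorphic_deriv[OF g(4) open_ball]] \<xi>
    by (simp add: continuous_on_eq_continuous_at isCont_def)
  have "((\<lambda>w. of_nat n + (w - \<xi>) * deriv g w / g w) \<longlongrightarrow> of_nat n + (\<xi> - \<xi>) * deriv g \<xi> / g \<xi>) (at \<xi>)"
    by (intro tendsto_intros 1 2 g(6)[OF \<xi>])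
  moreover have "\<forall>\<^sub>F w in at \<xi>. of_nat n + (w - \<xi>) * deriv g w / g w = (w - \<xi>) * deriv Q w / Q w"
  proof -
    have "of_nat n + (w - \<xi>) * deriv g w / g w = (w - \<xi>) * deriv Q w / Q w" if w: "w \<in> ball \<xi> r" "w \<noteq> \<xi>" for w
    proof -
      have "(g has_field_derivative deriv g w) (at w)"
        using g(4) w(1) by (intro holomorphic_derivI[OF _ open_ball]) auto
      then have "((\<lambda>w. (w - \<xi>)^n * g w) has_field_derivative
          (of_nat n * (w - \<xi>) ^ (n - 1) * g w + deriv g w * (w - \<xi>) ^ n)) (at w)"
        by (auto intro!: derivative_eq_intros)
      then have "(Q has_field_derivative
          (of_nat n * (w - \<xi>) ^ (n - 1) * g w + deriv g w * (w - \<xi>) ^ n)) (at w)"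
        by (rule has_field_derivative_transform_within_open[OF _ open_ball w(1)]) (simp add: g(5))
      then have d: "deriv Q w = of_nat n * (w - \<xi>) ^ (n - 1) * g w + deriv g w * (w - \<xi>) ^ n"
        by (rule DERIV_imp_deriv)
      have p: "(w - \<xi>) * (w - \<xi>) ^ (n - 1) = (w - \<xi>) ^ n" using g(1) by (cases n) auto
      have num: "(w - \<xi>) * deriv Q w = (w - \<xi>) ^ n * (of_nat n * g w + (w - \<xi>) * deriv g w)"
        unfolding d using p by (simp add: algebra_simps)
      have "(w - \<xi>) * deriv Q w / Q w = (of_nat n * g w + (w - \<xi>) * deriv g w) / g w"
        unfolding num g(5)[OF w(1)] using w(2) by simp
      then show ?thesis using g(6)[OF w(1)] by (simp add: add_divide_distrib)
    qed
    then show ?thesis using g(2) unfolding eventually_at by (intro exI[of _ r]) (auto simp: dist_commute)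
  qed
  ultimately have "((\<lambda>w. (w - \<xi>) * deriv Q w / Q w) \<longlongrightarrow> of_nat n) (at \<xi>)"
    using Lim_transform_eventually by fastforce
  then show ?thesis using g(1) by (intro exI[of _ n]) auto
qed

lemma Qf_not_constant:
  assumes e: "e\<^sup>2 = 1" shows "\<not> Qf e constant_on {s. Re s > 0}"
proof
  assume "Qf e constant_on {s. Re s > 0}"
  then obtain c where c: "\<And>s. Re s > 0 \<Longrightarrow> Qf e s = c" by (auto simp: constant_on_def)
  \<comment> \<open>Chosen so that \<open>(\<sigma> - 1) * (2/3)\<close> equals
    \<open>2/3 + 2 * \<bar>Re c\<bar>\<close> and exceeds \<open>Re c\<close>.\<close>
  define \<sigma> where "\<sigma> = 2 + 3 * \<bar>Re c\<bar>"
  have \<sigma>: "\<sigma> > 1" "\<sigma> > 0" by (simp_all add: \<sigma>_def)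
  have "Qf e (of_real \<sigma>) = of_real (\<sigma> - 1) * dirichlet_series (cchar e) (of_real \<sigma>)"
    using Qf_eq[OF e, of "of_real \<sigma>"] \<sigma> by simp
  then have "Re c = (\<sigma> - 1) * Re (dirichlet_series (cchar e) (of_real \<sigma>))"
    using c[of "of_real \<sigma>"] \<sigma> by (simp del: of_real_diff)
  also have "\<dots> \<ge> (\<sigma> - 1) * (2/3)"
    using Re_dirichlet_series_char4_ge[OF e \<sigma>(1)] \<sigma> by (intro mult_left_mono) auto
  finally show False by (simp add: \<sigma>_def)
qed

text \<open>Approaching \<open>1 + \<i> u\<close> horizontally measures the order of the pole or
  zero of \<open>L\<close> there: the \<open>of_bool\<close> comes from \<open>1 / (s - 1)\<close>,
  and \<open>m\<close> is the order of the zero of \<open>Qf\<close>. The difference stays correct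
  at \<open>u = 0\<close> when \<open>L\<close> is regular, since then \<open>Qf\<close>
  vanishes.\<close>

lemma mangoldt_limit:
  assumes e: "e\<^sup>2 = 1"
  shows "\<exists>m::nat. ((\<lambda>\<sigma>. of_real (\<sigma> - 1) * dirichlet_series (cmangoldt e) (Complex \<sigma> u)) \<longlongrightarrow> of_bool (u = 0) - of_nat m) (at_right 1)
     \<and> (Qf e (Complex 1 u) = 0 \<longrightarrow> m \<ge> 1)"
proof -
  define \<xi> where "\<xi> = Complex 1 u"
  define S where "S = {s. Re s > 0}"
  have S: "open S" "connected S" "\<xi> \<in> S"
    unfolding S_def \<xi>_def
    by (auto intro: open_halfspace_Re_gt convex_connected convex_halfspace_Re_gt)
  obtain m :: nat where m: "((\<lambda>w. (w - \<xi>) * deriv (Qf e) w / Qf e w) \<longlongrightarrow> of_nat m) (at \<xi>)" "Qf e \<xi> = 0 \<longrightarrow> m \<ge> 1"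
    using log_deriv_limit[OF _ S, of "Qf e"] Qf_holomorphic[of e] Qf_not_constant[OF e] unfolding S_def by blast
  have C: "((\<lambda>\<sigma>. Complex \<sigma> u) \<longlongrightarrow> \<xi>) (at_right 1)"
    unfolding \<xi>_def Complex_eq by (intro tendsto_intros)
  have flim: "filterlim (\<lambda>\<sigma>. Complex \<sigma> u) (at \<xi>) (at_right 1)"
    unfolding filterlim_at using C
    by (auto simp: \<xi>_def eventually_at_right_less intro: eventually_mono[OF eventually_at_right_less])
  have l1: "((\<lambda>\<sigma>. (Complex \<sigma> u - \<xi>) * deriv (Qf e) (Complex \<sigma> u) / Qf e (Complex \<sigma> u)) \<longlongrightarrow> of_nat m) (at_right 1)"
    using filterlim_compose[OF m(1) flim] .
  have l2: "((\<lambda>\<sigma>. of_real (\<sigma> - 1) / (Complex \<sigma> u - 1)) \<longlongrightarrow> of_bool (u = 0)) (at_right 1)"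
  proof (cases "u = 0")
    case True
    have "\<forall>\<^sub>F \<sigma> in at_right 1. 1 = of_real (\<sigma> - 1) / (Complex \<sigma> u - 1)"
      using eventually_at_right_less[of "1::real"]
    proof eventually_elim
      case (elim \<sigma>)
      have "Complex \<sigma> u - 1 = of_real (\<sigma> - 1)" using True by (simp add: complex_eq_iff)
      then show ?case using elim by simp
    qed
    then have "((\<lambda>\<sigma>. of_real (\<sigma> - 1) / (Complex \<sigma> u - 1)) \<longlongrightarrow> 1) (at_right 1)"
      by (rule Lim_transform_eventually[OF tendsto_const])
    then show ?thesis using True by simp
  next
    case False
    then have "\<xi> - 1 \<noteq> 0" by (simp add: \<xi>_def complex_eq_iff)
    then have "((\<lambda>\<sigma>. of_real (\<sigma> - 1) / (Complex \<sigma> u - 1)) \<longlongrightarrow> of_real (1 - 1) / (\<xi> - 1)) (at_right 1)"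
      by (intro tendsto_intros C)
    then show ?thesis using False by simp
  qed
  have "\<forall>\<^sub>F \<sigma> in at_right 1. of_real (\<sigma> - 1) / (Complex \<sigma> u - 1) - (Complex \<sigma> u - \<xi>) * deriv (Qf e) (Complex \<sigma> u) / Qf e (Complex \<sigma> u)
      = of_real (\<sigma> - 1) * dirichlet_series (cmangoldt e) (Complex \<sigma> u)"
    using eventually_at_right_less[of "1::real"]
  proof eventually_elim
    case (elim \<sigma>)
    have d: "Complex \<sigma> u - \<xi> = of_real (\<sigma> - 1)" by (simp add: \<xi>_def complex_eq_iff)
    show ?case unfolding d using dirichlet_series_mangoldt_eq[OF e, of "Complex \<sigma> u"] elim
      by (simp add: right_diff_distrib)
  qed
  then have "((\<lambda>\<sigma>. of_real (\<sigma> - 1) * dirichlet_series (cmangoldt e) (Complex \<sigma> u)) \<longlongrightarrow> of_bool (u = 0) - of_nat m) (at_right 1)"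
    using Lim_transform_eventually[OF tendsto_diff[OF l2 l1]] by simp
  then show ?thesis using m(2) unfolding \<xi>_def by blast
qed

text \<open>Multiplied by \<open>\<sigma> - 1\<close> and passed to the limit, the inequality reads
  \<open>3 * (1 - m0) - 4 * m1 - m2 \<ge> 0\<close>. A zero means \<open>m1 \<ge> 1\<close>,
  impossible because 4 exceeds 3. With \<open>t \<noteq> 0\<close> neither \<open>t\<close> nor
  \<open>2 * t\<close> meets the pole.\<close>

lemma Qf_nonzero_line:
  assumes e: "e\<^sup>2 = 1" and t: "t \<noteq> 0"
  shows "Qf e (Complex 1 t) \<noteq> 0"
proof
  assume zero: "Qf e (Complex 1 t) = 0"
  define V where "V = (\<lambda>e u \<sigma>. of_real (\<sigma> - 1) * dirichlet_series (cmangoldt e) (Complex \<sigma> u))"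
  obtain m0 :: nat where m0: "(V 1 0 \<longlongrightarrow> of_bool (0 = (0::real)) - of_nat m0) (at_right 1)"
    using mangoldt_limit[of 1 0] unfolding V_def by auto
  obtain m1 :: nat where m1: "(V e t \<longlongrightarrow> of_bool (t = 0) - of_nat m1) (at_right 1)" "m1 \<ge> 1"
    using mangoldt_limit[OF e, of t] zero unfolding V_def by auto
  obtain m2 :: nat where m2: "(V 1 (2 * t) \<longlongrightarrow> of_bool (2 * t = 0) - of_nat m2) (at_right 1)"
    using mangoldt_limit[of 1 "2 * t"] unfolding V_def by auto
  have "((\<lambda>\<sigma>. Re (3 * V 1 0 \<sigma> + 4 * V e t \<sigma> + V 1 (2 * t) \<sigma>)) \<longlongrightarrow>
     Re (3 * (of_bool (0 = (0::real)) - of_nat m0) + 4 * (of_bool (t = 0) - of_nat m1) + (of_bool (2 * t = 0) - of_nat m2))) (at_right 1)"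
    by (intro tendsto_intros m0 m1 m2)
  moreover have "\<forall>\<^sub>F \<sigma> in at_right 1. 0 \<le> Re (3 * V 1 0 \<sigma> + 4 * V e t \<sigma> + V 1 (2 * t) \<sigma>)"
    using eventually_at_right_less[of "1::real"]
  proof eventually_elim
    case (elim \<sigma>)
    have "3 * V 1 0 \<sigma> + 4 * V e t \<sigma> + V 1 (2 * t) \<sigma> = of_real (\<sigma> - 1) *
       (3 * dirichlet_series (cmangoldt 1) (of_real \<sigma>)
      + 4 * dirichlet_series (cmangoldt e) (Complex \<sigma> t) + dirichlet_series (cmangoldt 1) (Complex \<sigma> (2 * t)))"
      by (simp add: V_def complex_of_real_def algebra_simps)
    then have "Re (3 * V 1 0 \<sigma> + 4 * V e t \<sigma> + V 1 (2 * t) \<sigma>) = (\<sigma> - 1) * Re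
       (3 * dirichlet_series (cmangoldt 1) (of_real \<sigma>)
      + 4 * dirichlet_series (cmangoldt e) (Complex \<sigma> t) + dirichlet_series (cmangoldt 1) (Complex \<sigma> (2 * t)))"
      by (simp del: of_real_diff)
    then show ?case using three_four_one[OF e elim, of t] elim by simp
  qed
  ultimately have "0 \<le> Re (3 * (of_bool (0 = (0::real)) - of_nat m0) + 4 * (of_bool (t = 0) - of_nat m1) + (of_bool (2 * t = 0) - of_nat m2))"
    by (intro tendsto_lowerbound) auto
  then have "0 \<le> 3 * (1 - real m0) - 4 * real m1 - real m2" using t by simp
  moreover have "real m1 \<ge> 1" "real m0 \<ge> 0" "real m2 \<ge> 0" using m1(2) by simp_all
  ultimately show False by argo
qed

lemma Qf_nonzero:
  assumes GRH: "generalized_riemann_hypothesis" and e: "e\<^sup>2 = 1" and s: "1/2 < Re s" "s \<noteq> 1"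
  shows "Qf e s \<noteq> 0"
proof -
  consider "Re s < 1" | "Re s = 1" | "Re s > 1" by linarith
  then show ?thesis
  proof cases
    case 2
    then have "s = Complex 1 (Im s)" "Im s \<noteq> 0" using s(2) by (auto simp: complex_eq_iff)
    then show ?thesis using Qf_nonzero_line[OF e] by metis
  qed (use Qf_nonzero_strip[OF GRH e s(1)] Qf_nonzero_gt_1[OF e] in auto)
qed

text \<open>Either \<open>Qf\<close> is non-zero at 1, and the quotient tends to 0, or it vanishes
  there. In the second case the zero is simple, because the lower bound 2/3 for \<open>Re L\<close>
  to the right of 1 carries over to the derivative.\<close>

lemma Qf_quotient_bounded:
  assumes e: "e\<^sup>2 = 1"
  shows "\<exists>B. \<forall>\<^sub>F s in at 1. norm ((s - 1) / Qf e s) \<le> B"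
proof -
  define S where "S = {s. Re s > 0}"
  have op: "open S" unfolding S_def by (rule open_halfspace_Re_gt)
  have D: "(Qf e has_field_derivative deriv (Qf e) 1) (at 1)"
    using holomorphic_derivI[OF Qf_holomorphic[of e, folded S_def] op, of 1] by (simp add: S_def)
  have lim: "\<exists>l. ((\<lambda>s. (s - 1) / Qf e s) \<longlongrightarrow> l) (at 1)"
  proof (cases "Qf e 1 = 0")
    case False
    have "Qf e \<midarrow>1\<rightarrow> Qf e 1" using DERIV_isCont[OF D] by (simp add: isCont_def)
    then have "((\<lambda>s. (s - 1) / Qf e s) \<longlongrightarrow> (1 - 1) / Qf e 1) (at 1)"
      by (intro tendsto_intros False)
    then show ?thesis by blast
  next
    case True
    have q: "((\<lambda>s. Qf e s / (s - 1)) \<longlongrightarrow> deriv (Qf e) 1) (at 1)"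
      using D True by (simp add: has_field_derivative_iff)
    have fl: "filterlim complex_of_real (at 1) (at_right 1)"
      unfolding filterlim_at
      by (auto intro!: tendsto_eq_intros eventually_mono[OF eventually_at_right_less])
    have "((\<lambda>\<sigma>. Re (Qf e (of_real \<sigma>) / (of_real \<sigma> - 1))) \<longlongrightarrow> Re (deriv (Qf e) 1)) (at_right 1)"
      by (rule tendsto_Re[OF filterlim_compose[OF q fl]])
    moreover have "\<forall>\<^sub>F \<sigma> in at_right 1. 2/3 \<le> Re (Qf e (of_real \<sigma>) / (of_real \<sigma> - 1))"
      using eventually_at_right_less[of "1::real"]
    proof eventually_elim
      case (elim \<sigma>)
      have "complex_of_real \<sigma> - 1 \<noteq> 0" using elim by auto
      then show ?case using Qf_eq[OF e, of "of_real \<sigma>"] Re_dirichlet_series_char4_ge[OF e elim] elim by simp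
    qed
    ultimately have "2/3 \<le> Re (deriv (Qf e) 1)" by (intro tendsto_lowerbound) auto
    then have "deriv (Qf e) 1 \<noteq> 0" by auto
    then have "((\<lambda>s. inverse (Qf e s / (s - 1))) \<longlongrightarrow> inverse (deriv (Qf e) 1)) (at 1)"
      by (intro tendsto_intros q)
    then show ?thesis by (auto simp: divide_inverse mult.commute)
  qed
  then obtain l where "((\<lambda>s. (s - 1) / Qf e s) \<longlongrightarrow> l) (at 1)" by blast
  then have "((\<lambda>s. norm ((s - 1) / Qf e s)) \<longlongrightarrow> norm l) (at 1)" by (rule tendsto_norm)
  then have "\<forall>\<^sub>F s in at 1. norm ((s - 1) / Qf e s) < norm l + 1"
    by (rule order_tendstoD(2)) simp
  then have "\<forall>\<^sub>F s in at 1. norm ((s - 1) / Qf e s) \<le> norm l + 1"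
    by (rule eventually_mono) simp
  then show ?thesis by blast
qed

text \<open>\<open>R\<close> is \<open>1 / L\<close>. The region is free of zeros except possibly
  for \<open>Qf\<close> at 1, and there boundedness removes the singularity.\<close>

lemma reciprocal_exists:
  assumes GRH: "generalized_riemann_hypothesis" and e: "e\<^sup>2 = 1"
  shows "\<exists>R. R holomorphic_on {s. Re s > 1/2} \<and> (\<forall>s. Re s > 1/2 \<longrightarrow> s \<noteq> 1 \<longrightarrow> R s = (s - 1) / Qf e s) \<and>
     (\<forall>s. Re s > 1 \<longrightarrow> R s = dirichlet_series (cmob e) s)"
proof -
  define S where "S = {s. Re s > 1/2}"
  have op: "open S" unfolding S_def by (rule open_halfspace_Re_gt)
  have "(\<lambda>s. (s - 1) / Qf e s) holomorphic_on S - {1}"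
    using Qf_nonzero[OF GRH e]
    by (intro holomorphic_intros holomorphic_on_subset[OF Qf_holomorphic]) (auto simp: S_def)
  moreover have "1 \<in> interior S" using op by (simp add: interior_open S_def)
  ultimately obtain R where R: "R holomorphic_on S" "\<forall>z\<in>S - {1}. R z = (z - 1) / Qf e z"
    using Qf_quotient_bounded[OF e] holomorphic_on_extend_bounded[of "\<lambda>s. (s - 1) / Qf e s" S 1] by blast
  have "R s = dirichlet_series (cmob e) s" if s: "Re s > 1" for s
  proof -
    have s1: "s \<noteq> 1" using s by auto
    then have "R s = (s - 1) / Qf e s" using R(2) s by (auto simp: S_def)
    also have "\<dots> = 1 / dirichlet_series (cchar e) s" using Qf_eq[OF e s] s1 by simp
    also have "\<dots> = dirichlet_series (cmob e) s"
      using dirichlet_inverse[OF e s] by (metis eq_divide_imp mult_zero_right zero_neq_one)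
    finally show ?thesis .
  qed
  then show ?thesis using R unfolding S_def by blast
qed

subsection \<open>Growth of the reciprocal\<close>

text \<open>The map \<open>w / (2 A - w)\<close> sends the half-plane \<open>Re w < A\<close> into
  the unit disc and fixes 0, so the Schwarz lemma applies to its composition with
  \<open>g\<close>.\<close>

lemma Borel_Caratheodory_unit:
  assumes g: "g holomorphic_on ball 0 1" "g 0 = 0" and re: "\<And>z. norm z < 1 \<Longrightarrow> Re (g z) < A"
    and z: "norm z < 1"
  shows "norm (g z) \<le> 2 * A * norm z / (1 - norm z)"
proof -
  have A: "A > 0" using re[of 0] g(2) by simp
  define \<phi> where "\<phi> = (\<lambda>z. g z / (2 * of_real A - g z))"
  have lt: "norm (g z) < norm (2 * of_real A - g z)" if "norm z < 1" for z
  proof -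
    have "(norm (2 * of_real A - g z))\<^sup>2 - (norm (g z))\<^sup>2 = 4 * A * (A - Re (g z))"
      unfolding cmod_power2 by (simp add: power2_eq_square algebra_simps)
    also have "\<dots> > 0" using A re[OF that] by simp
    finally have "(norm (g z))\<^sup>2 < (norm (2 * of_real A - g z))\<^sup>2" by simp
    then show ?thesis by (rule power2_less_imp_less) simp
  qed
  have nz: "2 * of_real A - g z \<noteq> 0" if "norm z < 1" for z using lt[OF that] by auto
  have "norm (\<phi> z) \<le> norm z"
  proof (rule Schwarz_Lemma(1)[OF _ _ _ z])
    show "\<phi> holomorphic_on ball 0 1" unfolding \<phi>_def
      using nz by (intro holomorphic_intros g) auto
    show "\<phi> 0 = 0" by (simp add: \<phi>_def g)
    show "norm (\<phi> z) < 1" if "norm z < 1" for z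
      using lt[OF that] nz[OF that] by (simp add: \<phi>_def norm_divide)
  qed
  then have "norm (g z) \<le> norm z * norm (2 * of_real A - g z)"
    using nz[OF z] by (simp add: \<phi>_def norm_divide divide_le_eq)
  also have "\<dots> \<le> norm z * (2 * A + norm (g z))"
    using norm_triangle_ineq4[of "2 * of_real A" "g z"] A by (intro mult_left_mono) (auto simp: norm_mult)
  finally have "norm (g z) * (1 - norm z) \<le> 2 * A * norm z"
    by (simp add: algebra_simps)
  then show ?thesis using z by (simp add: le_divide_eq)
qed

lemma Borel_Caratheodory:
  assumes f: "f holomorphic_on ball c r" and re: "\<And>z. z \<in> ball c r \<Longrightarrow> Re (f z) < M"
    and z: "norm (z - c) \<le> \<rho>" and r: "\<rho> < r" "0 < r"
  shows "norm (f z - f c) \<le> 2 * (M - Re (f c)) * \<rho> / (r - \<rho>)"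
proof -
  define g where "g = (\<lambda>w. f (c + of_real r * w) - f c)"
  define w where "w = (z - c) / of_real r"
  have w: "norm w \<le> \<rho> / r" using r z by (simp add: w_def norm_divide divide_right_mono)
  have w1: "norm w < 1" using w r by (smt (verit) divide_less_eq_1)
  have inb: "c + of_real r * u \<in> ball c r" if "norm u < 1" for u
    using that r by (simp add: dist_norm norm_mult)
  have "c \<in> ball c r" using r by simp
  then have M: "M - Re (f c) > 0" using re by simp
  have "norm (g w) \<le> 2 * (M - Re (f c)) * norm w / (1 - norm w)"
  proof (rule Borel_Caratheodory_unit)
    have "(\<lambda>w. f (c + of_real r * w)) holomorphic_on ball 0 1"
      using inb by (intro holomorphic_on_compose_gen[OF _ f, unfolded o_def] holomorphic_intros) auto
    then show "g holomorphic_on ball 0 1" unfolding g_def by (intro holomorphic_intros)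
    show "Re (g u) < M - Re (f c)" if "norm u < 1" for u
      using re[OF inb[OF that]] by (simp add: g_def)
  qed (auto simp: g_def w1)
  also have "\<dots> \<le> 2 * (M - Re (f c)) * (\<rho> / r) / (1 - \<rho> / r)"
    using w w1 r M by (intro frac_le mult_left_mono mult_nonneg_nonneg) (auto intro: order.trans[OF norm_ge_zero w])
  also have "\<dots> = 2 * (M - Re (f c)) * \<rho> / (r - \<rho>)"
  proof -
    have "1 - \<rho> / r = (r - \<rho>) / r" using r by (simp add: field_simps)
    then show ?thesis using r by simp
  qed
  also have "g w = f z - f c" using r by (simp add: g_def w_def)
  finally show ?thesis .
qed

section \<open>A logarithm of \<open>L\<close> above the real axis\<close>

definition Lf :: "real \<Rightarrow> complex \<Rightarrow> complex" where "Lf e s = Qf e s / (s - 1)"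

lemma Lf_eq:
  assumes "e\<^sup>2 = 1" "Re s > 1" shows "Lf e s = dirichlet_series (cchar e) s"
proof -
  have "s \<noteq> 1" using assms by auto
  then show ?thesis by (simp add: Lf_def Qf_eq[OF assms])
qed

text \<open>Comparison of \<open>m powr (-3)\<close> with \<open>1 / (2 * m * (m - 1))\<close>,
  which telescopes from \<open>m = 2\<close> on to 1/2. Closeness to 1 makes the principal logarithm
  available on \<open>Re s \<ge> 3\<close>.\<close>

lemma norm_Lf_minus_1_le:
  assumes e: "e\<^sup>2 = 1" and s: "Re s \<ge> 3"
  shows "norm (Lf e s - 1) \<le> 1/2"
proof -
  have sum: "summable (\<lambda>n. norm (dterm (cchar e) s n))"
    using s by (intro summable_dterm[of _ 1] norm_cchar_le e) auto
  have "dterm (cchar e) s sums Lf e s"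
    using s Lf_eq[OF e, of s] summable_sums[OF summable_norm_cancel[OF sum]] by (simp add: dirichlet_series_def)
  then have "(\<lambda>n. dterm (cchar e) s (Suc n)) sums (Lf e s - dterm (cchar e) s 0)"
    by (subst sums_Suc_iff) simp
  then have 1: "Lf e s - 1 = (\<Sum>n. dterm (cchar e) s (Suc n))"
    by (simp add: cchar_def sums_iff)
  define h where "h = (\<lambda>n. (1/2) * (1 / real (Suc n) - 1 / real (Suc (Suc n))))"
  have lim: "(\<lambda>n. 1 / real (Suc n)) \<longlonglongrightarrow> 0" by (rule LIMSEQ_Suc[OF lim_1_over_n])
  have h: "h sums (1/2)"
    unfolding h_def using sums_mult[OF telescope_sums'[OF lim], of "1/2"] by simp
  have le: "norm (dterm (cchar e) s (Suc n)) \<le> h n" for n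
  proof -
    define m where "m = real (Suc (Suc n))"
    have m: "m \<ge> 2" by (simp add: m_def)
    have "norm (dterm (cchar e) s (Suc n)) \<le> 1 * m powr (- Re s)"
      unfolding norm_dterm m_def by (intro mult_right_mono norm_cchar_le e) auto
    also have "m powr (- Re s) \<le> m powr (- 3)" using s m by (intro powr_mono) auto
    also have "m powr (- 3) = 1 / (m * m * m)"
      using m by (simp add: powr_minus powr_numeral power3_eq_cube divide_inverse)
    also have "1 / (m * m * m) \<le> 1 / (2 * (m * (m - 1)))"
    proof (rule divide_left_mono)
      have "2 * (m * (m - 1)) \<le> m * (m * m)" 
        using mult_mono[of 2 m "m * (m - 1)" "m * m"] m by (simp add: mult_left_mono algebra_simps)
      then show "2 * (m * (m - 1)) \<le> m * m * m" by simp
    qed (use m in auto)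
    also have "\<dots> = h n" using m by (simp add: h_def m_def field_simps)
    finally show ?thesis by simp
  qed
  have "norm (\<Sum>n. dterm (cchar e) s (Suc n)) \<le> (\<Sum>n. h n)"
    using h le by (intro norm_suminf_le) (auto simp: sums_iff)
  then show ?thesis using 1 h by (simp add: sums_iff)
qed

lemma norm_Ln_bound:
  assumes "norm (z - 1) \<le> 1/2"
  shows "Re z > 0" "z \<notin> \<real>\<^sub>\<le>\<^sub>0" "norm (Ln z) \<le> 5"
proof -
  have "\<bar>Re z - 1\<bar> \<le> 1/2" using abs_Re_le_cmod[of "z - 1"] assms by simp
  then show pos: "Re z > 0" by linarith
  then show "z \<notin> \<real>\<^sub>\<le>\<^sub>0" by (auto simp: complex_nonpos_Reals_iff)
  have z0: "z \<noteq> 0" using pos by auto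
  have u: "norm z \<le> 3/2" using norm_triangle_sub[of z 1] assms by simp
  have l: "norm z \<ge> 1/2" using norm_triangle_sub[of 1 z] assms by (simp add: norm_minus_commute)
  have "ln (norm z) \<le> norm z - 1" using z0 by (intro ln_le_minus_one) auto
  moreover have "- ln (norm z) \<le> inverse (norm z) - 1"
    using ln_le_minus_one[of "inverse (norm z)"] z0 by (simp add: ln_inverse)
  moreover have "inverse (norm z) \<le> 2" using l z0 by (simp add: inverse_eq_divide divide_le_eq)
  ultimately have "\<bar>Re (Ln z)\<bar> \<le> 1" using z0 u by simp
  moreover have "\<bar>Im (Ln z)\<bar> \<le> pi" using z0 mpi_less_Im_Ln[OF z0] Im_Ln_le_pi[OF z0] by linarith
  ultimately show "norm (Ln z) \<le> 5" using cmod_le[of "Ln z"] pi_less_4 by linarith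
qed

lemma exp_eq_1_norm:
  fixes z :: complex
  assumes "exp z = 1" "z \<noteq> 0"
  shows "norm z \<ge> 1"
proof -
  obtain n :: int where n: "Im z = of_int (2 * n) * pi" "Re z = 0" using assms(1) by (auto simp: exp_eq_1)
  then have "n \<noteq> 0" using assms(2) by (auto simp: complex_eq_iff)
  then have "\<bar>real_of_int n\<bar> \<ge> 1" by linarith
  then have "1 * 1 \<le> (2 * \<bar>real_of_int n\<bar>) * pi" using pi_ge_two by (intro mult_mono) auto
  then have "\<bar>Im z\<bar> \<ge> 1" using n(1) by (simp add: abs_mult)
  then show ?thesis using abs_Im_le_cmod[of z] by linarith
qed

text \<open>The quarter plane is convex, avoids the pole at 1 and contains no zeros, so a logarithm
  exists. It is determined up to a period of \<open>exp\<close>, which is fixed by agreement with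
  \<open>Ln\<close> on \<open>Re s \<ge> 3\<close>; without this the bound by 5 could not
  hold.\<close>

lemma log_Lf_exists:
  assumes GRH: "generalized_riemann_hypothesis" and e: "e\<^sup>2 = 1"
  shows "\<exists>g. g holomorphic_on {s. Re s > 1/2 \<and> Im s > 0} \<and>
     (\<forall>s. Re s > 1/2 \<longrightarrow> Im s > 0 \<longrightarrow> exp (g s) = Lf e s) \<and>
     (\<forall>s. Re s \<ge> 3 \<longrightarrow> Im s > 0 \<longrightarrow> norm (g s) \<le> 5)"
proof -
  define \<Omega> where "\<Omega> = {s. Re s > 1/2 \<and> Im s > 0}"
  have \<Omega>_eq: "\<Omega> = {s. Re s > 1/2} \<inter> {s. Im s > 0}" by (auto simp: \<Omega>_def)
  have \<Omega>: "convex \<Omega>" "open \<Omega>"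
    unfolding \<Omega>_eq by (intro convex_Int open_Int convex_halfspace_Re_gt convex_halfspace_Im_gt
      open_halfspace_Re_gt open_halfspace_Im_gt)+
  \<comment> \<open>At 1 the quotient \<open>Lf\<close> has the default value 0 of division by 0;
    the region stays clear of that point.\<close>
  have n1: "s \<noteq> 1" if "s \<in> \<Omega>" for s using that by (auto simp: \<Omega>_def)
  have hol: "Lf e holomorphic_on \<Omega>" unfolding Lf_def
    using n1 by (intro holomorphic_intros holomorphic_on_subset[OF Qf_holomorphic]) (auto simp: \<Omega>_def)
  have nz: "Lf e s \<noteq> 0" if "s \<in> \<Omega>" for s
    using Qf_nonzero[OF GRH e, of s] n1[OF that] that by (auto simp: Lf_def \<Omega>_def)
  have "Complex 3 1 \<in> \<Omega>" by (simp add: \<Omega>_def)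
  then obtain g0 where g0: "g0 holomorphic_on \<Omega>" "\<And>s. s \<in> \<Omega> \<Longrightarrow> exp (g0 s) = Lf e s"
    using holomorphic_logarithm_exists[OF \<Omega> hol nz] by blast
  define W where "W = {s. Re s \<ge> 3 \<and> Im s > 0}"
  have W_eq: "W = {s. Re s \<ge> 3} \<inter> {s. Im s > 0}" by (auto simp: W_def)
  have W: "connected W" unfolding W_eq
    by (intro convex_connected convex_Int convex_halfspace_Re_ge convex_halfspace_Im_gt)
  have W\<Omega>: "W \<subseteq> \<Omega>" by (auto simp: W_def \<Omega>_def)
  define D where "D = (\<lambda>s. g0 s - Ln (Lf e s))"
  have D1: "exp (D s) = 1" if "s \<in> W" for s
    using that W\<Omega> g0(2)[of s] nz[of s] by (auto simp: D_def exp_diff)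
  \<comment> \<open>\<open>D\<close> is continuous with values among the periods of
    \<open>exp\<close>, which are at distance at least 1 from each other, and \<open>W\<close> is
    connected.\<close>
  have "D constant_on W"
  proof (rule continuous_discrete_range_constant[OF W])
    show "continuous_on W D" unfolding D_def
      using norm_Ln_bound(2)[OF norm_Lf_minus_1_le[OF e]]
      by (intro continuous_intros continuous_on_subset[OF holomorphic_on_imp_continuous_on[OF g0(1)] W\<Omega>]
            continuous_on_subset[OF holomorphic_on_imp_continuous_on[OF hol] W\<Omega>]) (auto simp: W_def)
    fix x assume x: "x \<in> W"
    show "\<exists>\<epsilon>>0. \<forall>y. y \<in> W \<and> D y \<noteq> D x \<longrightarrow> \<epsilon> \<le> norm (D y - D x)"
    proof (intro exI[of _ 1] conjI allI impI)
      fix y assume y: "y \<in> W \<and> D y \<noteq> D x"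
      have "exp (D y - D x) = 1" using D1 x y by (simp add: exp_diff)
      then show "1 \<le> norm (D y - D x)" using y by (intro exp_eq_1_norm) auto
    qed simp
  qed
  then obtain c where c: "\<And>s. s \<in> W \<Longrightarrow> D s = c" by (auto simp: constant_on_def)
  have "Complex 3 1 \<in> W" by (simp add: W_def)
  then have ec: "exp c = 1" using D1 c by metis
  define g where "g = (\<lambda>s. g0 s - c)"
  have "g holomorphic_on \<Omega>" unfolding g_def by (intro holomorphic_intros g0)
  moreover have "exp (g s) = Lf e s" if "s \<in> \<Omega>" for s
    using g0(2)[OF that] ec by (simp add: g_def exp_diff)
  moreover have "norm (g s) \<le> 5" if "s \<in> W" for s
  proof -
    have "g s = Ln (Lf e s)" using c[OF that] by (simp add: g_def D_def algebra_simps)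
    then show ?thesis using norm_Ln_bound(3)[OF norm_Lf_minus_1_le[OF e]] that by (simp add: W_def)
  qed
  ultimately show ?thesis unfolding \<Omega>_def W_def by blast
qed

text \<open>The real part of \<open>g\<close> is \<open>ln (norm L)\<close>, hence bounded above by
  a multiple of the logarithm of the height. Borel-Caratheodory around \<open>3 + \<i> t\<close>
  converts this one-sided bound into a bound for \<open>norm g\<close>. Heights from 4 on keep the
  disc above the real axis and at distance at least 1 from the pole.\<close>

lemma log_Lf_crude_bound:
  assumes e: "e\<^sup>2 = 1" and \<eta>: "0 < \<eta>" "\<eta> \<le> 1/4"
    and g: "g holomorphic_on {s. Re s > 1/2 \<and> Im s > 0}"
      "\<And>s. Re s > 1/2 \<Longrightarrow> Im s > 0 \<Longrightarrow> exp (g s) = Lf e s"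
      "\<And>s. Re s \<ge> 3 \<Longrightarrow> Im s > 0 \<Longrightarrow> norm (g s) \<le> 5"
  shows "\<exists>A\<ge>0. \<forall>\<sigma> t. 1/2 + \<eta> \<le> \<sigma> \<longrightarrow> \<sigma> \<le> 3 \<longrightarrow> t \<ge> 4 \<longrightarrow> norm (g (Complex \<sigma> t)) \<le> A * ln (t + 7)"
proof -
  obtain C where C: "C > 0" "\<And>s. Re s \<ge> 1/2 \<Longrightarrow> norm (Qf e s) \<le> C * (1 + norm s)\<^sup>2"
    using norm_Qf_le[OF e] by blast
  \<comment> \<open>The inner disc reaches exactly to \<open>Re s = 1/2 + \<eta>\<close>, the outer
    one to \<open>1/2 + \<eta>/2\<close>, still inside the region where \<open>g\<close> is
    holomorphic.\<close>
  define \<rho> where "\<rho> = 5/2 - \<eta>"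
  define r where "r = 5/2 - \<eta>/2"
  have r: "\<rho> < r" "0 < r" "0 \<le> \<rho>" "r < 5/2" "r - \<rho> = \<eta> / 2" using \<eta> by (auto simp: \<rho>_def r_def)
  define A where "A = 10 + (2 * (\<bar>ln C\<bar> + 9) * \<rho> / (r - \<rho>))"
  have A0: "A \<ge> 0" using r by (simp add: A_def)
  have "norm (g (Complex \<sigma> t)) \<le> A * ln (t + 7)" if \<sigma>: "1/2 + \<eta> \<le> \<sigma>" "\<sigma> \<le> 3" and t: "t \<ge> 4" for \<sigma> t
  proof -
    define c where "c = Complex 3 t"
    define M where "M = ln C + 2 * ln (t + 7) + 1"
    have l1: "ln (t + 7) \<ge> 1"
    proof -
      have "exp 1 \<le> t + 7" using t exp_le by linarith
      then show ?thesis using t by (subst ln_ge_iff) auto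
    qed
    have ball: "Re s > 1/2" "Im s > t - 5/2" "norm s < t + 6" if "s \<in> ball c r" for s
    proof -
      have n: "norm (c - s) < 5/2" using that r by (simp add: dist_norm)
      have "\<bar>3 - Re s\<bar> < 5/2" "\<bar>t - Im s\<bar> < 5/2"
        using abs_Re_le_cmod[of "c - s"] abs_Im_le_cmod[of "c - s"] n by (simp_all add: c_def)
      then show "Re s > 1/2" "Im s > t - 5/2" by linarith+
      have "norm c \<le> 3 + t" using cmod_le[of c] t by (simp add: c_def)
      then show "norm s < t + 6" using n norm_triangle_sub[of s c] by (simp add: norm_minus_commute)
    qed
    have sub: "ball c r \<subseteq> {s. Re s > 1/2 \<and> Im s > 0}" using ball t by force
    have "norm (g (Complex \<sigma> t) - g c) \<le> 2 * (M - Re (g c)) * \<rho> / (r - \<rho>)"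
    proof (rule Borel_Caratheodory[OF holomorphic_on_subset[OF g(1) sub] _ _ r(1,2)])
      fix s assume s: "s \<in> ball c r"
      have s1: "norm (s - 1) \<ge> 1"
        using abs_Im_le_cmod[of "s - 1"] ball(2)[OF s] t by simp
      have eg: "exp (g s) = Lf e s" using sub s by (intro g) auto
      have "exp (Re (g s)) = norm (Lf e s)" using eg by (metis norm_exp_eq_Re)
      also have "\<dots> \<le> norm (Qf e s) / 1" unfolding Lf_def norm_divide
        using s1 by (intro divide_left_mono) auto
      also have "norm (Qf e s) / 1 \<le> C * (1 + norm s)\<^sup>2" using C(2)[of s] ball(1)[OF s] by simp
      also have "\<dots> \<le> C * (t + 7)\<^sup>2"
        using C(1) ball(3)[OF s] t by (intro mult_left_mono power_mono) auto
      also have "\<dots> = exp (ln C + 2 * ln (t + 7))"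
      proof -
        have "exp (ln C) = C" "exp (ln (t + 7)) = t + 7" using C(1) t by auto
        then show ?thesis unfolding mult_2 exp_add power2_eq_square by (simp only:)
      qed
      finally show "Re (g s) < M" by (simp add: M_def)
    next
      have "Complex \<sigma> t - c = of_real (\<sigma> - 3)" by (simp add: c_def complex_eq_iff)
      then show "norm (Complex \<sigma> t - c) \<le> \<rho>" using \<sigma> by (simp only: norm_of_real) (simp add: \<rho>_def)
    qed
    moreover have gc: "norm (g c) \<le> 5" using t by (intro g) (auto simp: c_def)
    moreover have "2 * (M - Re (g c)) * \<rho> / (r - \<rho>) \<le> 2 * ((\<bar>ln C\<bar> + 9) * ln (t + 7)) * \<rho> / (r - \<rho>)"
    proof -
      have "M - Re (g c) \<le> \<bar>ln C\<bar> + 2 * ln (t + 7) + 6"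
        using gc abs_Re_le_cmod[of "g c"] by (simp add: M_def)
      also have "\<dots> \<le> \<bar>ln C\<bar> * ln (t + 7) + 2 * ln (t + 7) + 6 * ln (t + 7)"
        using l1 mult_left_mono[OF l1, of "\<bar>ln C\<bar>"] by simp
      also have "\<dots> \<le> (\<bar>ln C\<bar> + 9) * ln (t + 7)" using l1 by (simp add: algebra_simps)
      finally show ?thesis using r by (intro divide_right_mono mult_right_mono mult_left_mono) auto
    qed
    ultimately have "norm (g (Complex \<sigma> t)) \<le> 5 + 2 * ((\<bar>ln C\<bar> + 9) * ln (t + 7)) * \<rho> / (r - \<rho>)"
      using norm_triangle_sub[of "g (Complex \<sigma> t)" "g c"] by linarith
    also have "\<dots> \<le> 10 * ln (t + 7) + 2 * ((\<bar>ln C\<bar> + 9) * ln (t + 7)) * \<rho> / (r - \<rho>)"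
      using l1 by simp
    also have "\<dots> = A * ln (t + 7)" by (simp add: A_def algebra_simps)
    finally show ?thesis .
  qed
  then show ?thesis using A0 by blast
qed


lemma exp_neg_square_bound:
  fixes t :: real
  assumes "t \<ge> 8" shows "ln (3 * t / 2 + 7) * exp (- (t\<^sup>2 / 4)) \<le> 2"
proof -
  have "t * 8 \<le> t * t" using assms by (intro mult_left_mono) auto
  then have "3 * t / 2 + 7 \<le> 2 * (1 + t\<^sup>2 / 4)" unfolding power2_eq_square using assms by argo
  moreover have "ln (3 * t / 2 + 7) \<le> 3 * t / 2 + 7" using ln_le_minus_one[of "3 * t / 2 + 7"] assms by simp
  moreover have "1 + t\<^sup>2 / 4 \<le> exp (t\<^sup>2 / 4)" by (rule exp_ge_add_one_self)
  ultimately have "ln (3 * t / 2 + 7) \<le> 2 * exp (t\<^sup>2 / 4)" by argo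
  then show ?thesis by (simp add: exp_minus field_simps)
qed

text \<open>The factor \<open>exp ((s - s\<^sub>0)\<^sup>2)\<close> makes the horizontal sides of the rectangle harmless; tilting by
  \<open>exp (\<beta> (s - s\<^sub>0))\<close> with a large constant \<open>\<beta>\<close> trades the logarithmic bound on the left side for an
  arbitrarily small multiple of it, since \<open>g\<close> is bounded on the right side.\<close>

lemma log_Lf_small:
  assumes e: "e\<^sup>2 = 1" and \<eta>: "0 < \<eta>" "\<eta> \<le> 1/4" and \<epsilon>: "\<epsilon> > 0"
    and g: "g holomorphic_on {s. Re s > 1/2 \<and> Im s > 0}"
      "\<And>s. Re s > 1/2 \<Longrightarrow> Im s > 0 \<Longrightarrow> exp (g s) = Lf e s"
      "\<And>s. Re s \<ge> 3 \<Longrightarrow> Im s > 0 \<Longrightarrow> norm (g s) \<le> 5"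
  shows "\<exists>C. \<forall>\<sigma> t. 1/2 + 2 * \<eta> \<le> \<sigma> \<longrightarrow> \<sigma> \<le> 2 \<longrightarrow> t \<ge> 8 \<longrightarrow> norm (g (Complex \<sigma> t)) \<le> \<epsilon> * ln (t + 7) + C"
proof -
  from log_Lf_crude_bound[OF e \<eta> g] obtain A where A: "A \<ge> 0"
    "\<And>\<sigma> t. 1/2 + \<eta> \<le> \<sigma> \<Longrightarrow> \<sigma> \<le> 3 \<Longrightarrow> t \<ge> 4 \<Longrightarrow> norm (g (Complex \<sigma> t)) \<le> A * ln (t + 7)" by blast
  \<comment> \<open>On the left side \<open>Re s - \<sigma>0 \<le> - \<eta>\<close>, so the tilt
    gains \<open>exp (- \<beta> * \<eta>)\<close>; \<beta> is the size needed to bring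
    \<open>A * exp 7\<close> below \<epsilon>. The 7 bounds \<open>(5/2) ^ 2\<close>, the largest
    square of a horizontal distance.\<close>
  define \<beta> where "\<beta> = max 0 (ln ((A * exp 7 + 1) / \<epsilon>) / \<eta>)"
  have \<beta>0: "\<beta> \<ge> 0" by (simp add: \<beta>_def)
  have pos: "A * exp 7 + 1 > 0" using A(1) by (simp add: add_nonneg_pos)
  have \<beta>: "A * exp 7 * exp (- \<beta> * \<eta>) \<le> \<epsilon>"
  proof -
    have "ln ((A * exp 7 + 1) / \<epsilon>) / \<eta> \<le> \<beta>" by (simp add: \<beta>_def)
    then have "ln ((A * exp 7 + 1) / \<epsilon>) \<le> \<beta> * \<eta>" using \<eta> by (simp add: divide_le_eq)
    then have "exp (ln ((A * exp 7 + 1) / \<epsilon>)) \<le> exp (\<beta> * \<eta>)" by simp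
    moreover have "exp (ln ((A * exp 7 + 1) / \<epsilon>)) = (A * exp 7 + 1) / \<epsilon>" using pos \<epsilon> by simp
    ultimately have "(A * exp 7 + 1) / \<epsilon> \<le> exp (\<beta> * \<eta>)" by (simp only:)
    then have "A * exp 7 + 1 \<le> \<epsilon> * exp (\<beta> * \<eta>)" using \<epsilon> by (simp add: divide_le_eq mult.commute)
    then have "A * exp 7 \<le> \<epsilon> * exp (\<beta> * \<eta>)" by simp
    then have "A * exp 7 * exp (- (\<beta> * \<eta>)) \<le> \<epsilon> * exp (\<beta> * \<eta>) * exp (- (\<beta> * \<eta>))"
      by (rule mult_right_mono) simp
    also have "\<dots> = \<epsilon>" by (simp add: exp_minus)
    finally show ?thesis by simp
  qed
  define K where "K = exp 7 * exp (\<beta> * (5/2))"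
  have K: "K \<ge> 0" by (simp add: K_def)
  define C where "C = \<epsilon> + 5 * K + 2 * A * K"
  have "norm (g (Complex \<sigma>0 t0)) \<le> \<epsilon> * ln (t0 + 7) + C" if \<sigma>0: "1/2 + 2 * \<eta> \<le> \<sigma>0" "\<sigma>0 \<le> 2" and t0: "t0 \<ge> 8" for \<sigma>0 t0
  proof -
    define s0 where "s0 = Complex \<sigma>0 t0"
    \<comment> \<open>The horizontal sides are at distance \<open>t0/2\<close> from
      \<open>s0\<close>, where the Gaussian factor \<open>exp (- (t0 ^ 2) / 4)\<close> beats the
      logarithm. From \<open>t0 \<ge> 8\<close> the rectangle lies above height 4, as the crude
      bound requires.\<close>
    define S where "S = cbox (Complex (1/2 + \<eta>) (t0/2)) (Complex 3 (3 * t0 / 2))"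
    define \<Phi> where "\<Phi> = (\<lambda>s. g s * exp ((s - s0)\<^sup>2 + of_real \<beta> * (s - s0)))"
    define l where "l = ln (3 * t0 / 2 + 7)"
    have l0: "l \<ge> 0" using t0 by (simp add: l_def)
    have mem: "s \<in> S \<longleftrightarrow> 1/2 + \<eta> \<le> Re s \<and> Re s \<le> 3 \<and> t0/2 \<le> Im s \<and> Im s \<le> 3 * t0 / 2" for s
      by (auto simp: S_def in_cbox_complex_iff)
    have sub: "S \<subseteq> {s. Re s > 1/2 \<and> Im s > 0}" using \<eta> t0 by (auto simp: mem)
    have hol: "\<Phi> holomorphic_on S" unfolding \<Phi>_def
      by (intro holomorphic_intros holomorphic_on_subset[OF g(1) sub])
    have gS: "norm (g s) \<le> A * l" if "s \<in> S" for s
    proof -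
      have "norm (g s) \<le> A * ln (Im s + 7)"
        using A(2)[of "Re s" "Im s"] that t0 by (simp add: mem complex.collapse)
      also have "\<dots> \<le> A * l" unfolding l_def using that t0 A(1) by (intro mult_left_mono) (auto simp: mem)
      finally show ?thesis .
    qed
    have nexp: "norm (exp ((s - s0)\<^sup>2 + of_real \<beta> * (s - s0))) \<le>
        exp 7 * exp (- (Im s - t0)\<^sup>2) * exp (\<beta> * (Re s - \<sigma>0))" if "s \<in> S" for s
    proof -
      have x: "\<bar>Re s - \<sigma>0\<bar> \<le> 5/2" using that \<sigma>0 \<eta> unfolding mem abs_le_iff by auto
      have "(Re s - \<sigma>0)\<^sup>2 \<le> (5/2)\<^sup>2" using power_mono[OF x, of 2] by simp
      then have "(Re s - \<sigma>0)\<^sup>2 \<le> 7" by (simp add: power2_eq_square)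
      then have "(Re s - \<sigma>0)\<^sup>2 - (Im s - t0)\<^sup>2 + \<beta> * (Re s - \<sigma>0) \<le> 7 + - (Im s - t0)\<^sup>2 + \<beta> * (Re s - \<sigma>0)" by simp
      then have "exp ((Re s - \<sigma>0)\<^sup>2 - (Im s - t0)\<^sup>2 + \<beta> * (Re s - \<sigma>0)) \<le> exp (7 + - (Im s - t0)\<^sup>2 + \<beta> * (Re s - \<sigma>0))"
        by simp
      moreover have "Re ((s - s0)\<^sup>2 + of_real \<beta> * (s - s0)) = (Re s - \<sigma>0)\<^sup>2 - (Im s - t0)\<^sup>2 + \<beta> * (Re s - \<sigma>0)"
        by (simp add: s0_def power2_eq_square)
      ultimately show ?thesis unfolding norm_exp_eq_Re by (simp only: exp_add)
    qed
    have fr: "norm (\<Phi> s) \<le> \<epsilon> * l + 5 * K + 2 * A * K" if s: "s \<in> frontier S" for s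
    proof -
      have sS: "s \<in> S" using s by (simp add: S_def frontier_def)
      have ns: "s \<notin> box (Complex (1/2 + \<eta>) (t0/2)) (Complex 3 (3 * t0 / 2))"
        using s by (simp add: S_def frontier_def)
      have ex1: "exp (- (Im s - t0)\<^sup>2) \<le> 1" by simp
      have "\<beta> * (Re s - \<sigma>0) \<le> \<beta> * (5/2)"
        using sS \<sigma>0 \<eta> \<beta>0 by (intro mult_left_mono) (auto simp: mem)
      then have ex2: "exp (\<beta> * (Re s - \<sigma>0)) \<le> exp (\<beta> * (5/2))" by (simp only: exp_le_cancel_iff)
      have nP: "norm (\<Phi> s) \<le> norm (g s) * (exp 7 * exp (- (Im s - t0)\<^sup>2) * exp (\<beta> * (Re s - \<sigma>0)))"
        unfolding \<Phi>_def norm_mult by (intro mult_left_mono nexp sS) auto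
      have "Re s = 1/2 + \<eta> \<or> Re s = 3 \<or> Im s = t0/2 \<or> Im s = 3 * t0 / 2"
        using sS ns unfolding mem in_box_complex_iff by auto
      then consider "Re s = 1/2 + \<eta>" | "Re s = 3" | "\<bar>Im s - t0\<bar> = t0/2"
        using t0 by auto
      then show ?thesis
      proof cases
        case 1
        have "norm (\<Phi> s) \<le> (A * l) * (exp 7 * 1 * exp (- \<beta> * \<eta>))"
        proof (rule order.trans[OF nP])
          have "\<beta> * (Re s - \<sigma>0) \<le> \<beta> * (- \<eta>)" using 1 \<sigma>0 \<beta>0 by (intro mult_left_mono) auto
          then show "norm (g s) * (exp 7 * exp (- (Im s - t0)\<^sup>2) * exp (\<beta> * (Re s - \<sigma>0))) \<le> (A * l) * (exp 7 * 1 * exp (- \<beta> * \<eta>))"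
            using A(1) l0 by (intro mult_mono gS sS) auto
        qed
        also have "\<dots> = (A * exp 7 * exp (- \<beta> * \<eta>)) * l" by simp
        also have "\<dots> \<le> \<epsilon> * l" using \<beta> l0 by (rule mult_right_mono)
        finally show ?thesis using A(1) K by (simp add: add_increasing2)
      next
        case 2
        have "norm (g s) \<le> 5" using 2 sS t0 by (intro g) (auto simp: mem)
        then have "norm (\<Phi> s) \<le> 5 * (exp 7 * 1 * exp (\<beta> * (5/2)))"
          using ex1 ex2 by (intro order.trans[OF nP] mult_mono) auto
        also have "\<dots> = 5 * K" by (simp add: K_def)
        also have "\<dots> \<le> \<epsilon> * l + 5 * K + 2 * A * K" using \<epsilon> l0 A(1) K by simp
        finally show ?thesis .
      next
        case 3
        have "(Im s - t0)\<^sup>2 = (t0 / 2)\<^sup>2" using 3 by (metis power2_abs)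
        then have sq: "(Im s - t0)\<^sup>2 = t0\<^sup>2 / 4" by (simp add: power_divide)
        have "norm (\<Phi> s) \<le> norm (g s) * (exp 7 * exp (- (t0\<^sup>2 / 4)) * exp (\<beta> * (Re s - \<sigma>0)))"
          using nP unfolding sq .
        also have "\<dots> \<le> (A * l) * (exp 7 * exp (- (t0\<^sup>2 / 4)) * exp (\<beta> * (5/2)))"
          using ex2 A(1) l0 by (intro mult_mono gS sS) auto
        also have "\<dots> = A * K * (l * exp (- (t0\<^sup>2 / 4)))" by (simp add: K_def)
        also have "\<dots> \<le> A * K * 2"
          using exp_neg_square_bound[OF t0] A(1) K by (intro mult_left_mono) (auto simp: l_def)
        also have "\<dots> \<le> \<epsilon> * l + 5 * K + 2 * A * K" using \<epsilon> l0 A(1) K by simp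
        finally show ?thesis .
      qed
    qed
    have s0S: "s0 \<in> S" using \<sigma>0 \<eta> t0 by (simp add: mem s0_def)
    have "norm (\<Phi> s0) \<le> \<epsilon> * l + 5 * K + 2 * A * K"
    proof (rule maximum_modulus_frontier[OF _ _ _ fr s0S])
      show "\<Phi> holomorphic_on interior S" using hol interior_subset by (rule holomorphic_on_subset)
      show "continuous_on (closure S) \<Phi>" using holomorphic_on_imp_continuous_on[OF hol] by (simp add: S_def)
      show "bounded S" by (simp add: S_def)
    qed
    moreover have "\<Phi> s0 = g s0" by (simp add: \<Phi>_def)
    moreover have "l \<le> ln (t0 + 7) + 1"
    proof -
      have "3 * t0 / 2 + 7 \<le> exp 1 * (t0 + 7)"
        using mult_right_mono[of 2 "exp 1 :: real" "t0 + 7"] exp_ge_add_one_self[of 1] t0 by simp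
      then have "l \<le> ln (exp 1 * (t0 + 7))" unfolding l_def using t0 by (intro ln_mono) auto
      also have "\<dots> = ln (t0 + 7) + 1" using t0 by (subst ln_mult) auto
      finally show ?thesis .
    qed
    then have "\<epsilon> * l \<le> \<epsilon> * (ln (t0 + 7) + 1)" using \<epsilon> by (intro mult_left_mono) auto
    ultimately show ?thesis by (simp add: C_def s0_def algebra_simps)
  qed
  then show ?thesis by blast
qed

section \<open>Conjugation symmetry and the bound for \<open>1 / L\<close>\<close>

lemma hz_cnj:
  assumes a: "a \<ge> 1" and s: "Re s > 0" shows "hz a (cnj s) = cnj (hz a s)"
proof -
  have pw: "of_real x powr cnj w = cnj (of_real x powr w)" if "x > 0" for x w
    using that by (subst cnj_powr) auto
  have "hz_term a j (cnj s) = cnj (hz_term a j s)" for j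
  proof -
    have "a + 4 * real j > 0" "a + 4 * real (Suc j) > 0" using a by (auto intro!: add_pos_nonneg)
    note p = pw[OF this(1), of "- s"] pw[OF this(1), of "1 - s"] pw[OF this(2), of "1 - s"]
    show ?thesis unfolding hz_term_def using p by (simp del: of_nat_Suc of_real_add)
  qed
  moreover have "(\<lambda>j. hz_term a j s) sums (\<Sum>j. hz_term a j s)"
    by (rule summable_sums[OF summable_norm_cancel[OF summable_hz_term[OF a s]]])
  then have "(\<lambda>j. cnj (hz_term a j s)) sums cnj (\<Sum>j. hz_term a j s)" by (simp add: sums_cnj)
  ultimately have "(\<Sum>j. hz_term a j (cnj s)) = cnj (\<Sum>j. hz_term a j s)" by (simp add: sums_iff)
  moreover have "of_real a powr (1 - cnj s) = cnj (of_real a powr (1 - s))"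
    using pw[of a "1 - s"] a by simp
  ultimately show ?thesis by (simp add: hz_def)
qed

lemma Qf_cnj: "Re s > 0 \<Longrightarrow> Qf e (cnj s) = cnj (Qf e s)"
  by (simp add: Qf_def hz_cnj)

text \<open>Above height 8 the norm of \<open>1 / L\<close> is \<open>exp (- Re g)\<close>, and
  \<open>\<epsilon> ln t\<close> in the exponent becomes a power \<epsilon>. Real coefficients
  reflect the estimate to negative heights. What remains is compact, and \<open>R\<close> is
  holomorphic there, including at 1.\<close>

lemma reciprocal_growth:
  assumes GRH: "generalized_riemann_hypothesis" and e: "e\<^sup>2 = 1"
    and R: "R holomorphic_on {s. Re s > 1/2}" "\<And>s. Re s > 1/2 \<Longrightarrow> s \<noteq> 1 \<Longrightarrow> R s = (s - 1) / Qf e s"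
    and \<eta>: "0 < \<eta>" and \<epsilon>: "\<epsilon> > 0"
  shows "\<exists>C>0. \<forall>s. 1/2 + \<eta> \<le> Re s \<longrightarrow> Re s \<le> 2 \<longrightarrow> norm (R s) \<le> C * (1 + \<bar>Im s\<bar>) powr \<epsilon>"
proof -
  from log_Lf_exists[OF GRH e] obtain g where g: "g holomorphic_on {s. Re s > 1/2 \<and> Im s > 0}"
      "\<And>s. Re s > 1/2 \<Longrightarrow> Im s > 0 \<Longrightarrow> exp (g s) = Lf e s"
      "\<And>s. Re s \<ge> 3 \<Longrightarrow> Im s > 0 \<Longrightarrow> norm (g s) \<le> 5" by blast
  define \<eta>' where "\<eta>' = min (\<eta> / 2) (1/4)"
  have \<eta>': "0 < \<eta>'" "\<eta>' \<le> 1/4" "2 * \<eta>' \<le> \<eta>" using \<eta> by (auto simp: \<eta>'_def)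
  from log_Lf_small[OF e \<eta>'(1,2) \<epsilon> g] obtain C1 where
    C1: "\<And>\<sigma> t. 1/2 + 2 * \<eta>' \<le> \<sigma> \<Longrightarrow> \<sigma> \<le> 2 \<Longrightarrow> t \<ge> 8 \<Longrightarrow> norm (g (Complex \<sigma> t)) \<le> \<epsilon> * ln (t + 7) + C1" by blast
  have up: "norm (R s) \<le> exp C1 * (Im s + 7) powr \<epsilon>" if s: "1/2 + \<eta> \<le> Re s" "Re s \<le> 2" "Im s \<ge> 8" for s
  proof -
    have "s \<noteq> 1" using s by auto
    then have "R s = inverse (Lf e s)" using R(2)[of s] s \<eta> by (simp add: Lf_def)
    also have "\<dots> = exp (- g s)" using g(2)[of s] s \<eta> by (simp add: exp_minus)
    finally have "norm (R s) = exp (- Re (g s))" by simp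
    also have "\<dots> \<le> exp (\<epsilon> * ln (Im s + 7) + C1)"
      using C1[of "Re s" "Im s"] s \<eta>' abs_Re_le_cmod[of "g s"] by (simp add: complex.collapse)
    also have "\<dots> = exp C1 * (Im s + 7) powr \<epsilon>" using s by (simp add: exp_add powr_def)
    finally show ?thesis .
  qed
  define K where "K = cbox (Complex (1/2 + \<eta>) (-8)) (Complex 2 8)"
  have "compact (R ` K)"
    by (intro compact_continuous_image holomorphic_on_imp_continuous_on holomorphic_on_subset[OF R(1)])
       (use \<eta> in \<open>auto simp: K_def in_cbox_complex_iff\<close>)
  then have "bounded (R ` K)" by (rule compact_imp_bounded)
  then obtain C2 where "\<forall>x\<in>R ` K. norm x \<le> C2" unfolding bounded_iff ..
  then have C2: "norm (R s) \<le> C2" if "s \<in> K" for s using that by simp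
  define C where "C = exp C1 * 7 powr \<epsilon> + \<bar>C2\<bar> + 1"
  have C0: "C > 0" by (simp add: C_def add_nonneg_pos)
  have sc: "exp C1 * (u + 7) powr \<epsilon> \<le> C * (1 + u) powr \<epsilon>" if "u \<ge> 0" for u
  proof -
    have "(u + 7) powr \<epsilon> \<le> (7 * (1 + u)) powr \<epsilon>" using that \<epsilon> by (intro powr_mono2) auto
    also have "\<dots> = 7 powr \<epsilon> * (1 + u) powr \<epsilon>" by (rule powr_mult)
    finally have "exp C1 * (u + 7) powr \<epsilon> \<le> (exp C1 * 7 powr \<epsilon>) * (1 + u) powr \<epsilon>" by simp
    also have "\<dots> \<le> C * (1 + u) powr \<epsilon>" by (intro mult_right_mono) (auto simp: C_def)
    finally show ?thesis .
  qed
  have "norm (R s) \<le> C * (1 + \<bar>Im s\<bar>) powr \<epsilon>" if s: "1/2 + \<eta> \<le> Re s" "Re s \<le> 2" for s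
  proof -
    consider "Im s \<ge> 8" | "Im s \<le> -8" | "\<bar>Im s\<bar> < 8" by linarith
    then show ?thesis
    proof cases
      case 1
      then show ?thesis using up[OF s 1] sc[of "Im s"] by simp
    next
      case 2
      have "R (cnj s) = cnj (R s)"
      proof -
        have "s \<noteq> 1" "cnj s \<noteq> 1" using 2 by (auto simp: complex_eq_iff)
        then have "R s = (s - 1) / Qf e s" "R (cnj s) = (cnj s - 1) / cnj (Qf e s)"
          using R(2)[of s] R(2)[of "cnj s"] Qf_cnj[of s e] s \<eta> by auto
        then show ?thesis by simp
      qed
      then have "norm (R s) = norm (R (cnj s))" by simp
      also have "\<dots> \<le> exp C1 * (- Im s + 7) powr \<epsilon>" using up[of "cnj s"] s 2 by simp
      also have "\<dots> \<le> C * (1 + - Im s) powr \<epsilon>" using 2 by (intro sc) auto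
      finally show ?thesis using 2 by simp
    next
      case 3
      then have "s \<in> K" using s by (auto simp: K_def in_cbox_complex_iff)
      then have "norm (R s) \<le> C2" by (rule C2)
      also have "C2 \<le> C * 1"
      proof -
        have "0 \<le> exp C1 * 7 powr \<epsilon>" by simp
        then show ?thesis unfolding C_def using abs_ge_self[of C2] by argo
      qed
      also have "\<dots> \<le> C * (1 + \<bar>Im s\<bar>) powr \<epsilon>"
        using C0 \<epsilon> by (intro mult_left_mono ge_one_powr_ge_zero) auto
      finally show ?thesis .
    qed
  qed
  then show ?thesis using C0 by blast
qed

subsection \<open>Truncated Perron formula\<close>

lemma rectpath_integral_vertical:
  fixes f :: "complex \<Rightarrow> complex"
  assumes ab: "a < b" and T: "T > 0"
    and cont: "continuous_on (path_image (rectpath (Complex a (-T)) (Complex b T))) f"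
    and B: "\<And>x. a \<le> x \<Longrightarrow> x \<le> b \<Longrightarrow> norm (f (Complex x T)) \<le> B" "\<And>x. a \<le> x \<Longrightarrow> x \<le> b \<Longrightarrow> norm (f (Complex x (-T))) \<le> B"
  shows "norm (contour_integral (rectpath (Complex a (-T)) (Complex b T)) f
      - \<i> * (integral {-T..T} (\<lambda>t. f (Complex b t)) - integral {-T..T} (\<lambda>t. f (Complex a t)))) \<le> 2 * B * (b - a)"
proof -
  define a1 a2 a3 a4 where "a1 = Complex a (-T)" and "a2 = Complex b (-T)" and "a3 = Complex b T" and "a4 = Complex a T"
  have B0: "B \<ge> 0" using B(1)[of a] ab norm_ge_zero order_trans less_imp_le by blast
  have rp: "rectpath (Complex a (-T)) (Complex b T) = linepath a1 a2 +++ linepath a2 a3 +++ linepath a3 a4 +++ linepath a4 a1"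
    by (simp add: rectpath_def Let_def a1_def a2_def a3_def a4_def)
  have img: "path_image (rectpath (Complex a (-T)) (Complex b T)) =
      closed_segment a1 a2 \<union> closed_segment a2 a3 \<union> closed_segment a3 a4 \<union> closed_segment a4 a1"
    unfolding rp by (simp add: path_image_join Un_assoc)
  have c: "continuous_on (closed_segment a1 a2) f" "continuous_on (closed_segment a2 a3) f"
      "continuous_on (closed_segment a3 a4) f" "continuous_on (closed_segment a4 a1) f"
    using cont unfolding img by (auto intro: continuous_on_subset)
  note i = c[THEN contour_integrable_continuous_linepath]
  have sum: "contour_integral (rectpath (Complex a (-T)) (Complex b T)) f =
      contour_integral (linepath a1 a2) f + (contour_integral (linepath a2 a3) f +
      (contour_integral (linepath a3 a4) f + contour_integral (linepath a4 a1) f))"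
    unfolding rp using i by (simp add: contour_integral_join)
  have v1: "contour_integral (linepath a2 a3) f = \<i> * integral {-T..T} (\<lambda>t. f (Complex b t))"
    by (rule contour_integral_linepath_same_Re) (use T in \<open>auto simp: a2_def a3_def\<close>)
  have "contour_integral (linepath a4 a1) f = - contour_integral (linepath a1 a4) f"
    by (rule contour_integral_reverse_linepath) (rule c)
  also have "contour_integral (linepath a1 a4) f = \<i> * integral {-T..T} (\<lambda>t. f (Complex a t))"
    by (rule contour_integral_linepath_same_Re) (use T in \<open>auto simp: a1_def a4_def\<close>)
  finally have v2: "contour_integral (linepath a4 a1) f = - (\<i> * integral {-T..T} (\<lambda>t. f (Complex a t)))" .
  have "norm (contour_integral (linepath a1 a2) f) \<le> B * norm (a2 - a1)"
  proof (rule contour_integral_bound_linepath[OF i(1) B0])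
    fix s assume "s \<in> closed_segment a1 a2"
    then have "s = Complex (Re s) (-T)" "a \<le> Re s" "Re s \<le> b"
      using ab by (auto simp: a1_def a2_def closed_segment_same_Im closed_segment_eq_real_ivl complex_eq_iff)
    then show "norm (f s) \<le> B" using B(2) by metis
  qed
  moreover have "norm (contour_integral (linepath a3 a4) f) \<le> B * norm (a4 - a3)"
  proof (rule contour_integral_bound_linepath[OF i(3) B0])
    fix s assume "s \<in> closed_segment a3 a4"
    then have "s = Complex (Re s) T" "a \<le> Re s" "Re s \<le> b"
      using ab by (auto simp: a3_def a4_def closed_segment_same_Im closed_segment_eq_real_ivl complex_eq_iff)
    then show "norm (f s) \<le> B" using B(1) by metis
  qed
  moreover have "norm (a2 - a1) = b - a"
  proof -
    have "a2 - a1 = of_real (b - a)" by (simp add: a1_def a2_def complex_eq_iff)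
    then show ?thesis using ab by (simp only: norm_of_real)
  qed
  moreover have "norm (a4 - a3) = b - a"
  proof -
    have "a4 - a3 = of_real (a - b)" by (simp add: a3_def a4_def complex_eq_iff)
    then show ?thesis using ab by (simp only: norm_of_real)
  qed
  moreover have "contour_integral (rectpath (Complex a (-T)) (Complex b T)) f
      - \<i> * (integral {-T..T} (\<lambda>t. f (Complex b t)) - integral {-T..T} (\<lambda>t. f (Complex a t)))
      = contour_integral (linepath a1 a2) f + contour_integral (linepath a3 a4) f"
    unfolding sum v1 v2 by (simp add: algebra_simps)
  moreover have "norm (contour_integral (linepath a1 a2) f + contour_integral (linepath a3 a4) f) \<le>
      norm (contour_integral (linepath a1 a2) f) + norm (contour_integral (linepath a3 a4) f)"
    by (rule norm_triangle_ineq)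
  ultimately show ?thesis by simp
qed

lemma vertical_shift:
  fixes f :: "complex \<Rightarrow> complex"
  assumes ab: "a < b" and T: "T > 0" and S: "convex S" "f holomorphic_on S"
    and sub: "\<And>s. a \<le> Re s \<Longrightarrow> s \<in> S"
    and B: "\<And>x. a \<le> x \<Longrightarrow> x \<le> b \<Longrightarrow> norm (f (Complex x T)) \<le> B" "\<And>x. a \<le> x \<Longrightarrow> x \<le> b \<Longrightarrow> norm (f (Complex x (-T))) \<le> B"
  shows "norm (integral {-T..T} (\<lambda>t. f (Complex b t)) - integral {-T..T} (\<lambda>t. f (Complex a t))) \<le> 2 * B * (b - a)"
proof -
  have img: "path_image (rectpath (Complex a (-T)) (Complex b T)) \<subseteq> S"
    using ab T by (subst path_image_rectpath) (auto intro!: sub)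
  have "contour_integral (rectpath (Complex a (-T)) (Complex b T)) f = 0"
    by (intro contour_integral_unique Cauchy_theorem_convex_simple[OF S(2,1)] img) auto
  moreover have cont: "continuous_on (path_image (rectpath (Complex a (-T)) (Complex b T))) f"
    by (rule continuous_on_subset[OF holomorphic_on_imp_continuous_on[OF S(2)] img])
  ultimately show ?thesis using rectpath_integral_vertical[OF ab T cont B] by (simp add: norm_mult)
qed

text \<open>The denominator \<open>s ^ 2\<close> belongs to logarithmic weights. It is written
  \<open>Suc 1\<close> to fit the residue formula for a function divided by a power.\<close>

abbreviation perron_ker :: "real \<Rightarrow> complex \<Rightarrow> complex" where
  "perron_ker v s \<equiv> exp (of_real v * s) / s ^ Suc 1"

text \<open>The difference quotient of step \<delta> of \<open>perron_ker\<close> in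
  \<open>v\<close>, with the factor \<open>exp (v s)\<close> removed. It tends to the sharp Perron
  kernel \<open>1 / s\<close> as \<delta> tends to 0.\<close>

abbreviation smooth_ker :: "real \<Rightarrow> complex \<Rightarrow> complex" where
  "smooth_ker \<delta> s \<equiv> (exp (of_real \<delta> * s) - 1) / (of_real \<delta> * s ^ Suc 1)"

lemma norm_exp_over_square_le:
  assumes "norm s \<ge> T" "T > 0" "v * Re s \<le> w"
  shows "norm (perron_ker v s) \<le> exp w / T\<^sup>2"
proof -
  have "norm (perron_ker v s) = exp (v * Re s) / (norm s)\<^sup>2"
    by (simp add: norm_divide norm_power norm_mult power2_eq_square)
  also have "\<dots> \<le> exp w / T\<^sup>2"
    using assms by (intro frac_le power_mono) auto
  finally show ?thesis .
qed

lemma norm_integral_vertical_le: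
  fixes f :: "real \<Rightarrow> complex"
  assumes "continuous_on {-T..T} f" "T \<ge> 0" "\<And>t. t \<in> {-T..T} \<Longrightarrow> norm (f t) \<le> B"
  shows "norm (integral {-T..T} f) \<le> 2 * T * B"
proof -
  have "norm (integral {-T..T} f) \<le> B * (T - (-T))"
    using assms by (intro integral_bound) auto
  then show ?thesis by (simp add: mult.commute)
qed

text \<open>For \<open>v \<le> 0\<close> the line is moved right to \<open>c + T\<close>, for
  \<open>v > 0\<close> left to \<open>- T\<close>, where the double pole at 0 is passed and
  contributes the residue \<open>v\<close>. On every side left over the integrand is at most
  \<open>exp (v * c) / T ^ 2\<close> and the length is of order \<open>T\<close>.\<close>

lemma perron_kernel:
  assumes c: "0 < c" "c \<le> T"
  shows "norm (integral {-T..T} (\<lambda>t. perron_ker v (Complex c t)) - of_real (2 * pi * max v 0))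
           \<le> 6 * exp (v * c) / T"
proof -
  have T: "T > 0" using c by simp
  define F :: "complex \<Rightarrow> complex" where "F = (\<lambda>s. perron_ker v s)"
  have hol: "F holomorphic_on - {0}" unfolding F_def by (intro holomorphic_intros) auto
  have contv: "continuous_on {-T..T} (\<lambda>t. F (Complex a t))" if "a \<noteq> 0" for a
    using that unfolding Complex_eq by (intro continuous_on_compose2[OF holomorphic_on_imp_continuous_on[OF hol]] continuous_intros)
       (auto simp: complex_eq_iff)
  have imT: "norm (Complex x T) \<ge> T" "norm (Complex x (-T)) \<ge> T" for x
    using abs_Im_le_cmod[of "Complex x T"] abs_Im_le_cmod[of "Complex x (-T)"] T by auto
  show ?thesis
  proof (cases "v \<le> 0")
    case True
    define R where "R = c + T"
    have R: "c < R" "T \<le> R" using c T by (auto simp: R_def)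
    have "norm (integral {-T..T} (\<lambda>t. F (Complex R t)) - integral {-T..T} (\<lambda>t. F (Complex c t))) \<le> 2 * (exp (v * c) / T\<^sup>2) * (R - c)"
    proof (rule vertical_shift[OF R(1) T convex_halfspace_Re_gt[of 0]])
      show "F holomorphic_on {x. 0 < Re x}" by (rule holomorphic_on_subset[OF hol]) auto
      show "norm (F (Complex x T)) \<le> exp (v * c) / T\<^sup>2" "norm (F (Complex x (-T))) \<le> exp (v * c) / T\<^sup>2" if "c \<le> x" for x
        unfolding F_def using imT T mult_left_mono_neg[OF that True] by (intro norm_exp_over_square_le; simp)+
    qed (use c in auto)
    also have "\<dots> = 2 * exp (v * c) / T" using T by (simp add: R_def power2_eq_square)
    finally have 1: "norm (integral {-T..T} (\<lambda>t. F (Complex R t)) - integral {-T..T} (\<lambda>t. F (Complex c t))) \<le> 2 * exp (v * c) / T" .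
    have "norm (integral {-T..T} (\<lambda>t. F (Complex R t))) \<le> 2 * T * (exp (v * c) / T\<^sup>2)"
    proof (rule norm_integral_vertical_le[OF contv])
      fix t
      have "norm (Complex R t) \<ge> T" using abs_Re_le_cmod[of "Complex R t"] R c by simp
      then show "norm (F (Complex R t)) \<le> exp (v * c) / T\<^sup>2"
        unfolding F_def using T mult_left_mono_neg[of c R v] True R by (intro norm_exp_over_square_le) auto
    qed (use c R T in auto)
    also have "\<dots> = 2 * exp (v * c) / T" using T by (simp add: power2_eq_square)
    finally have 2: "norm (integral {-T..T} (\<lambda>t. F (Complex R t))) \<le> 2 * exp (v * c) / T" .
    have "norm (integral {-T..T} (\<lambda>t. F (Complex c t))) \<le> 2 * exp (v * c) / T + 2 * exp (v * c) / T"
      using 1 2 norm_triangle_sub[of "integral {-T..T} (\<lambda>t. F (Complex c t))" "integral {-T..T} (\<lambda>t. F (Complex R t))"]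
      by (simp add: norm_minus_commute)
    also have "\<dots> \<le> 6 * exp (v * c) / T" using T by (simp add: field_simps)
    finally show ?thesis using True by (simp add: F_def)
  next
    case False
    define \<gamma> where "\<gamma> = rectpath (Complex (-T) (-T)) (Complex c T)"
    have img: "path_image \<gamma> \<subseteq> UNIV - {0}"
      unfolding \<gamma>_def using c T by (subst path_image_rectpath) auto
    have "contour_integral \<gamma> F = 2 * pi * \<i> * (\<Sum>p\<in>{0}. winding_number \<gamma> p * residue F p)"
      by (rule Residue_theorem[of UNIV]) (use img in \<open>auto simp: \<gamma>_def Compl_eq_Diff_UNIV[symmetric] intro: hol\<close>)
    moreover have "winding_number \<gamma> 0 = 1" unfolding \<gamma>_def
      by (rule winding_number_rectpath) (use c T in \<open>auto simp: in_box_complex_iff\<close>)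
    moreover have "residue F 0 = of_real v"
    proof -
      have "residue F 0 = (deriv ^^ 1) (\<lambda>s. exp (of_real v * s)) 0 / fact 1"
        unfolding F_def by (rule residue_holomorphic_over_power'[of UNIV]) (auto intro!: holomorphic_intros)
      also have "\<dots> = deriv (\<lambda>s. exp (of_real v * s)) 0" by simp
      also have "\<dots> = of_real v"
        by (rule DERIV_imp_deriv) (auto intro!: derivative_eq_intros)
      finally show ?thesis .
    qed
    ultimately have res: "contour_integral \<gamma> F = \<i> * of_real (2 * pi * v)" by simp
    have "norm (contour_integral \<gamma> F - \<i> * (integral {-T..T} (\<lambda>t. F (Complex c t)) - integral {-T..T} (\<lambda>t. F (Complex (-T) t))))
        \<le> 2 * (exp (v * c) / T\<^sup>2) * (c - (-T))"
      unfolding \<gamma>_def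
    proof (rule rectpath_integral_vertical)
      show "continuous_on (path_image (rectpath (Complex (-T) (-T)) (Complex c T))) F"
        using img by (intro continuous_on_subset[OF holomorphic_on_imp_continuous_on[OF hol]]) (auto simp: \<gamma>_def)
      show "norm (F (Complex x T)) \<le> exp (v * c) / T\<^sup>2" "norm (F (Complex x (-T))) \<le> exp (v * c) / T\<^sup>2" if "x \<le> c" for x
        unfolding F_def using imT T mult_left_mono[OF that, of v] False by (intro norm_exp_over_square_le; simp)+
    qed (use c T in auto)
    also have "\<dots> \<le> 2 * (exp (v * c) / T\<^sup>2) * (2 * T)" using c by (intro mult_left_mono) auto
    also have "\<dots> = 4 * exp (v * c) / T" using T by (simp add: power2_eq_square)
    also have "contour_integral \<gamma> F - \<i> * (integral {-T..T} (\<lambda>t. F (Complex c t)) - integral {-T..T} (\<lambda>t. F (Complex (-T) t))) =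
       \<i> * (of_real (2 * pi * v) - (integral {-T..T} (\<lambda>t. F (Complex c t)) - integral {-T..T} (\<lambda>t. F (Complex (-T) t))))"
      unfolding res by (simp add: algebra_simps)
    finally have 1: "norm (of_real (2 * pi * v) - (integral {-T..T} (\<lambda>t. F (Complex c t)) - integral {-T..T} (\<lambda>t. F (Complex (-T) t)))) \<le> 4 * exp (v * c) / T"
      by (simp only: norm_mult norm_ii mult_1)
    have "norm (integral {-T..T} (\<lambda>t. F (Complex (-T) t))) \<le> 2 * T * (exp (v * c) / T\<^sup>2)"
    proof (rule norm_integral_vertical_le[OF contv])
      fix t
      have "norm (Complex (-T) t) \<ge> T" using abs_Re_le_cmod[of "Complex (-T) t"] T by simp
      then show "norm (F (Complex (-T) t)) \<le> exp (v * c) / T\<^sup>2"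
        unfolding F_def using T mult_left_mono[of "-T" c v] False c by (intro norm_exp_over_square_le) auto
    qed (use T in auto)
    also have "\<dots> = 2 * exp (v * c) / T" using T by (simp add: power2_eq_square)
    finally have 2: "norm (integral {-T..T} (\<lambda>t. F (Complex (-T) t))) \<le> 2 * exp (v * c) / T" .
    have tri: "norm (x - p) \<le> A1 + A2" if "norm (p - (x - y)) \<le> A1" "norm y \<le> A2" for x y p :: complex and A1 A2
    proof -
      have "norm (x - p) = norm (y - (p - (x - y)))" by (simp add: algebra_simps)
      also have "\<dots> \<le> norm y + norm (p - (x - y))" by (rule norm_triangle_ineq4)
      finally show ?thesis using that by linarith
    qed
    have "norm (integral {-T..T} (\<lambda>t. F (Complex c t)) - of_real (2 * pi * v)) \<le> 4 * exp (v * c) / T + 2 * exp (v * c) / T"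
      by (rule tri[OF 1 2])
    also have "\<dots> = 6 * exp (v * c) / T" by (simp add: add_divide_distrib[symmetric])
    finally show ?thesis using False by (simp add: F_def)
  qed
qed

section \<open>Perron's formula for sums of the Moebius function\<close>

lemma sum_inverse_squares_le: "(\<Sum>n<P. 1 / (real (Suc n))\<^sup>2) \<le> 2"
proof -
  have *: "(\<Sum>n<Suc P. 1 / (real (Suc n))\<^sup>2) \<le> 2 - 1 / real (Suc P)" for P
  proof (induction P)
    case (Suc P)
    define x where "x = real (Suc P)"
    have x: "x > 0" by (simp add: x_def)
    have "1 / (x + 1)\<^sup>2 \<le> 1 / (x * (x + 1))"
      using x unfolding power2_eq_square by (intro divide_left_mono mult_right_mono) auto
    also have "\<dots> = 1 / x - 1 / (x + 1)" using x by (simp add: field_simps)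
    finally have "1 / (real (Suc (Suc P)))\<^sup>2 \<le> 1 / real (Suc P) - 1 / real (Suc (Suc P))"
      by (simp add: x_def add.commute)
    then show ?case using Suc by (simp del: of_nat_Suc)
  qed simp
  have "(\<Sum>n<P. 1 / (real (Suc n))\<^sup>2) \<le> (\<Sum>n<Suc P. 1 / (real (Suc n))\<^sup>2)" by simp
  also have "\<dots> \<le> 2 - 1 / real (Suc P)" by (rule *)
  also have "\<dots> \<le> 2" by simp
  finally show ?thesis .
qed


text \<open>A Riesz mean: the weight vanishes at the cut-off, so the sum is continuous in
  \<open>y\<close> and the Perron error needs no care for integers near \<open>y\<close>.\<close>

definition weighted_mob_sum :: "real \<Rightarrow> real \<Rightarrow> real" where
  "weighted_mob_sum e y = (\<Sum>m | m \<ge> 1 \<and> real m \<le> y. mob_char e m * ln (y / real m))"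

lemma dterm_cmob_kernel:
  assumes y: "y > 0"
  shows "dterm (cmob e) s n * perron_ker (ln y) s =
     cmob e (Suc n) * perron_ker (ln (y / real (Suc n))) s"
proof -
  have "of_nat (Suc n) powr s = exp (of_real (ln (real (Suc n))) * s)"
    using Ln_of_real[of "real (Suc n)"] by (simp add: powr_def mult.commute del: of_nat_Suc)
  moreover have "ln (y / real (Suc n)) = ln y - ln (real (Suc n))" using y by (simp add: ln_div del: of_nat_Suc)
  ultimately show ?thesis by (simp add: left_diff_distrib exp_diff del: of_nat_Suc)
qed

text \<open>On \<open>Re s = 2\<close> the series converges uniformly and may be integrated term by
  term. The term of \<open>m\<close> has error \<open>6 * (y / m) ^ 2 / T\<close>, and the sum of
  \<open>1 / m ^ 2\<close> is at most 2; terms with \<open>m > y\<close> have main part 0.\<close>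

lemma perron_cmob:
  assumes e: "e\<^sup>2 = 1" and y: "y > 0" and T: "T \<ge> 2"
  shows "norm (integral {-T..T} (\<lambda>t. dirichlet_series (cmob e) (Complex 2 t) * perron_ker (ln y) (Complex 2 t))
           - of_real (2 * pi * weighted_mob_sum e y)) \<le> 12 * y\<^sup>2 / T"
proof -
  define G where "G = (\<lambda>t. perron_ker (ln y) (Complex 2 t))"
  define Ff where "Ff = (\<lambda>P t. (\<Sum>n<P. dterm (cmob e) (Complex 2 t) n) * G t)"
  define D where "D = (\<lambda>t. dirichlet_series (cmob e) (Complex 2 t) * G t)"
  have Gcont: "continuous_on A G" for A unfolding G_def Complex_eq
    by (intro continuous_intros) (auto simp: complex_eq_iff)
  have dcont: "continuous_on A (\<lambda>t. dterm (cmob e) (Complex 2 t) n)" for A n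
    unfolding Complex_eq by (intro continuous_intros) (simp_all del: of_nat_Suc)
  have sm: "summable (\<lambda>n. real (Suc n) powr (- 2))" by (rule summable_Suc_powr) simp
  have dle: "norm (dterm (cmob e) (Complex 2 t) n) \<le> real (Suc n) powr (- 2)" for t n
    unfolding norm_dterm using mult_right_mono[OF norm_cmob_le[OF e, of "Suc n"], of "real (Suc n) powr (- 2)"] by simp
  have ul1: "uniform_limit {-T..T} (\<lambda>P t. \<Sum>n<P. dterm (cmob e) (Complex 2 t) n) (\<lambda>t. dirichlet_series (cmob e) (Complex 2 t)) sequentially"
    unfolding dirichlet_series_def by (rule Weierstrass_m_test[OF dle sm])
  have Gb: "bounded (G ` {-T..T})"
    by (intro compact_imp_bounded compact_continuous_image Gcont compact_Icc)
  have Db: "bounded ((\<lambda>t. dirichlet_series (cmob e) (Complex 2 t)) ` {-T..T})"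
  proof (rule boundedI)
    fix x assume "x \<in> (\<lambda>t. dirichlet_series (cmob e) (Complex 2 t)) ` {-T..T}"
    then obtain t where x: "x = dirichlet_series (cmob e) (Complex 2 t)" by auto
    show "norm x \<le> (\<Sum>n. real (Suc n) powr (- 2))"
      unfolding x dirichlet_series_def by (intro norm_suminf_le sm dle)
  qed
  have ul: "uniform_limit {-T..T} Ff D sequentially"
    unfolding Ff_def D_def by (intro uniform_lim_mult ul1 uniform_limit_const Gb Db)
  have Fcont: "continuous_on {-T..T} (Ff P)" for P
    unfolding Ff_def by (intro continuous_intros dcont Gcont)
  obtain I J where IJ: "\<And>P. (Ff P has_integral I P) {-T..T}" "(D has_integral J) {-T..T}" "I \<longlonglongrightarrow> J"
    by (rule uniform_limit_integral[OF ul Fcont sequentially_bot], rule that)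
  define W where "W = (\<lambda>n. mob_char e (Suc n) * max (ln (y / real (Suc n))) 0)"
  have IP: "norm (I P - of_real (2 * pi * (\<Sum>n<P. W n))) \<le> 12 * y\<^sup>2 / T" for P
  proof -
    define H where "H = (\<lambda>n t. perron_ker (ln (y / real (Suc n))) (Complex 2 t))"
    have Hcont: "continuous_on A (H n)" for A n unfolding H_def Complex_eq
      by (intro continuous_intros) (auto simp: complex_eq_iff)
    have "Ff P = (\<lambda>t. \<Sum>n<P. cmob e (Suc n) * H n t)"
      unfolding Ff_def G_def H_def sum_distrib_right
      by (rule ext, rule sum.cong[OF refl], rule dterm_cmob_kernel[OF y])
    moreover have "((\<lambda>t. \<Sum>n<P. cmob e (Suc n) * H n t) has_integral (\<Sum>n<P. cmob e (Suc n) * integral {-T..T} (H n))) {-T..T}"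
      by (intro has_integral_sum has_integral_mult_right integrable_integral integrable_continuous_interval Hcont) auto
    ultimately have "I P = (\<Sum>n<P. cmob e (Suc n) * integral {-T..T} (H n))"
      using IJ(1)[of P] has_integral_unique by metis
    then have "I P - of_real (2 * pi * (\<Sum>n<P. W n)) =
        (\<Sum>n<P. cmob e (Suc n) * (integral {-T..T} (H n) - of_real (2 * pi * max (ln (y / real (Suc n))) 0)))"
      by (simp add: W_def cmob_def sum_distrib_left right_diff_distrib sum_subtractf mult_ac)
    also have "norm \<dots> \<le> (\<Sum>n<P. 6 * y\<^sup>2 / T * (1 / (real (Suc n))\<^sup>2))"
    proof (rule sum_norm_le)
      fix n
      have "norm (integral {-T..T} (H n) - of_real (2 * pi * max (ln (y / real (Suc n))) 0)) \<le> 6 * exp (ln (y / real (Suc n)) * 2) / T"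
        unfolding H_def by (rule perron_kernel) (use T in auto)
      also have "exp (ln (y / real (Suc n)) * 2) = (y / real (Suc n))\<^sup>2"
      proof -
        have "exp (ln (y / real (Suc n))) = y / real (Suc n)" using y by simp
        then show ?thesis by (simp only: mult_2_right exp_add power2_eq_square)
      qed
      finally have "norm (integral {-T..T} (H n) - of_real (2 * pi * max (ln (y / real (Suc n))) 0)) \<le> 6 * y\<^sup>2 / T * (1 / (real (Suc n))\<^sup>2)"
        by (simp add: power_divide mult_ac)
      then have "norm (cmob e (Suc n)) * norm (integral {-T..T} (H n) - of_real (2 * pi * max (ln (y / real (Suc n))) 0)) \<le> 1 * (6 * y\<^sup>2 / T * (1 / (real (Suc n))\<^sup>2))"
        by (intro mult_mono norm_cmob_le e) auto
      then show "norm (cmob e (Suc n) * (integral {-T..T} (H n) - of_real (2 * pi * max (ln (y / real (Suc n))) 0))) \<le> 6 * y\<^sup>2 / T * (1 / (real (Suc n))\<^sup>2)"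
        by (simp only: norm_mult mult_1)
    qed
    also have "\<dots> = 6 * y\<^sup>2 / T * (\<Sum>n<P. 1 / (real (Suc n))\<^sup>2)" by (rule sum_distrib_left[symmetric])
    also have "\<dots> \<le> 6 * y\<^sup>2 / T * 2" using T by (intro mult_left_mono sum_inverse_squares_le) auto
    finally show ?thesis by simp
  qed
  have W: "(\<Sum>n<P. W n) = weighted_mob_sum e y" if "y \<le> real P" for P
  proof -
    have "(\<Sum>n<P. W n) = (\<Sum>m\<in>Suc ` {..<P}. mob_char e m * max (ln (y / real m)) 0)"
      by (subst sum.reindex) (auto simp: W_def)
    also have "\<dots> = (\<Sum>m | m \<ge> 1 \<and> real m \<le> y. mob_char e m * max (ln (y / real m)) 0)"
    proof (rule sum.mono_neutral_right)
      show "{m. m \<ge> 1 \<and> real m \<le> y} \<subseteq> Suc ` {..<P}"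
      proof
        fix m assume "m \<in> {m. m \<ge> 1 \<and> real m \<le> y}"
        then have "m \<ge> 1" "m \<le> P" using that by auto
        then show "m \<in> Suc ` {..<P}" by (intro image_eqI[of _ _ "m - 1"]) auto
      qed
      show "\<forall>m\<in>Suc ` {..<P} - {m. m \<ge> 1 \<and> real m \<le> y}. mob_char e m * max (ln (y / real m)) 0 = 0"
      proof
        fix m assume m: "m \<in> Suc ` {..<P} - {m. m \<ge> 1 \<and> real m \<le> y}"
        then have "m \<ge> 1" "y < real m" by auto
        then have "ln (y / real m) \<le> 0" using y by (intro ln_le_zero_iff[THEN iffD2]) (auto simp: divide_le_eq_1)
        then show "mob_char e m * max (ln (y / real m)) 0 = 0" by simp
      qed
    qed simp
    also have "\<dots> = weighted_mob_sum e y" unfolding weighted_mob_sum_def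
    proof (rule sum.cong)
      fix m assume "m \<in> {m. m \<ge> 1 \<and> real m \<le> y}"
      then have "0 \<le> ln (y / real m)" by (intro ln_ge_zero) (auto simp: le_divide_eq_1)
      then show "mob_char e m * max (ln (y / real m)) 0 = mob_char e m * ln (y / real m)" by simp
    qed simp
    finally show ?thesis .
  qed
  have "(\<lambda>P. I P - of_real (2 * pi * weighted_mob_sum e y)) \<longlonglongrightarrow> J - of_real (2 * pi * weighted_mob_sum e y)"
    by (intro tendsto_intros IJ(3))
  moreover have "\<forall>\<^sub>F P in sequentially. norm (I P - of_real (2 * pi * weighted_mob_sum e y)) \<le> 12 * y\<^sup>2 / T"
    using eventually_ge_at_top[of "nat \<lceil>y\<rceil>"]
  proof eventually_elim
    case (elim P)
    then have "y \<le> real P" by linarith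
    then show ?case using IP[of P] W by simp
  qed
  ultimately have "norm (J - of_real (2 * pi * weighted_mob_sum e y)) \<le> 12 * y\<^sup>2 / T"
    by (rule Lim_norm_ubound[OF sequentially_bot])
  moreover have "integral {-T..T} D = J" using IJ(2) by (rule integral_unique)
  ultimately show ?thesis by (simp only: D_def G_def)
qed

text \<open>On the horizontal sides \<open>R\<close> is \<open>O(T)\<close> and the kernel at most
  \<open>y ^ 2 / T ^ 2\<close>, so moving the line costs no more than the truncation error already
  present.\<close>

lemma perron_reciprocal:
  assumes GRH: "generalized_riemann_hypothesis" and e: "e\<^sup>2 = 1"
    and R: "R holomorphic_on {s. Re s > 1/2}" "\<And>s. Re s > 1/2 \<Longrightarrow> s \<noteq> 1 \<Longrightarrow> R s = (s - 1) / Qf e s"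
      "\<And>s. Re s > 1 \<Longrightarrow> R s = dirichlet_series (cmob e) s"
    and \<sigma>: "1/2 < \<sigma>" "\<sigma> < 2"
  shows "\<exists>C\<ge>0. \<forall>y T. y \<ge> 1 \<longrightarrow> T \<ge> 2 \<longrightarrow>
    norm (integral {-T..T} (\<lambda>t. R (Complex \<sigma> t) * perron_ker (ln y) (Complex \<sigma> t))
      - of_real (2 * pi * weighted_mob_sum e y)) \<le> C * y\<^sup>2 / T"
proof -
  have "0 < \<sigma> - 1/2" using \<sigma> by simp
  from reciprocal_growth[OF GRH e R(1,2) this zero_less_one] obtain C where C: "C > 0"
    "\<And>s. \<sigma> \<le> Re s \<Longrightarrow> Re s \<le> 2 \<Longrightarrow> norm (R s) \<le> C * (1 + \<bar>Im s\<bar>) powr 1" by auto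
  have "norm (integral {-T..T} (\<lambda>t. R (Complex \<sigma> t) * perron_ker (ln y) (Complex \<sigma> t))
      - of_real (2 * pi * weighted_mob_sum e y)) \<le> (8 * C + 12) * y\<^sup>2 / T" if y: "y \<ge> 1" and T: "T \<ge> 2" for y T
  proof -
    define f where "f = (\<lambda>s. R s * perron_ker (ln y) s)"
    define S where "S = {s. Re s > 1/2}"
    have hol: "f holomorphic_on S"
      unfolding f_def using R(1) by (intro holomorphic_intros) (auto simp: S_def)
    have ey: "exp (ln y * 2) = y\<^sup>2"
      using y by (simp only: mult_2_right exp_add power2_eq_square) simp
    have bd: "norm (f s) \<le> 2 * C * y\<^sup>2 / T" if s: "\<sigma> \<le> Re s" "Re s \<le> 2" "\<bar>Im s\<bar> = T" for s
    proof -
      have "norm (R s) \<le> C * (1 + T)" using C(2)[OF s(1,2)] s(3) T by simp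
      also have "\<dots> \<le> C * (2 * T)" using C(1) T by (intro mult_left_mono) auto
      finally have 1: "norm (R s) \<le> C * (2 * T)" .
      have "ln y * Re s \<le> ln y * 2" using s y by (intro mult_left_mono) auto
      then have 2: "norm (perron_ker (ln y) s) \<le> y\<^sup>2 / T\<^sup>2"
        unfolding ey[symmetric] using abs_Im_le_cmod[of s] s T by (intro norm_exp_over_square_le) auto
      have "norm (f s) \<le> C * (2 * T) * (y\<^sup>2 / T\<^sup>2)"
        unfolding f_def norm_mult[of "R s"] using C(1) T by (intro mult_mono 1 2) auto
      also have "\<dots> = 2 * C * y\<^sup>2 / T" using T by (simp add: power2_eq_square)
      finally show ?thesis .
    qed
    have 1: "norm (integral {-T..T} (\<lambda>t. f (Complex 2 t)) - integral {-T..T} (\<lambda>t. f (Complex \<sigma> t))) \<le> 2 * (2 * C * y\<^sup>2 / T) * (2 - \<sigma>)"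
    proof (rule vertical_shift[OF \<sigma>(2) _ _ hol])
      show "convex S" unfolding S_def by (rule convex_halfspace_Re_gt)
    qed (use \<sigma> T in \<open>auto simp: S_def intro!: bd\<close>)
    also have "\<dots> \<le> 2 * (2 * C * y\<^sup>2 / T) * 2" using \<sigma> C(1) T by (intro mult_left_mono) auto
    finally have 1: "norm (integral {-T..T} (\<lambda>t. f (Complex 2 t)) - integral {-T..T} (\<lambda>t. f (Complex \<sigma> t))) \<le> 8 * C * y\<^sup>2 / T"
      by simp
    have "norm (integral {-T..T} (\<lambda>t. f (Complex 2 t)) - of_real (2 * pi * weighted_mob_sum e y)) \<le> 12 * y\<^sup>2 / T"
      using perron_cmob[OF e, of y T] y T R(3)[of "Complex 2 t" for t] by (simp only: f_def) simp
    then have "norm (integral {-T..T} (\<lambda>t. f (Complex \<sigma> t)) - of_real (2 * pi * weighted_mob_sum e y)) \<le> 8 * C * y\<^sup>2 / T + 12 * y\<^sup>2 / T"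
      using 1 norm_diff_triangle_le norm_minus_commute by metis
    also have "\<dots> = (8 * C + 12) * y\<^sup>2 / T" by (simp add: add_divide_distrib[symmetric] distrib_right)
    finally show ?thesis by (simp only: f_def)
  qed
  then show ?thesis using C(1) by (intro exI[of _ "8 * C + 12"]) auto
qed

definition mob_sum :: "real \<Rightarrow> real \<Rightarrow> real" where
  "mob_sum e y = (\<Sum>m | m \<ge> 1 \<and> real m \<le> y. mob_char e m)"

text \<open>Raising \<open>y\<close> to \<open>y * exp \<delta>\<close> increases the weight of each
  \<open>m \<le> y\<close> by exactly \<delta>. At most one new \<open>m\<close> appears, since the
  new range has length at most 1, and its weight is at most \<delta>.\<close>

lemma weighted_mob_sum_diff:
  assumes e: "e\<^sup>2 = 1" and y: "y \<ge> 1" and \<delta>: "\<delta> > 0" and short: "y * exp \<delta> \<le> y + 1"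
  shows "\<bar>weighted_mob_sum e (y * exp \<delta>) - weighted_mob_sum e y - \<delta> * mob_sum e y\<bar> \<le> \<delta>"
proof -
  define A where "A = {m. m \<ge> 1 \<and> real m \<le> y}"
  define B where "B = {m. y < real m \<and> real m \<le> y * exp \<delta>}"
  have fin: "finite A" "finite B"
  proof -
    have "A \<subseteq> {..nat \<lfloor>y\<rfloor>}" by (auto simp: A_def le_nat_floor)
    then show "finite A" by (rule finite_subset) simp
    have "B \<subseteq> {..nat \<lfloor>y * exp \<delta>\<rfloor>}" by (auto simp: B_def le_nat_floor)
    then show "finite B" by (rule finite_subset) simp
  qed
  have "1 \<le> exp \<delta>" using \<delta> by simp
  then have yle: "y \<le> y * exp \<delta>" using y mult_left_mono[of 1 "exp \<delta>" y] by simp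
  have un: "{m. m \<ge> 1 \<and> real m \<le> y * exp \<delta>} = A \<union> B"
  proof (intro equalityI subsetI)
    fix m assume "m \<in> {m. m \<ge> 1 \<and> real m \<le> y * exp \<delta>}"
    then show "m \<in> A \<union> B" by (auto simp: A_def B_def)
  next
    fix m assume "m \<in> A \<union> B"
    then show "m \<in> {m. m \<ge> 1 \<and> real m \<le> y * exp \<delta>}"
    proof
      assume "m \<in> A"
      then have m: "m \<ge> 1" "real m \<le> y" by (auto simp: A_def)
      then have "real m \<le> y * exp \<delta>" using yle by linarith
      then show ?thesis using m by simp
    next
      assume "m \<in> B"
      then have "real m \<le> y * exp \<delta>" "real m \<ge> 1" using y by (auto simp: B_def)
      then show ?thesis by simp
    qed
  qed
  have disj: "A \<inter> B = {}" by (auto simp: A_def B_def)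
  have "weighted_mob_sum e (y * exp \<delta>) = (\<Sum>m\<in>A. mob_char e m * ln (y * exp \<delta> / real m)) + (\<Sum>m\<in>B. mob_char e m * ln (y * exp \<delta> / real m))"
    unfolding weighted_mob_sum_def un by (rule sum.union_disjoint[OF fin disj])
  also have "(\<Sum>m\<in>A. mob_char e m * ln (y * exp \<delta> / real m)) = (\<Sum>m\<in>A. mob_char e m * ln (y / real m) + \<delta> * mob_char e m)"
  proof (rule sum.cong)
    fix m assume "m \<in> A"
    then have "ln (y * exp \<delta> / real m) = ln (y / real m) + \<delta>"
      using y by (auto simp: A_def ln_div ln_mult)
    then show "mob_char e m * ln (y * exp \<delta> / real m) = mob_char e m * ln (y / real m) + \<delta> * mob_char e m"
      by (simp add: algebra_simps)
  qed simp
  also have "\<dots> = weighted_mob_sum e y + \<delta> * mob_sum e y"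
    by (simp add: sum.distrib sum_distrib_left weighted_mob_sum_def mob_sum_def A_def)
  finally have eq: "weighted_mob_sum e (y * exp \<delta>) - weighted_mob_sum e y - \<delta> * mob_sum e y = (\<Sum>m\<in>B. mob_char e m * ln (y * exp \<delta> / real m))"
    by simp
  have "\<bar>\<Sum>m\<in>B. mob_char e m * ln (y * exp \<delta> / real m)\<bar> \<le> (\<Sum>m\<in>B. \<delta>)"
  proof (rule order.trans[OF sum_abs sum_mono])
    fix m assume m: "m \<in> B"
    have mp: "real m > 0" using m y by (simp add: B_def)
    have "1 \<le> y * exp \<delta> / real m" using m mp by (simp add: B_def le_divide_eq_1)
    then have 1: "0 \<le> ln (y * exp \<delta> / real m)" by (rule ln_ge_zero)
    have "y * exp \<delta> / real m \<le> exp \<delta>" using m mp by (simp add: B_def divide_le_eq mult.commute)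
    then have "ln (y * exp \<delta> / real m) \<le> ln (exp \<delta>)" using mp y by (intro ln_mono) auto
    then have 2: "ln (y * exp \<delta> / real m) \<le> \<delta>" by simp
    have "\<bar>mob_char e m\<bar> * \<bar>ln (y * exp \<delta> / real m)\<bar> \<le> 1 * \<delta>"
      using 1 2 by (intro mult_mono abs_mob_char_le e) auto
    then show "\<bar>mob_char e m * ln (y * exp \<delta> / real m)\<bar> \<le> \<delta>" by (simp add: abs_mult)
  qed
  also have "\<dots> = \<delta> * real (card B)" by simp
  also have "\<dots> \<le> \<delta> * 1"
  proof (rule mult_left_mono)
    have "B \<subseteq> {nat \<lfloor>y + 1\<rfloor>}"
    proof
      fix m assume "m \<in> B"
      then have "y < real m" "real m \<le> y + 1" using short by (auto simp: B_def)
      then show "m \<in> {nat \<lfloor>y + 1\<rfloor>}" by simp linarith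
    qed
    then have "card B \<le> card {nat \<lfloor>y + 1\<rfloor>}" by (intro card_mono) auto
    then show "real (card B) \<le> 1" by simp
  qed (use \<delta> in simp)
  finally show ?thesis unfolding eq by simp
qed

text \<open>The formula for logarithmic weights at \<open>y * exp \<delta>\<close> and at
  \<open>y\<close>, subtracted and divided by \<delta>. The possible extra term gives the
  \<open>2 * pi\<close>; the truncation errors grow by \<open>1 / \<delta>\<close>, which a large
  \<open>T\<close> absorbs.\<close>

lemma mob_sum_integral:
  assumes GRH: "generalized_riemann_hypothesis" and e: "e\<^sup>2 = 1"
    and R: "R holomorphic_on {s. Re s > 1/2}" "\<And>s. Re s > 1/2 \<Longrightarrow> s \<noteq> 1 \<Longrightarrow> R s = (s - 1) / Qf e s"
      "\<And>s. Re s > 1 \<Longrightarrow> R s = dirichlet_series (cmob e) s"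
    and \<sigma>: "1/2 < \<sigma>" "\<sigma> < 2"
  shows "\<exists>C\<ge>0. \<forall>y T \<delta>. y \<ge> 1 \<longrightarrow> T \<ge> 2 \<longrightarrow> \<delta> > 0 \<longrightarrow> y * exp \<delta> \<le> y + 1 \<longrightarrow>
    norm (of_real (2 * pi * mob_sum e y) -
       integral {-T..T} (\<lambda>t. R (Complex \<sigma> t) * exp (of_real (ln y) * Complex \<sigma> t) *
          smooth_ker \<delta> (Complex \<sigma> t))) \<le> 2 * pi + C * (y + 1)\<^sup>2 / (T * \<delta>)"
proof -
  from perron_reciprocal[OF GRH e R \<sigma>] obtain C where C: "C \<ge> 0"
    "\<And>y T. y \<ge> 1 \<Longrightarrow> T \<ge> 2 \<Longrightarrow> norm (integral {-T..T} (\<lambda>t. R (Complex \<sigma> t) * perron_ker (ln y) (Complex \<sigma> t))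
      - of_real (2 * pi * weighted_mob_sum e y)) \<le> C * y\<^sup>2 / T" by blast
  have "norm (of_real (2 * pi * mob_sum e y) -
       integral {-T..T} (\<lambda>t. R (Complex \<sigma> t) * exp (of_real (ln y) * Complex \<sigma> t) *
          smooth_ker \<delta> (Complex \<sigma> t))) \<le> 2 * pi + 2 * C * (y + 1)\<^sup>2 / (T * \<delta>)"
    if y: "y \<ge> 1" and T: "T \<ge> 2" and \<delta>: "\<delta> > 0" and short: "y * exp \<delta> \<le> y + 1" for y T \<delta>
  proof -
    define J where "J = (\<lambda>y. integral {-T..T} (\<lambda>t. R (Complex \<sigma> t) * perron_ker (ln y) (Complex \<sigma> t)))"
    define w where "w = (\<lambda>y. 2 * pi * weighted_mob_sum e y)"
    have int: "(\<lambda>t. R (Complex \<sigma> t) * perron_ker (ln y) (Complex \<sigma> t)) integrable_on {-T..T}" for y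
    proof (rule integrable_continuous_interval)
      have "continuous_on {-T..T} (\<lambda>t. R (Complex \<sigma> t))"
        using \<sigma> by (intro continuous_on_compose2[OF holomorphic_on_imp_continuous_on[OF R(1)]]) (auto simp: Complex_eq intro!: continuous_intros)
      then show "continuous_on {-T..T} (\<lambda>t. R (Complex \<sigma> t) * perron_ker (ln y) (Complex \<sigma> t))"
        using \<sigma> by (intro continuous_intros) (auto simp: Complex_eq complex_eq_iff intro!: continuous_intros)
    qed
    have ye: "1 \<le> y * exp \<delta>" using mult_mono[of 1 y 1 "exp \<delta>"] y \<delta> by simp
    have lny: "ln (y * exp \<delta>) = ln y + \<delta>" using y by (simp add: ln_mult)
    have "R (Complex \<sigma> t) * exp (of_real (ln y) * Complex \<sigma> t) *
          smooth_ker \<delta> (Complex \<sigma> t) =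
       (R (Complex \<sigma> t) * perron_ker (ln (y * exp \<delta>)) (Complex \<sigma> t)
         - R (Complex \<sigma> t) * perron_ker (ln y) (Complex \<sigma> t)) / of_real \<delta>" for t
    proof -
      have "Complex \<sigma> t \<noteq> 0" using \<sigma> by (auto simp: complex_eq_iff)
      then show ?thesis unfolding lny using \<delta> by (simp add: distrib_right exp_add field_simps)
    qed
    then have I: "integral {-T..T} (\<lambda>t. R (Complex \<sigma> t) * exp (of_real (ln y) * Complex \<sigma> t) *
          smooth_ker \<delta> (Complex \<sigma> t)) = (J (y * exp \<delta>) - J y) / of_real \<delta>"
      unfolding J_def by (simp only: integral_divide integral_diff[OF int int])
    have a: "norm (J (y * exp \<delta>) - of_real (w (y * exp \<delta>))) \<le> C * (y + 1)\<^sup>2 / T"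
    proof -
      have "norm (J (y * exp \<delta>) - of_real (w (y * exp \<delta>))) \<le> C * (y * exp \<delta>)\<^sup>2 / T"
        unfolding J_def w_def by (rule C(2)[OF ye T])
      also have "\<dots> \<le> C * (y + 1)\<^sup>2 / T"
        using C(1) short ye T by (intro divide_right_mono mult_left_mono power_mono) auto
      finally show ?thesis .
    qed
    have b: "norm (J y - of_real (w y)) \<le> C * (y + 1)\<^sup>2 / T"
    proof -
      have "norm (J y - of_real (w y)) \<le> C * y\<^sup>2 / T"
        unfolding J_def w_def by (rule C(2)[OF y T])
      also have "\<dots> \<le> C * (y + 1)\<^sup>2 / T"
        using C(1) y T by (intro divide_right_mono mult_left_mono power_mono) auto
      finally show ?thesis .
    qed
    have "\<bar>w (y * exp \<delta>) - w y - \<delta> * (2 * pi * mob_sum e y)\<bar> = 2 * pi * \<bar>weighted_mob_sum e (y * exp \<delta>) - weighted_mob_sum e y - \<delta> * mob_sum e y\<bar>"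
    proof -
      have "w (y * exp \<delta>) - w y - \<delta> * (2 * pi * mob_sum e y) = 2 * pi * (weighted_mob_sum e (y * exp \<delta>) - weighted_mob_sum e y - \<delta> * mob_sum e y)"
        by (simp add: w_def algebra_simps)
      then show ?thesis by (simp add: abs_mult)
    qed
    also have "\<dots> \<le> 2 * pi * \<delta>"
      by (intro mult_left_mono weighted_mob_sum_diff[OF e y \<delta> short]) simp
    finally have c: "norm (of_real (w (y * exp \<delta>) - w y - \<delta> * (2 * pi * mob_sum e y)) :: complex) \<le> 2 * pi * \<delta>"
      by (simp only: norm_of_real)
    have "of_real \<delta> * (of_real (2 * pi * mob_sum e y) - (J (y * exp \<delta>) - J y) / of_real \<delta>) =
       - of_real (w (y * exp \<delta>) - w y - \<delta> * (2 * pi * mob_sum e y)) - (J (y * exp \<delta>) - of_real (w (y * exp \<delta>))) + (J y - of_real (w y))"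
    proof -
      have "of_real \<delta> * ((J (y * exp \<delta>) - J y) / of_real \<delta>) = J (y * exp \<delta>) - J y" using \<delta> by simp
      then show ?thesis unfolding right_diff_distrib by (simp add: algebra_simps)
    qed
    also have "norm \<dots> \<le> (2 * pi * \<delta> + C * (y + 1)\<^sup>2 / T) + C * (y + 1)\<^sup>2 / T"
      by (intro norm_triangle_mono[OF order.trans[OF norm_triangle_ineq4 add_mono] b] a)
         (simp only: norm_minus_cancel c)
    finally have "\<delta> * norm (of_real (2 * pi * mob_sum e y) - (J (y * exp \<delta>) - J y) / of_real \<delta>) \<le> 2 * pi * \<delta> + 2 * C * (y + 1)\<^sup>2 / T"
      using \<delta> by (simp add: norm_mult)
    then have "norm (of_real (2 * pi * mob_sum e y) - (J (y * exp \<delta>) - J y) / of_real \<delta>) \<le> (2 * pi * \<delta> + 2 * C * (y + 1)\<^sup>2 / T) / \<delta>"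
      using \<delta> by (simp only: pos_le_divide_eq) (simp add: mult.commute)
    also have "\<dots> = 2 * pi + 2 * C * (y + 1)\<^sup>2 / (T * \<delta>)"
      using \<delta> by (simp add: add_divide_distrib)
    finally show ?thesis unfolding I .
  qed
  then show ?thesis using C(1) by (intro exI[of _ "2 * C"]) auto
qed


section \<open>Bounding the contour integral\<close>

lemma char_poly_cnj: "char_poly N (cnj w) = cnj (char_poly N w)"
  by (simp add: char_poly_def exp_cnj)

text \<open>The bound is uniform in \<delta>, so \<delta> may be taken very small at no cost.
  Factoring out \<open>exp (\<delta> s)\<close>, of norm at most 3, leaves exponentials in the left
  half-plane, where \<open>exp\<close> is 1-Lipschitz.\<close>

lemma norm_kernel_le:
  assumes \<delta>: "0 < \<delta>" "\<delta> \<le> 1/2" and \<sigma>: "1/2 \<le> \<sigma>" "\<sigma> \<le> 1"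
  shows "norm (smooth_ker \<delta> (Complex \<sigma> t)) \<le> 9 / (1 + \<bar>t\<bar>)"
proof -
  define s where "s = Complex \<sigma> t"
  have s: "norm s \<ge> 1/2" "norm s \<ge> \<bar>t\<bar>"
    using abs_Re_le_cmod[of s] abs_Im_le_cmod[of s] \<sigma> by (auto simp: s_def)
  have "exp (of_real \<delta> * s) - 1 = exp (of_real \<delta> * s) * (exp 0 - exp (- of_real \<delta> * s))"
    by (simp add: right_diff_distrib flip: exp_add)
  then have "norm (exp (of_real \<delta> * s) - 1) = exp (\<delta> * \<sigma>) * norm (exp 0 - exp (- of_real \<delta> * s))"
    by (simp add: norm_mult s_def)
  also have "\<dots> \<le> 3 * norm (0 - (- of_real \<delta> * s))"
  proof (intro mult_mono norm_exp_diff_le)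
    have "\<delta> * \<sigma> \<le> 1" using mult_mono[of \<delta> 1 \<sigma> 1] \<delta> \<sigma> by simp
    then have "exp (\<delta> * \<sigma>) \<le> exp 1" by simp
    then show "exp (\<delta> * \<sigma>) \<le> 3" using exp_le by linarith
  qed (use \<delta> \<sigma> in \<open>auto simp: s_def\<close>)
  also have "\<dots> = 3 * \<delta> * norm s" using \<delta> by (simp add: norm_mult)
  finally have 1: "norm (exp (of_real \<delta> * s) - 1) \<le> 3 * \<delta> * norm s" .
  have s0: "norm s > 0" using s by linarith
  have "norm (smooth_ker \<delta> s) = norm (exp (of_real \<delta> * s) - 1) / (\<delta> * (norm s * norm s))"
    using \<delta> by (simp add: norm_divide norm_mult)
  also have "\<dots> \<le> 3 * \<delta> * norm s / (\<delta> * (norm s * norm s))"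
    using 1 \<delta> s0 by (intro divide_right_mono) auto
  also have "\<dots> = 3 / norm s" using \<delta> s0 by simp
  also have "\<dots> \<le> 9 / (1 + \<bar>t\<bar>)"
  proof -
    have "1 + \<bar>t\<bar> > 0" "1 + \<bar>t\<bar> \<le> 3 * norm s" using s by linarith+
    then show ?thesis using s0 by (simp add: pos_divide_le_eq pos_le_divide_eq)
  qed
  finally show ?thesis by (simp add: s_def)
qed

lemma integral_even:
  fixes g :: "real \<Rightarrow> real"
  assumes g: "continuous_on {-T..T} g" and T: "T \<ge> 0" and even: "\<And>t. g (-t) = g t"
  shows "integral {-T..T} g = 2 * integral {0..T} g"
proof -
  have "integral {-T..T} g = integral {-T..0} g + integral {0..T} g"
    using T by (intro Henstock_Kurzweil_Integration.integral_combine[symmetric] integrable_continuous_interval g) auto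
  also have "integral {-T..0} g = integral {0..T} g"
    using Henstock_Kurzweil_Integration.integral_reflect_real[of T 0 g] even by simp
  finally show ?thesis by simp
qed

text \<open>After \<open>R\<close>, the exponential and the kernel are estimated pointwise, the
  integral of \<open>norm D / (1 + \<bar>t\<bar>)\<close> remains, and it is even because \<chi> is
  real. The constant is 2 for the two halves, times 9 from the kernel, times \<open>10 * k\<close>
  from the mean value with \<open>\<kappa> = 1 / k\<close>.\<close>

lemma smoothed_integral_le:
  assumes k: "k \<ge> 2" and \<sigma>: "1/2 \<le> \<sigma>" "\<sigma> \<le> 1" and N: "N \<ge> 1" and T: "T \<ge> 0" and \<delta>: "0 < \<delta>" "\<delta> \<le> 1/2"
    and Rc: "continuous_on {-T..T} (\<lambda>t. R (Complex \<sigma> t))" and M: "M \<ge> 0" "\<And>t. t \<in> {-T..T} \<Longrightarrow> norm (R (Complex \<sigma> t)) \<le> M"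
  shows "norm (integral {-T..T} (\<lambda>t. R (Complex \<sigma> t) * exp (of_real u * Complex \<sigma> t) *
          smooth_ker \<delta> (Complex \<sigma> t) * char_poly N (Complex \<sigma> t / of_nat k)))
      \<le> 180 * real k * M * exp (u * \<sigma>) * (real N powr (1/2 - \<sigma> / real k) * (1 + ln (real N))) * (1 + ln (1 + T))"
proof -
  define \<kappa> where "\<kappa> = 1 / real k"
  define \<sigma>k where "\<sigma>k = \<sigma> / real k"
  have \<kappa>: "0 < \<kappa>" "\<kappa> \<le> 1" using k by (auto simp: \<kappa>_def)
  have \<sigma>k: "0 \<le> \<sigma>k" "\<sigma>k \<le> 1/2"
  proof -
    show "0 \<le> \<sigma>k" using \<sigma> by (simp add: \<sigma>k_def)
    have "\<sigma> / real k \<le> 1 / 2" using \<sigma> k by (intro frac_le) auto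
    then show "\<sigma>k \<le> 1/2" by (simp add: \<sigma>k_def)
  qed
  have ck: "Complex \<sigma> t / of_nat k = Complex \<sigma>k (\<kappa> * t)" for t
    by (simp add: complex_eq_iff \<sigma>k_def \<kappa>_def)
  define h where "h = (\<lambda>t. norm (char_poly N (Complex \<sigma>k (\<kappa> * t))))"
  define B where "B = real N powr (1/2 - \<sigma>k) * (1 + ln (real N))"
  have B0: "B \<ge> 0" using N by (simp add: B_def)
  have hc: "continuous_on A h" for A
    unfolding h_def Complex_eq by (intro continuous_intros)
  define A where "A = 9 * M * exp (u * \<sigma>)"
  have A0: "A \<ge> 0" using M by (simp add: A_def)
  define F where "F = (\<lambda>t. R (Complex \<sigma> t) * exp (of_real u * Complex \<sigma> t) *
          smooth_ker \<delta> (Complex \<sigma> t) * char_poly N (Complex \<sigma> t / of_nat k))"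
  have Fc: "continuous_on {-T..T} F"
  proof -
    have c: "continuous_on {-T..T} (\<lambda>t. Complex \<sigma> t)" unfolding Complex_eq by (intro continuous_intros)
    show ?thesis unfolding F_def
      by (intro continuous_intros Rc c) (use \<delta> \<sigma> k in \<open>auto simp: complex_eq_iff\<close>)
  qed
  have gc: "continuous_on A' (\<lambda>t. A * (h t / (1 + \<bar>t\<bar>)))" for A'
    by (intro continuous_intros hc) (auto simp: add_nonneg_eq_0_iff)
  have "norm (F t) \<le> A * (h t / (1 + \<bar>t\<bar>))" if t: "t \<in> {-T..T}" for t
  proof -
    have "norm (F t) \<le> M * exp (u * \<sigma>) * (9 / (1 + \<bar>t\<bar>)) * h t"
      unfolding F_def ck norm_mult h_def
      by (intro mult_mono M(2) t norm_kernel_le[unfolded norm_divide, OF \<delta> \<sigma>] norm_kernel_le[OF \<delta> \<sigma>]) (auto simp: M(1))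
    also have "\<dots> = A * (h t / (1 + \<bar>t\<bar>))" by (simp add: A_def)
    finally show ?thesis .
  qed
  then have "norm (integral {-T..T} F) \<le> integral {-T..T} (\<lambda>t. A * (h t / (1 + \<bar>t\<bar>)))"
    by (intro integral_norm_bound_integral integrable_continuous_interval Fc gc)
  also have "\<dots> = 2 * integral {0..T} (\<lambda>t. A * (h t / (1 + \<bar>t\<bar>)))"
  proof (rule integral_even[OF gc T])
    fix t
    have "Complex \<sigma>k (\<kappa> * - t) = cnj (Complex \<sigma>k (\<kappa> * t))" by (simp add: complex_eq_iff)
    then have "h (- t) = h t" by (simp only: h_def char_poly_cnj complex_mod_cnj)
    then show "A * (h (- t) / (1 + \<bar>- t\<bar>)) = A * (h t / (1 + \<bar>t\<bar>))" by simp
  qed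
  also have "integral {0..T} (\<lambda>t. A * (h t / (1 + \<bar>t\<bar>))) = A * integral {0..T} (\<lambda>t. h t / (1 + t))"
  proof -
    have "integral {0..T} (\<lambda>t. A * (h t / (1 + \<bar>t\<bar>))) = integral {0..T} (\<lambda>t. A * (h t / (1 + t)))"
      by (rule integral_cong) simp
    then show ?thesis by (simp only: Henstock_Kurzweil_Integration.integral_mult_right)
  qed
  also have "integral {0..T} (\<lambda>t. h t / (1 + t)) \<le> (10 / \<kappa> * B) * (1 + ln (1 + T))"
  proof (rule integral_weighted_le[OF hc T])
    show "integral {0..U} h \<le> 10 / \<kappa> * B * (1 + U)" if "U \<in> {0..T}" for U
      using integral_char_poly_le[OF N \<sigma>k \<kappa>, of U] that
      by (simp only: h_def B_def mult.commute mult.left_commute mult.assoc) simp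
  qed (use \<kappa> B0 in auto)
  then have "2 * (A * integral {0..T} (\<lambda>t. h t / (1 + t))) \<le> 2 * (A * ((10 / \<kappa> * B) * (1 + ln (1 + T))))"
    using A0 by (intro mult_left_mono) auto
  finally show ?thesis by (simp add: F_def A_def \<kappa>_def B_def \<sigma>k_def mult_ac)
qed

subsection \<open>The main estimate\<close>

lemma le_powr_inverse_iff:
  assumes "k > 0" "a > 0"
  shows "real m \<le> a powr (1 / real k) \<longleftrightarrow> real m ^ k \<le> a"
proof -
  have "(a powr (1 / real k)) ^ k = a"
    using assms by (simp add: powr_powr flip: powr_realpow)
  then show ?thesis
    using power_mono_iff[of "real m" "a powr (1 / real k)" k] assms by simp
qed

text \<open>The inner condition is \<open>m \<le> y d\<close> with
  \<open>y d = (X / d) powr (1 / k)\<close>. In the contour integral \<open>y d\<close> to the power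
  \<open>s\<close> separates into a factor in \<open>X\<close> and one in \<open>d\<close>, so the
  weighted integrals for all \<open>d\<close> add up to a single one containing
  \<open>char_poly N (s / k)\<close>.\<close>

lemma sum_char_mob_bound:
  assumes GRH: "generalized_riemann_hypothesis" and k: "k \<ge> 2" and \<eta>: "0 < \<eta>" "\<eta> \<le> 1/2" and \<epsilon>: "\<epsilon> > 0"
    and e: "e\<^sup>2 = 1"
  defines "\<sigma> \<equiv> 1/2 + \<eta>"
  shows "\<exists>C\<ge>0. \<forall>X N. N \<ge> 1 \<longrightarrow> N \<le> X \<longrightarrow>
    \<bar>\<Sum>d\<in>{1..N}. char4 (-1) d * (\<Sum>m | m \<ge> 1 \<and> m ^ k * d \<le> X. mob_char e m)\<bar> \<le>
      C * (real N + (1 + 2 * real X ^ 3) powr \<epsilon> * real X powr (\<sigma> / real k) *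
         (real N powr (1/2 - \<sigma> / real k) * (1 + ln (real N))) * (1 + ln (1 + 2 * real X ^ 3)))"
proof -
  from reciprocal_exists[OF GRH e] obtain R where R: "R holomorphic_on {s. Re s > 1/2}"
      "\<And>s. Re s > 1/2 \<Longrightarrow> s \<noteq> 1 \<Longrightarrow> R s = (s - 1) / Qf e s"
      "\<And>s. Re s > 1 \<Longrightarrow> R s = dirichlet_series (cmob e) s" by blast
  have \<sigma>: "1/2 < \<sigma>" "\<sigma> < 2" "1/2 \<le> \<sigma>" "\<sigma> \<le> 1" using \<eta> by (auto simp: \<sigma>_def)
  from reciprocal_growth[OF GRH e R(1,2) \<eta>(1) \<epsilon>] obtain C1 where C1: "C1 > 0"
    "\<And>s. \<sigma> \<le> Re s \<Longrightarrow> Re s \<le> 2 \<Longrightarrow> norm (R s) \<le> C1 * (1 + \<bar>Im s\<bar>) powr \<epsilon>" unfolding \<sigma>_def by blast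
  from mob_sum_integral[OF GRH e R \<sigma>(1,2)] obtain C2 where C2: "C2 \<ge> 0"
    "\<And>y T \<delta>. y \<ge> 1 \<Longrightarrow> T \<ge> 2 \<Longrightarrow> \<delta> > 0 \<Longrightarrow> y * exp \<delta> \<le> y + 1 \<Longrightarrow>
    norm (of_real (2 * pi * mob_sum e y) -
       integral {-T..T} (\<lambda>t. R (Complex \<sigma> t) * exp (of_real (ln y) * Complex \<sigma> t) *
          smooth_ker \<delta> (Complex \<sigma> t))) \<le> 2 * pi + C2 * (y + 1)\<^sup>2 / (T * \<delta>)" by blast
  define C where "C = 2 * pi + 4 * C2 + 180 * real k * C1"
  have C0: "C \<ge> 0" using C1(1) C2(1) by (simp add: C_def)
  have "\<bar>\<Sum>d\<in>{1..N}. char4 (-1) d * (\<Sum>m | m \<ge> 1 \<and> m ^ k * d \<le> X. mob_char e m)\<bar> \<le>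
      C * (real N + (1 + 2 * real X ^ 3) powr \<epsilon> * real X powr (\<sigma> / real k) *
         (real N powr (1/2 - \<sigma> / real k) * (1 + ln (real N))) * (1 + ln (1 + 2 * real X ^ 3)))"
    if N: "N \<ge> 1" "N \<le> X" for X N
  proof -
    \<comment> \<open>With these values \<open>T * \<delta> = X ^ 2\<close>, so each
      \<open>d\<close> carries an error \<open>O(1)\<close> and all together \<open>O(N)\<close>. As
      \<open>y d \<le> X\<close>, the choice \<open>\<delta> = 1 / (2 * X)\<close> also keeps
      \<open>y d * exp \<delta>\<close> below \<open>y d + 1\<close>.\<close>
    define T where "T = 2 * real X ^ 3"
    define \<delta> where "\<delta> = 1 / (2 * real X)"
    define u where "u = ln (real X) / real k"
    have X: "real X \<ge> 1" using N by simp
    have T: "T \<ge> 2" using X by (simp add: T_def)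
    have \<delta>: "0 < \<delta>" "\<delta> \<le> 1/2" using X by (auto simp: \<delta>_def)
    define y where "y = (\<lambda>d. (real X / real d) powr (1 / real k))"
    define \<kappa> where "\<kappa> = (\<lambda>t. smooth_ker \<delta> (Complex \<sigma> t))"
    define f where "f = (\<lambda>d t. R (Complex \<sigma> t) * exp (of_real (ln (y d)) * Complex \<sigma> t) * \<kappa> t)"
    have Rc: "continuous_on {-T..T} (\<lambda>t. R (Complex \<sigma> t))"
      using \<sigma> by (intro continuous_on_compose2[OF holomorphic_on_imp_continuous_on[OF R(1)]]) (auto simp: Complex_eq intro!: continuous_intros)
    have fc: "f d integrable_on {-T..T}" for d
    proof (rule integrable_continuous_interval)
      have c: "continuous_on {-T..T} (\<lambda>t. Complex \<sigma> t)" unfolding Complex_eq by (intro continuous_intros)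
      show "continuous_on {-T..T} (f d)" unfolding f_def \<kappa>_def
        by (intro continuous_intros Rc c) (use \<delta> \<sigma> in \<open>auto simp: complex_eq_iff\<close>)
    qed
    have yd: "norm (of_real (2 * pi * mob_sum e (y d)) - integral {-T..T} (f d)) \<le> 2 * pi + 4 * C2" if d: "d \<in> {1..N}" for d
    proof -
      have q: "1 \<le> real X / real d" "real X / real d \<le> real X"
        using d N by (auto simp: le_divide_eq_1 divide_le_eq mult_le_cancel_left1)
      have y1: "1 \<le> y d" unfolding y_def using q k by (intro ge_one_powr_ge_zero) auto
      have "y d \<le> (real X / real d) powr 1" unfolding y_def using q k by (intro powr_mono) auto
      then have yX: "y d \<le> real X" using q by simp
      have "exp \<delta> \<le> 1 + \<delta> + \<delta>\<^sup>2" using \<delta> by (intro exp_bound) auto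
      moreover have "\<delta>\<^sup>2 \<le> \<delta>" using mult_left_mono[of \<delta> 1 \<delta>] \<delta> by (simp add: power2_eq_square)
      ultimately have "exp \<delta> \<le> 1 + 2 * \<delta>" by linarith
      then have "y d * exp \<delta> \<le> y d * (1 + 2 * \<delta>)" using y1 by (intro mult_left_mono) auto
      also have "\<dots> = y d + y d / real X" by (simp add: \<delta>_def distrib_left)
      also have "\<dots> \<le> y d + 1" using yX X by (simp add: divide_le_eq_1)
      finally have short: "y d * exp \<delta> \<le> y d + 1" .
      have "norm (of_real (2 * pi * mob_sum e (y d)) - integral {-T..T} (f d)) \<le> 2 * pi + C2 * (y d + 1)\<^sup>2 / (T * \<delta>)"
        unfolding f_def \<kappa>_def by (rule C2(2)[OF y1 T \<delta>(1) short])
      also have "C2 * (y d + 1)\<^sup>2 / (T * \<delta>) \<le> C2 * (2 * real X)\<^sup>2 / (T * \<delta>)"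
        using C2(1) yX y1 X T \<delta> by (intro divide_right_mono mult_left_mono power_mono) auto
      also have "T * \<delta> = real X ^ 2" using X by (simp add: T_def \<delta>_def power3_eq_cube power2_eq_square)
      also have "C2 * (2 * real X)\<^sup>2 / real X ^ 2 = 4 * C2" using X by (simp add: power_mult_distrib)
      finally show ?thesis by simp
    qed
    define S where "S = (\<Sum>d\<in>{1..N}. char4 (-1) d * mob_sum e (y d))"
    have S_eq: "(\<Sum>d\<in>{1..N}. char4 (-1) d * (\<Sum>m | m \<ge> 1 \<and> m ^ k * d \<le> X. mob_char e m)) = S"
      unfolding S_def
    proof (rule sum.cong)
      fix d assume d: "d \<in> {1..N}"
      have "m ^ k * d \<le> X \<longleftrightarrow> real m \<le> y d" for m
      proof -
        have "real m \<le> y d \<longleftrightarrow> real m ^ k \<le> real X / real d"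
          unfolding y_def using k d N by (intro le_powr_inverse_iff) auto
        also have "\<dots> \<longleftrightarrow> real (m ^ k * d) \<le> real X" using d by (simp add: le_divide_eq)
        finally show ?thesis by (simp only: of_nat_le_iff)
      qed
      then show "char4 (-1) d * (\<Sum>m | m \<ge> 1 \<and> m ^ k * d \<le> X. mob_char e m) = char4 (-1) d * mob_sum e (y d)"
        by (simp add: mob_sum_def)
    qed simp
    have G: "(\<Sum>d\<in>{1..N}. of_real (char4 (-1) d) * integral {-T..T} (f d)) =
       integral {-T..T} (\<lambda>t. R (Complex \<sigma> t) * exp (of_real u * Complex \<sigma> t) * \<kappa> t * char_poly N (Complex \<sigma> t / of_nat k))"
    proof -
      have "((\<lambda>t. \<Sum>d\<in>{1..N}. of_real (char4 (-1) d) * f d t) has_integral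
          (\<Sum>d\<in>{1..N}. of_real (char4 (-1) d) * integral {-T..T} (f d))) {-T..T}"
        by (intro has_integral_sum has_integral_mult_right integrable_integral fc) auto
      moreover have "(\<Sum>d\<in>{1..N}. of_real (char4 (-1) d) * f d t) =
         R (Complex \<sigma> t) * exp (of_real u * Complex \<sigma> t) * \<kappa> t * char_poly N (Complex \<sigma> t / of_nat k)" for t
        unfolding char_poly_def sum_distrib_left
      proof (rule sum.cong)
        fix d assume d: "d \<in> {1..N}"
        \<comment> \<open>The separation of \<open>X\<close> and \<open>d\<close>.\<close>
        have "ln (y d) = u - ln (real d) / real k"
          unfolding y_def u_def using d N k X by (simp add: ln_powr ln_div diff_divide_distrib)
        then have "of_real (ln (y d)) * Complex \<sigma> t = of_real u * Complex \<sigma> t + - (Complex \<sigma> t / of_nat k) * of_real (ln (real d))"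
          using k by (simp add: left_diff_distrib)
        then have "exp (of_real (ln (y d)) * Complex \<sigma> t) = exp (of_real u * Complex \<sigma> t) * exp (- (Complex \<sigma> t / of_nat k) * of_real (ln (real d)))"
          by (simp only: exp_add)
        then show "of_real (char4 (-1) d) * f d t = R (Complex \<sigma> t) * exp (of_real u * Complex \<sigma> t) * \<kappa> t *
            (of_real (char4 (-1) d) * exp (- (Complex \<sigma> t / of_nat k) * of_real (ln (real d))))"
          by (simp only: f_def mult_ac)
      qed simp
      ultimately show ?thesis by (simp only: integral_unique)
    qed
    define Q where "Q = real N powr (1/2 - \<sigma> / real k) * (1 + ln (real N))"
    have "norm (integral {-T..T} (\<lambda>t. R (Complex \<sigma> t) * exp (of_real u * Complex \<sigma> t) * \<kappa> t * char_poly N (Complex \<sigma> t / of_nat k)))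
       \<le> 180 * real k * (C1 * (1 + T) powr \<epsilon>) * exp (u * \<sigma>) * Q * (1 + ln (1 + T))"
      unfolding \<kappa>_def Q_def
    proof (rule smoothed_integral_le[OF k \<sigma>(3,4) N(1) _ \<delta> Rc])
      fix t assume t: "t \<in> {-T..T}"
      have "norm (R (Complex \<sigma> t)) \<le> C1 * (1 + \<bar>t\<bar>) powr \<epsilon>" using C1(2)[of "Complex \<sigma> t"] \<sigma> by simp
      also have "\<dots> \<le> C1 * (1 + T) powr \<epsilon>"
        using C1(1) t \<epsilon> by (intro mult_left_mono powr_mono2) auto
      finally show "norm (R (Complex \<sigma> t)) \<le> C1 * (1 + T) powr \<epsilon>" .
    qed (use T C1 in auto)
    also have "exp (u * \<sigma>) = real X powr (\<sigma> / real k)" using X by (simp add: u_def powr_def)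
    finally have I: "norm (\<Sum>d\<in>{1..N}. of_real (char4 (-1) d) * integral {-T..T} (f d)) \<le>
       180 * real k * C1 * ((1 + T) powr \<epsilon> * real X powr (\<sigma> / real k) * Q * (1 + ln (1 + T)))"
      unfolding G by (simp only: mult_ac)
    have "norm (of_real (2 * pi * S) - (\<Sum>d\<in>{1..N}. of_real (char4 (-1) d) * integral {-T..T} (f d))) =
       norm (\<Sum>d\<in>{1..N}. of_real (char4 (-1) d) * (of_real (2 * pi * mob_sum e (y d)) - integral {-T..T} (f d)))"
      by (simp add: S_def sum_distrib_left right_diff_distrib sum_subtractf mult_ac)
    also have "\<dots> \<le> (\<Sum>d\<in>{1..N}. 2 * pi + 4 * C2)"
    proof (rule sum_norm_le)
      fix d assume d: "d \<in> {1..N}"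
      have "norm (of_real (char4 (-1) d) :: complex) * norm (of_real (2 * pi * mob_sum e (y d)) - integral {-T..T} (f d)) \<le> 1 * (2 * pi + 4 * C2)"
        using abs_char4_le[of "-1" d] by (intro mult_mono yd[OF d]) auto
      then show "norm (of_real (char4 (-1) d) * (of_real (2 * pi * mob_sum e (y d)) - integral {-T..T} (f d))) \<le> 2 * pi + 4 * C2"
        by (simp only: norm_mult mult_1)
    qed
    also have "\<dots> = (2 * pi + 4 * C2) * real N" by simp
    finally have "norm (of_real (2 * pi * S) :: complex) \<le> (2 * pi + 4 * C2) * real N +
       180 * real k * C1 * ((1 + T) powr \<epsilon> * real X powr (\<sigma> / real k) * Q * (1 + ln (1 + T)))"
      using I norm_triangle_sub order_trans add_mono by (smt (verit, best))
    moreover have "norm (of_real (2 * pi * S) :: complex) = 2 * pi * \<bar>S\<bar>" by (simp add: norm_mult)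
    moreover have "1 * \<bar>S\<bar> \<le> 2 * pi * \<bar>S\<bar>" using pi_ge_two by (intro mult_right_mono) auto
    ultimately have S: "\<bar>S\<bar> \<le> (2 * pi + 4 * C2) * real N +
       180 * real k * C1 * ((1 + T) powr \<epsilon> * real X powr (\<sigma> / real k) * Q * (1 + ln (1 + T)))" by linarith
    define Z where "Z = (1 + T) powr \<epsilon> * real X powr (\<sigma> / real k) * Q * (1 + ln (1 + T))"
    have Z0: "Z \<ge> 0" using T N unfolding Z_def Q_def by (intro mult_nonneg_nonneg add_nonneg_nonneg) auto
    have "(2 * pi + 4 * C2) * real N \<le> C * real N" "180 * real k * C1 * Z \<le> C * Z"
      using C1(1) C2(1) Z0 by (auto intro!: mult_right_mono simp: C_def)
    then have "\<bar>S\<bar> \<le> C * real N + C * Z" using S unfolding Z_def by linarith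
    then show ?thesis unfolding S_eq by (simp only: Z_def Q_def T_def distrib_left)
  qed
  then show ?thesis using C0 by blast
qed

lemma kfree_char_sum_bound:
  assumes GRH: "generalized_riemann_hypothesis" and k: "k \<ge> 2" and \<epsilon>0: "\<epsilon>0 > 0"
  shows "\<exists>C\<ge>0. \<forall>X::nat. X \<ge> 1 \<longrightarrow> \<bar>\<Sum>n\<in>{1..X}. kfree_char k n\<bar> \<le> C * real X powr (1 / (real k + 1) + \<epsilon>0)"
proof -
  \<comment> \<open>Six small losses have to fit into \<open>\<epsilon>0\<close>: three from the
    power of \<open>1 + 2 * X ^ 3\<close>, one from each of the two logarithms, and one from
    \<open>\<sigma> = 1/2 + \<epsilon>\<close>.\<close>
  define \<epsilon> where "\<epsilon> = min \<epsilon>0 1 / 6"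
  have \<epsilon>: "\<epsilon> > 0" "\<epsilon> \<le> 1/2" "\<epsilon> \<le> 1" "6 * \<epsilon> \<le> \<epsilon>0" using \<epsilon>0 by (auto simp: \<epsilon>_def)
  define e :: real where "e = (-1) ^ k"
  have e: "e\<^sup>2 = 1" by (simp add: e_def flip: power_mult)
  define \<sigma> where "\<sigma> = 1/2 + \<epsilon>"
  from sum_char_mob_bound[OF GRH k \<epsilon>(1,2,1) e] obtain C where C: "C \<ge> 0"
    "\<And>X N. N \<ge> 1 \<Longrightarrow> N \<le> X \<Longrightarrow>
    \<bar>\<Sum>d\<in>{1..N}. char4 (-1) d * (\<Sum>m | m \<ge> 1 \<and> m ^ k * d \<le> X. mob_char e m)\<bar> \<le>
      C * (real N + (1 + 2 * real X ^ 3) powr \<epsilon> * real X powr (\<sigma> / real k) *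
         (real N powr (1/2 - \<sigma> / real k) * (1 + ln (real N))) * (1 + ln (1 + 2 * real X ^ 3)))"
    unfolding \<sigma>_def by blast
  define K where "K = 3 * 2 * (1 + 1 / \<epsilon>) * (3 + 3 / \<epsilon>)"
  have K0: "K \<ge> 0" using \<epsilon> by (simp add: K_def)
  have "\<bar>\<Sum>n\<in>{1..X}. kfree_char k n\<bar> \<le> (4 + C * (2 + K)) * real X powr (1 / (real k + 1) + \<epsilon>0)" if X: "X \<ge> 1" for X :: nat
  proof -
    define r where "r = real X powr (1 / (real k + 1))"
    \<comment> \<open>Rounding up ensures \<open>X \<le> z ^ (k + 1)\<close>, and
      \<open>r \<ge> 1\<close> limits the loss to a factor 2.\<close>
    define z where "z = nat \<lceil>r\<rceil>"
    define P where "P = real X powr (1 / (real k + 1) + \<epsilon>0)"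
    have X1: "real X \<ge> 1" using X by simp
    have r1: "r \<ge> 1" unfolding r_def using X1 by (intro ge_one_powr_ge_zero) auto
    have z: "z \<ge> 1" "r \<le> real z" "real z \<le> 2 * r" unfolding z_def using r1 by linarith+
    have rP: "r \<le> P" unfolding r_def P_def using X1 \<epsilon>0 by (intro powr_mono) auto
    have "real X = r powr (real k + 1)" unfolding r_def using X1 by (simp add: powr_powr)
    also have "\<dots> = r ^ (k + 1)" using powr_realpow[of r "k + 1"] r1 by (simp add: add.commute)
    also have "\<dots> \<le> real z ^ (k + 1)" using z r1 by (intro power_mono) auto
    finally have Xz: "X \<le> z ^ (k + 1)" by (simp only: of_nat_power[symmetric] of_nat_le_iff)
    define N where "N = X div z ^ k"
    have k1: "k \<ge> 1" using k by simp
    note red = kfree_char_sum_reduction[OF k1 z(1) Xz, folded N_def e_def]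
    have Nz: "real N \<le> 2 * r" using red(1) z(3) by linarith
    have main: "\<bar>\<Sum>d\<in>{1..N}. char4 (-1) d * (\<Sum>m | m \<ge> 1 \<and> m ^ k * d \<le> X. mob_char e m)\<bar> \<le> C * (2 * P + K * P)"
    proof (cases "N = 0")
      case True
      then show ?thesis using C K0 by (simp add: P_def)
    next
      case False
      then have N: "N \<ge> 1" "N \<le> X" by (auto simp: N_def)
      have lnX: "0 \<le> ln (real X)" "ln (real X) \<le> real X powr \<epsilon> / \<epsilon>"
        using X1 \<epsilon> by (auto intro: ln_powr_bound)
      have Xe: "1 \<le> real X powr \<epsilon>" using X1 \<epsilon> by (intro ge_one_powr_ge_zero) auto
      have X3: "1 + 2 * real X ^ 3 \<le> 3 * real X ^ 3" using X1 by simp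
      have a1: "(1 + 2 * real X ^ 3) powr \<epsilon> \<le> 3 * real X powr (3 * \<epsilon>)"
      proof -
        have "(1 + 2 * real X ^ 3) powr \<epsilon> \<le> (3 * real X ^ 3) powr \<epsilon>" using X3 \<epsilon> by (intro powr_mono2) auto
        also have "\<dots> = 3 powr \<epsilon> * (real X ^ 3) powr \<epsilon>" by (rule powr_mult)
        also have "\<dots> \<le> 3 powr 1 * (real X ^ 3) powr \<epsilon>" using \<epsilon> by (intro mult_right_mono powr_mono) auto
        also have "real X ^ 3 = real X powr 3" using X1 by simp
        also have "(real X powr 3) powr \<epsilon> = real X powr (3 * \<epsilon>)" by (rule powr_powr)
        finally show ?thesis by simp
      qed
      have a2: "1 + ln (real N) \<le> (1 + 1 / \<epsilon>) * real X powr \<epsilon>"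
      proof -
        have "ln (real N) \<le> ln (real X)" using N by simp
        then have "1 + ln (real N) \<le> real X powr \<epsilon> + real X powr \<epsilon> / \<epsilon>" using lnX Xe by linarith
        then show ?thesis by (simp add: distrib_right)
      qed
      have a3: "1 + ln (1 + 2 * real X ^ 3) \<le> (3 + 3 / \<epsilon>) * real X powr \<epsilon>"
      proof -
        have "ln (1 + 2 * real X ^ 3) \<le> ln (3 * real X ^ 3)" using X3 X1 by (intro ln_mono) (auto simp: add_pos_nonneg)
        also have "\<dots> = ln 3 + 3 * ln (real X)" using X1 by (simp add: ln_mult ln_realpow)
        finally have "ln (1 + 2 * real X ^ 3) \<le> ln 3 + 3 * ln (real X)" .
        moreover have "ln 3 \<le> (3 - 1 :: real)" by (rule ln_le_minus_one) simp
        ultimately have "1 + ln (1 + 2 * real X ^ 3) \<le> 3 * real X powr \<epsilon> + 3 * (real X powr \<epsilon> / \<epsilon>)" using lnX Xe by linarith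
        then show ?thesis by (simp add: distrib_right)
      qed
      \<comment> \<open>Non-negativity of this exponent, from \<open>\<sigma> \<le> 1\<close> and
        \<open>k \<ge> 2\<close>, allows \<open>N\<close> to be replaced by its upper bound
        \<open>2 * r\<close>.\<close>
      have \<sigma>k: "0 \<le> 1/2 - \<sigma> / real k" "1/2 - \<sigma> / real k \<le> 1"
      proof -
        have "\<sigma> / real k \<le> 1 / 2" using \<epsilon> k unfolding \<sigma>_def by (intro frac_le) auto
        then show "0 \<le> 1/2 - \<sigma> / real k" by simp
        have "0 \<le> \<sigma> / real k" using \<epsilon> by (simp add: \<sigma>_def)
        then show "1/2 - \<sigma> / real k \<le> 1" by simp
      qed
      have a4: "real N powr (1/2 - \<sigma> / real k) \<le> 2 * real X powr ((1/2 - \<sigma> / real k) / (real k + 1))"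
      proof -
        have "real N powr (1/2 - \<sigma> / real k) \<le> (2 * r) powr (1/2 - \<sigma> / real k)" using Nz \<sigma>k by (intro powr_mono2) auto
        also have "\<dots> = 2 powr (1/2 - \<sigma> / real k) * r powr (1/2 - \<sigma> / real k)" using r1 by (simp add: powr_mult)
        also have "\<dots> \<le> 2 powr 1 * r powr (1/2 - \<sigma> / real k)" using \<sigma>k by (intro mult_right_mono powr_mono) auto
        finally show ?thesis by (simp add: r_def powr_powr mult.commute)
      qed
      have "(1 + 2 * real X ^ 3) powr \<epsilon> * real X powr (\<sigma> / real k) *
         (real N powr (1/2 - \<sigma> / real k) * (1 + ln (real N))) * (1 + ln (1 + 2 * real X ^ 3)) \<le>
         (3 * real X powr (3 * \<epsilon>)) * real X powr (\<sigma> / real k) *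
         ((2 * real X powr ((1/2 - \<sigma> / real k) / (real k + 1))) * ((1 + 1 / \<epsilon>) * real X powr \<epsilon>)) * ((3 + 3 / \<epsilon>) * real X powr \<epsilon>)"
        using a1 a2 a3 a4 \<epsilon> N X1
        by (intro mult_mono) (auto intro!: mult_nonneg_nonneg add_nonneg_nonneg)
      also have "\<dots> = K * (real X powr (3 * \<epsilon>) * real X powr (\<sigma> / real k) * real X powr ((1/2 - \<sigma> / real k) / (real k + 1)) * real X powr \<epsilon> * real X powr \<epsilon>)"
        by (simp add: K_def)
      also have "real X powr (3 * \<epsilon>) * real X powr (\<sigma> / real k) * real X powr ((1/2 - \<sigma> / real k) / (real k + 1)) * real X powr \<epsilon> * real X powr \<epsilon>
          = real X powr (3 * \<epsilon> + \<sigma> / real k + (1/2 - \<sigma> / real k) / (real k + 1) + \<epsilon> + \<epsilon>)"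
        by (simp only: powr_add)
      \<comment> \<open>The balance that produces the exponent of the theorem: the terms
        \<open>\<sigma> / k\<close> combine to \<open>\<sigma> / (k + 1)\<close>, and
        \<open>\<sigma> + 1/2 = 1 + \<epsilon>\<close>.\<close>
      also have "3 * \<epsilon> + \<sigma> / real k + (1/2 - \<sigma> / real k) / (real k + 1) + \<epsilon> + \<epsilon> = 5 * \<epsilon> + (1 + \<epsilon>) / (real k + 1)"
      proof -
        have "\<sigma> / real k + (1/2 - \<sigma> / real k) / (real k + 1) = (\<sigma> + 1/2) / (real k + 1)"
          using k by (simp add: divide_simps) (simp add: algebra_simps)
        also have "\<sigma> + 1/2 = 1 + \<epsilon>" by (simp add: \<sigma>_def)
        finally show ?thesis by linarith
      qed
      also have "K * real X powr (5 * \<epsilon> + (1 + \<epsilon>) / (real k + 1)) \<le> K * P"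
      proof (rule mult_left_mono[OF _ K0])
        have "\<epsilon> / (real k + 1) \<le> \<epsilon> / 1" using \<epsilon> by (intro divide_left_mono) auto
        then have "5 * \<epsilon> + (1 + \<epsilon>) / (real k + 1) \<le> 1 / (real k + 1) + \<epsilon>0" using \<epsilon>(4) by (simp add: add_divide_distrib)
        then show "real X powr (5 * \<epsilon> + (1 + \<epsilon>) / (real k + 1)) \<le> P" unfolding P_def using X1 by (intro powr_mono) auto
      qed
      finally have "real N + (1 + 2 * real X ^ 3) powr \<epsilon> * real X powr (\<sigma> / real k) *
         (real N powr (1/2 - \<sigma> / real k) * (1 + ln (real N))) * (1 + ln (1 + 2 * real X ^ 3)) \<le> 2 * P + K * P"
        using Nz rP by linarith
      then show ?thesis using C(2)[OF N] C(1) by (meson mult_left_mono order_trans)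
    qed
    have "\<bar>\<Sum>n\<in>{1..X}. kfree_char k n\<bar> \<le> 2 * real z + C * (2 * P + K * P)"
      using red(2) main by linarith
    also have "\<dots> \<le> 4 * P + C * (2 * P + K * P)" using z(3) rP by linarith
    also have "\<dots> = (4 + C * (2 + K)) * P" by (simp add: algebra_simps)
    finally show ?thesis by (simp add: P_def)
  qed
  moreover have "4 + C * (2 + K) \<ge> 0" using C(1) K0 by simp
  ultimately show ?thesis by blast
qed

theorem theorem1:
  fixes k :: nat
  assumes "k \<ge> 2"
    and "generalized_riemann_hypothesis"
  shows "\<exists>f :: nat \<Rightarrow> real.
    (\<forall>n>0. f n \<in> {-1, 0, 1}) \<and>
    multiplicative_fun f \<and>
    (\<forall>n>0. \<not> k_free k n \<longrightarrow> f n = 0) \<and>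
    (\<forall>p. prime p \<longrightarrow> f p \<in> {-1, 1}) \<and>
    (\<forall>\<epsilon>::real. \<epsilon> > 0 \<longrightarrow>
      (\<lambda>x::real. \<Sum>n\<in>{1..nat \<lfloor>x\<rfloor>}. f n) \<in> O(\<lambda>x. x powr (1 / (real k + 1) + \<epsilon>)))"
proof -
  define a where "a = kfree_char k"
  \<comment> \<open>The Dirichlet series of \<open>a\<close> is multiplied by
    \<open>1 + 2 ^ (-s)\<close>. As \<open>a\<close> vanishes at even numbers, this sets
    \<open>f 2 = 1\<close> and leaves 0 at all multiples of 4.\<close>
  define f where "f = (\<lambda>n. a n + (if even n then a (n div 2) else 0))"
  have a_even: "a n = 0" if "even n" for n
    using that by (simp add: a_def kfree_char_def char4_eq_0_iff)
  have a_mult: "a (m * n) = a m * a n" if "coprime m n" "m > 0" "n > 0" for m n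
    using that by (simp add: a_def kfree_char_def char4_mult k_free_mult_coprime)
  have a_in: "a n \<in> {-1, 0, 1}" for n
    using char4_minus1_in[of n] by (auto simp: a_def kfree_char_def)
  have f_odd: "f n = a n" if "odd n" for n using that by (simp add: f_def)
  have f_even: "f n = a (n div 2)" if "even n" for n using that by (simp add: f_def a_even)
  have kf2: "k_free k 2"
  proof -
    have "\<not> p ^ k dvd 2" if p: "prime p" for p :: nat
    proof
      assume "p ^ k dvd 2"
      then have "p ^ k \<le> 2" by (rule dvd_imp_le) simp
      moreover have "(2::nat) ^ 2 \<le> p ^ 2" using prime_ge_2_nat[OF p] by (intro power_mono) auto
      moreover have "p ^ 2 \<le> p ^ k" using prime_ge_2_nat[OF p] assms(1) by (intro power_increasing) auto
      ultimately show False by simp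
    qed
    then show ?thesis by (simp add: k_free_def)
  qed
  have f_kfree: "k_free k n" if n: "n > 0" "f n \<noteq> 0" for n
  proof (cases "even n")
    case False
    then show ?thesis using n f_odd[of n] by (simp add: a_def kfree_char_def split: if_splits)
  next
    case True
    then obtain j where j: "n = 2 * j" by blast
    have aj: "a j \<noteq> 0" using n f_even[OF True] by (simp add: j)
    then have "odd j" "k_free k j" using a_even by (auto simp: a_def kfree_char_def)
    then show ?thesis unfolding j using kf2 n j by (subst k_free_mult_coprime) auto
  qed
  have f_mult: "f (m * n) = f m * f n" if mn: "m > 0" "n > 0" "coprime m n" for m n
  proof -
    \<comment> \<open>Coprimality lets at most one of the two arguments be even; by symmetry it may
      be \<open>m\<close>.\<close>
    have ev: "f (m * n) = f m * f n" if mn: "m > 0" "n > 0" "coprime m n" "even m" for m n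
    proof -
      obtain j where j: "m = 2 * j" using mn(4) by blast
      have "odd n" using mn(3,4) by (metis coprime_common_divisor odd_one)
      moreover have "coprime j n" using mn(3) by (simp add: j)
      moreover have "m * n div 2 = j * n" by (simp add: j)
      ultimately show ?thesis using mn j by (simp add: f_even f_odd a_mult)
    qed
    consider "even m" | "even n" | "odd m" "odd n" by blast
    then show ?thesis
    proof cases
      case 1 then show ?thesis using ev mn by blast
    next
      case 2 then show ?thesis using ev[of n m] mn by (simp add: mult.commute coprime_commute)
    next
      case 3 then show ?thesis using a_mult mn by (simp add: f_odd)
    qed
  qed
  have f_prime: "f p \<in> {-1, 1}" if p: "prime p" for p
  proof (cases "p = 2")
    case True
    have "k_free k 1" using assms(1) by (auto simp: k_free_def prime_nat_iff)
    then show ?thesis using True by (simp add: f_even a_def kfree_char_def)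
  next
    case False
    then have "odd p" using p by (metis primes_dvd_imp_eq two_is_prime_nat)
    moreover have "k_free k p"
    proof -
      have "\<not> q ^ k dvd p" if q: "prime q" for q
      proof
        assume d: "q ^ k dvd p"
        have "q ^ 1 dvd q ^ k" using assms(1) by (intro le_imp_power_dvd) auto
        then have "q = p" using d p q by (metis dvd_trans power_one_right primes_dvd_imp_eq)
        then have "p ^ k \<le> p" using d prime_gt_0_nat[OF p] dvd_imp_le[of "q ^ k" p] by (simp only:)
        moreover have "p ^ 1 < p ^ k" using assms(1) prime_gt_1_nat[OF p] by (intro power_strict_increasing) auto
        ultimately show False by simp
      qed
      then show ?thesis using p by (simp add: k_free_def prime_gt_0_nat)
    qed
    ultimately have "a p \<noteq> 0" by (simp add: a_def kfree_char_def char4_eq_0_iff)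
    then show ?thesis using a_in[of p] f_odd[OF \<open>odd p\<close>] by auto
  qed
  have f_sum: "(\<Sum>n\<in>{1..X}. f n) = (\<Sum>n\<in>{1..X}. a n) + (\<Sum>n\<in>{1..X div 2}. a n)" for X
  proof -
    have "(\<Sum>n\<in>{1..X}. if even n then a (n div 2) else 0) = (\<Sum>n | n \<in> {1..X} \<and> even n. a (n div 2))"
      by (subst sum.inter_filter) auto
    also have "\<dots> = (\<Sum>n\<in>{1..X div 2}. a n)"
      by (rule sum.reindex_bij_witness[of _ "\<lambda>j. 2 * j" "\<lambda>n. n div 2"]) auto
    finally show ?thesis by (simp add: f_def sum.distrib)
  qed
  have f_O: "(\<lambda>x::real. \<Sum>n\<in>{1..nat \<lfloor>x\<rfloor>}. f n) \<in> O(\<lambda>x. x powr (1 / (real k + 1) + \<epsilon>))" if \<epsilon>: "\<epsilon> > 0" for \<epsilon> :: real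
  proof -
    from kfree_char_sum_bound[OF assms(2,1) \<epsilon>] obtain C where C: "C \<ge> 0"
      "\<And>X::nat. X \<ge> 1 \<Longrightarrow> \<bar>\<Sum>n\<in>{1..X}. a n\<bar> \<le> C * real X powr (1 / (real k + 1) + \<epsilon>)"
      unfolding a_def by blast
    \<comment> \<open>Stated for every \<open>X \<le> x\<close> so that it serves for both
      \<open>X\<close> and \<open>X div 2\<close>; the latter can be 0, when the sum is
      empty.\<close>
    have *: "\<bar>\<Sum>n\<in>{1..X}. a n\<bar> \<le> C * x powr (1 / (real k + 1) + \<epsilon>)" if "real X \<le> x" for X x
    proof (cases "X = 0")
      case True
      then show ?thesis using C(1) by simp
    next
      case False
      then have "\<bar>\<Sum>n\<in>{1..X}. a n\<bar> \<le> C * real X powr (1 / (real k + 1) + \<epsilon>)" by (intro C(2)) simp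
      also have "\<dots> \<le> C * x powr (1 / (real k + 1) + \<epsilon>)"
        using C(1) that \<epsilon> by (intro mult_left_mono powr_mono2) auto
      finally show ?thesis .
    qed
    show ?thesis
    proof (rule bigoI[of _ "2 * C"])
      show "\<forall>\<^sub>F x in at_top. norm (\<Sum>n\<in>{1..nat \<lfloor>x\<rfloor>}. f n) \<le> 2 * C * norm (x powr (1 / (real k + 1) + \<epsilon>))"
        using eventually_ge_at_top[of "1::real"]
      proof eventually_elim
        case (elim x)
        have X: "real (nat \<lfloor>x\<rfloor>) \<le> x" using elim by linarith
        moreover have "real (nat \<lfloor>x\<rfloor> div 2) \<le> real (nat \<lfloor>x\<rfloor>)" by (simp add: div_le_dividend)
        ultimately have X2: "real (nat \<lfloor>x\<rfloor> div 2) \<le> x" by linarith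
        have "\<bar>\<Sum>n\<in>{1..nat \<lfloor>x\<rfloor>}. f n\<bar> \<le> C * x powr (1 / (real k + 1) + \<epsilon>) + C * x powr (1 / (real k + 1) + \<epsilon>)"
          unfolding f_sum by (rule order.trans[OF abs_triangle_ineq add_mono[OF *[OF X] *[OF X2]]])
        then show ?case by simp
      qed
    qed
  qed
  have f_in: "f n \<in> {-1, 0, 1}" for n
    using a_in[of n] a_in[of "n div 2"] a_even[of n] by (auto simp: f_def)
  show ?thesis
    using f_in f_mult f_kfree f_prime f_O by (intro exI[of _ f]) (auto simp: multiplicative_fun_def)
qed

end
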